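(* Let $k$ be a field, let $G$ be a simple graph with vertex set $V_G$, and let $S \subset V_G$. Suppose that $G \backslash S$ is a chordal graph or a five-cycle $C_5$. Then $G \cup W(S)$ is a sequentially Cohen-Macaulay graph (over $k$).
   Context: A simple graph $G=(V_G,E_G)$ is a finite graph with no loops or multiple edges. For $S \subset V_G$, $G \backslash S$ denotes the subgraph obtained from $G$ by removing the vertices in $S$ and all edges incident to at least one of these vertices. If $S=\{y_1,\dots,y_n\}$, then $G \cup W(S)$ denotes the graph obtained from $G$ by adding a whisker at each vertex of $S$: one adds $n$ new distinct vertices $x_1,\dots,x_n$ and the edges $x_1y_1,\dots,x_ny_n$. A graph is chordal if for all $m\ge 4$ every $m$-cycle in it has a chord, i.e. an edge connecting two non-consecutive vertices of the cycle. $C_m$ denotes the cycle with $m$ vertices. The edge ideal of a graph $G$ on vertices $x_1,\dots,x_n$ is $\mathcal{I}(G)=(x_ix_j \mid \{x_i,x_j\}\in E_G)\subset R=k[x_1,\dots,x_n]$, where the vertices are identified with the variables. A finitely generated graded $R$-module $M$ is sequentially Cohen-Macaulay if there is a filtration $0=M_0\subset M_1\subset\cdots\subset M_r=M$ by graded $R$-modules such that each $M_i/M_{i-1}$ is Cohen-Macaulay and $\dim M_i/M_{i-1}<\dim M_{i+1}/M_i$ for all $i$ (Krull dimension). A graph $G$ is sequentially Cohen-Macaulay (over $k$) if $R/\mathcal{I}(G)$ is a sequentially Cohen-Macaulay $R$-module. *)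

theory Defs
  imports
    "HOL-Algebra.Algebra"
    "HOL-Library.Poly_Mapping"
    "HOL-Library.Extended_Real"
begin

section \<open>Graphs\<close>

record 'a graph =
  verts :: "'a set"
  edges :: "'a set set"

definition simple_graph :: "'a graph \<Rightarrow> bool" where
  "simple_graph G \<longleftrightarrow> finite (verts G) \<and>
    (\<forall>e\<in>edges G. \<exists>u v. u \<in> verts G \<and> v \<in> verts G \<and> u \<noteq> v \<and> e = {u, v})"

definition delete_verts :: "'a graph \<Rightarrow> 'a set \<Rightarrow> 'a graph" where
  "delete_verts G S = \<lparr>verts = verts G - S, edges = {e \<in> edges G. e \<inter> S = {}}\<rparr>"

text \<open>The vertices of \<^term>\<open>G\<close> are embedded by \<^const>\<open>Inl\<close>; the new vertex at the other end of
  the whisker at \<^term>\<open>y \<in> S\<close> is \<^term>\<open>Inr y\<close>.\<close>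

definition add_whiskers :: "'a graph \<Rightarrow> 'a set \<Rightarrow> ('a + 'a) graph" where
  "add_whiskers G S =
    \<lparr>verts = Inl ` verts G \<union> Inr ` S,
     edges = (\<lambda>e. Inl ` e) ` edges G \<union> (\<lambda>y. {Inr y, Inl y}) ` S\<rparr>"

text \<open>A cycle in a graph is given by the list of its vertices, in cyclic order.\<close>

definition cycle_edges :: "'a list \<Rightarrow> 'a set set" where
  "cycle_edges c = {{c ! i, c ! (Suc i mod length c)} | i. i < length c}"

definition is_cycle_in :: "'a graph \<Rightarrow> 'a list \<Rightarrow> bool" where
  "is_cycle_in G c \<longleftrightarrow>
    3 \<le> length c \<and> distinct c \<and> set c \<subseteq> verts G \<and> cycle_edges c \<subseteq> edges G"

definition has_chord :: "'a graph \<Rightarrow> 'a list \<Rightarrow> bool" where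
  "has_chord G c \<longleftrightarrow>
    (\<exists>i j. i < length c \<and> j < length c \<and> i \<noteq> j \<and>
       j \<noteq> Suc i mod length c \<and> i \<noteq> Suc j mod length c \<and> {c ! i, c ! j} \<in> edges G)"

definition chordal :: "'a graph \<Rightarrow> bool" where
  "chordal G \<longleftrightarrow> (\<forall>c. is_cycle_in G c \<and> 4 \<le> length c \<longrightarrow> has_chord G c)"

text \<open>\<open>is_cycle_graph m G\<close> says that the whole graph \<^term>\<open>G\<close> is a cycle $C_m$ ($m \ge 3$).\<close>

definition is_cycle_graph :: "nat \<Rightarrow> 'a graph \<Rightarrow> bool" where
  "is_cycle_graph m G \<longleftrightarrow>
    (\<exists>c. length c = m \<and> 3 \<le> m \<and> distinct c \<and> verts G = set c \<and> edges G = cycle_edges c)"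


section \<open>Modules\<close>

definition ring_as_module :: "('a, 'c) ring_scheme \<Rightarrow> ('a, 'a) module" where
  "ring_as_module R =
    \<lparr>carrier = carrier R, monoid.mult = monoid.mult R, one = \<one>\<^bsub>R\<^esub>, ring.zero = \<zero>\<^bsub>R\<^esub>, ring.add = ring.add R,
     smult = monoid.mult R\<rparr>"

text \<open>The quotient of a module by a submodule \<^term>\<open>N\<close>; the submodule \<^term>\<open>N\<close> itself, seen as
  a module, is \<^term>\<open>M\<lparr>carrier := N\<rparr>\<close>.  The type of module records extends that of ring
  records, but the fields \<^const>\<open>monoid.mult\<close> and \<^const>\<open>one\<close> play no role for modules.\<close>

definition quot_module :: "('r, 'm, 'c) module_scheme \<Rightarrow> 'm set \<Rightarrow> ('r, 'm set) module" where
  "quot_module M N =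
    \<lparr>carrier = a_rcosets\<^bsub>M\<^esub> N, monoid.mult = (\<lambda>_ _. undefined), one = undefined,
     ring.zero = N, ring.add = set_add M,
     smult = (\<lambda>r C. \<Union>x\<in>C. N +>\<^bsub>M\<^esub> (r \<odot>\<^bsub>M\<^esub> x))\<rparr>"

definition gen_submodule ::
  "('r, 'c) ring_scheme \<Rightarrow> ('r, 'm, 'd) module_scheme \<Rightarrow> 'm set \<Rightarrow> 'm set" where
  "gen_submodule R M A = \<Inter>{N. submodule N R M \<and> A \<subseteq> N}"

definition fin_gen_module ::
  "('r, 'c) ring_scheme \<Rightarrow> ('r, 'm, 'd) module_scheme \<Rightarrow> bool" where
  "fin_gen_module R M \<longleftrightarrow>
    (\<exists>A. finite A \<and> A \<subseteq> carrier M \<and> gen_submodule R M A = carrier M)"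

definition annihilator ::
  "('r, 'c) ring_scheme \<Rightarrow> ('r, 'm, 'd) module_scheme \<Rightarrow> 'r set" where
  "annihilator R M = {r \<in> carrier R. \<forall>x\<in>carrier M. r \<odot>\<^bsub>M\<^esub> x = \<zero>\<^bsub>M\<^esub>}"

text \<open>The Krull dimension of $M$ is that of $R/\mathrm{Ann}\,M$, that is, the supremum of the
  lengths of chains of prime ideals of $R$ containing $\mathrm{Ann}\,M$.  The values are extended
  reals so that the zero module has dimension $-\infty$.\<close>

definition krull_dim ::
  "('r, 'c) ring_scheme \<Rightarrow> ('r, 'm, 'd) module_scheme \<Rightarrow> ereal" where
  "krull_dim R M =
    Sup {ereal (real n) | n. \<exists>P :: nat \<Rightarrow> 'r set.
      (\<forall>i\<le>n. primeideal (P i) R \<and> annihilator R M \<subseteq> P i) \<and> (\<forall>i<n. P i \<subset> P (Suc i))}"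

text \<open>The submodule $(r_1, \dots, r_n) M$.\<close>

definition list_smult_module ::
  "('r, 'c) ring_scheme \<Rightarrow> ('r, 'm, 'd) module_scheme \<Rightarrow> 'r list \<Rightarrow> 'm set" where
  "list_smult_module R M rs =
    gen_submodule R M {r \<odot>\<^bsub>M\<^esub> x | r x. r \<in> set rs \<and> x \<in> carrier M}"

definition nonzerodivisor_on :: "('r, 'm, 'd) module_scheme \<Rightarrow> 'r \<Rightarrow> bool" where
  "nonzerodivisor_on M r \<longleftrightarrow> (\<forall>x\<in>carrier M. r \<odot>\<^bsub>M\<^esub> x = \<zero>\<^bsub>M\<^esub> \<longrightarrow> x = \<zero>\<^bsub>M\<^esub>)"

definition regular_sequence ::
  "('r, 'c) ring_scheme \<Rightarrow> ('r, 'm, 'd) module_scheme \<Rightarrow> 'r list \<Rightarrow> bool" where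
  "regular_sequence R M rs \<longleftrightarrow>
    set rs \<subseteq> carrier R \<and>
    (\<forall>i<length rs.
       nonzerodivisor_on (quot_module M (list_smult_module R M (take i rs))) (rs ! i)) \<and>
    list_smult_module R M rs \<noteq> carrier M"

definition depth ::
  "('r, 'c) ring_scheme \<Rightarrow> 'r set \<Rightarrow> ('r, 'm, 'd) module_scheme \<Rightarrow> ereal" where
  "depth R I M =
    Sup {ereal (real (length rs)) | rs. set rs \<subseteq> I \<and> regular_sequence R M rs}"

text \<open>Here \<^term>\<open>I\<close> is meant to be the irrelevant maximal ideal of a graded ring.  The zero module
  is Cohen-Macaulay: it has no regular sequences in the above sense, so both sides are
  $-\infty$.\<close>

definition cohen_macaulay ::
  "('r, 'c) ring_scheme \<Rightarrow> 'r set \<Rightarrow> ('r, 'm, 'd) module_scheme \<Rightarrow> bool" where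
  "cohen_macaulay R I M \<longleftrightarrow> depth R I M = krull_dim R M"


section \<open>Graded modules\<close>

text \<open>Gradings are by the integers; \<^term>\<open>Rg i\<close> and \<^term>\<open>Mg i\<close> are the homogeneous components
  of degree \<^term>\<open>i\<close> of the ring and of the module.\<close>

definition graded_module ::
  "('r, 'c) ring_scheme \<Rightarrow> (int \<Rightarrow> 'r set) \<Rightarrow> ('r, 'm, 'd) module_scheme \<Rightarrow> (int \<Rightarrow> 'm set) \<Rightarrow> bool"
  where
  "graded_module R Rg M Mg \<longleftrightarrow>
    module R M \<and>
    (\<forall>i. additive_subgroup (Mg i) M) \<and>
    (\<forall>i j. \<forall>r\<in>Rg i. \<forall>x\<in>Mg j. r \<odot>\<^bsub>M\<^esub> x \<in> Mg (i + j)) \<and>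
    (\<forall>x\<in>carrier M. \<exists>!c. (\<forall>i. c i \<in> Mg i) \<and> finite {i. c i \<noteq> \<zero>\<^bsub>M\<^esub>} \<and>
       x = finsum M c {i. c i \<noteq> \<zero>\<^bsub>M\<^esub>})"

definition graded_submodule ::
  "('r, 'c) ring_scheme \<Rightarrow> (int \<Rightarrow> 'r set) \<Rightarrow> ('r, 'm, 'd) module_scheme \<Rightarrow> (int \<Rightarrow> 'm set) \<Rightarrow>
    'm set \<Rightarrow> bool" where
  "graded_submodule R Rg M Mg N \<longleftrightarrow>
    submodule N R M \<and> graded_module R Rg (M\<lparr>carrier := N\<rparr>) (\<lambda>i. Mg i \<inter> N)"

definition irrelevant_ideal :: "('r, 'c) ring_scheme \<Rightarrow> (int \<Rightarrow> 'r set) \<Rightarrow> 'r set" where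
  "irrelevant_ideal R Rg = Idl\<^bsub>R\<^esub> (\<Union>i\<in>{0<..}. Rg i)"

definition sequentially_cohen_macaulay ::
  "('r, 'c) ring_scheme \<Rightarrow> (int \<Rightarrow> 'r set) \<Rightarrow> ('r, 'm, 'd) module_scheme \<Rightarrow> (int \<Rightarrow> 'm set) \<Rightarrow> bool"
  where
  "sequentially_cohen_macaulay R Rg M Mg \<longleftrightarrow>
    graded_module R Rg M Mg \<and> fin_gen_module R M \<and>
    (\<exists>(r :: nat) N. N 0 = {\<zero>\<^bsub>M\<^esub>} \<and> N r = carrier M \<and>
      (\<forall>i\<le>r. graded_submodule R Rg M Mg (N i)) \<and>
      (\<forall>i<r. N i \<subset> N (Suc i)) \<and>
      (\<forall>i<r. cohen_macaulay R (irrelevant_ideal R Rg)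
                (quot_module (M\<lparr>carrier := N (Suc i)\<rparr>) (N i))) \<and>
      (\<forall>i. Suc i < r \<longrightarrow>
         krull_dim R (quot_module (M\<lparr>carrier := N (Suc i)\<rparr>) (N i)) <
         krull_dim R (quot_module (M\<lparr>carrier := N (Suc (Suc i))\<rparr>) (N (Suc i)))))"


section \<open>Polynomial rings and edge ideals\<close>

text \<open>A monomial is a finitely supported exponent function \<open>'v \<Rightarrow>\<^sub>0 nat\<close>, and a polynomial is a
  finitely supported coefficient function on monomials.\<close>

definition mpoly_ring :: "'v set \<Rightarrow> (('v \<Rightarrow>\<^sub>0 nat) \<Rightarrow>\<^sub>0 'k::field) ring" where
  "mpoly_ring V =
    \<lparr>carrier = {p. \<forall>m\<in>Poly_Mapping.keys p. Poly_Mapping.keys m \<subseteq> V},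
     monoid.mult = (*), one = 1, ring.zero = 0, ring.add = (+)\<rparr>"

definition poly_var :: "'v \<Rightarrow> (('v \<Rightarrow>\<^sub>0 nat) \<Rightarrow>\<^sub>0 'k::field)" where
  "poly_var v = Poly_Mapping.single (Poly_Mapping.single v 1) 1"

definition monomial_degree :: "('v \<Rightarrow>\<^sub>0 nat) \<Rightarrow> nat" where
  "monomial_degree m = (\<Sum>v\<in>Poly_Mapping.keys m. Poly_Mapping.lookup m v)"

definition mpoly_grading :: "'v set \<Rightarrow> int \<Rightarrow> (('v \<Rightarrow>\<^sub>0 nat) \<Rightarrow>\<^sub>0 'k::field) set" where
  "mpoly_grading V d =
    {p \<in> carrier (mpoly_ring V). \<forall>m\<in>Poly_Mapping.keys p. int (monomial_degree m) = d}"

definition edge_ideal :: "'v graph \<Rightarrow> (('v \<Rightarrow>\<^sub>0 nat) \<Rightarrow>\<^sub>0 'k::field) set" where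
  "edge_ideal G =
    Idl\<^bsub>mpoly_ring (verts G)\<^esub> {poly_var u * poly_var v | u v. {u, v} \<in> edges G}"

definition edge_module ::
  "'v graph \<Rightarrow> (('v \<Rightarrow>\<^sub>0 nat) \<Rightarrow>\<^sub>0 'k::field, (('v \<Rightarrow>\<^sub>0 nat) \<Rightarrow>\<^sub>0 'k) set) module" where
  "edge_module G = quot_module (ring_as_module (mpoly_ring (verts G))) (edge_ideal G)"

definition edge_module_grading ::
  "'v graph \<Rightarrow> int \<Rightarrow> (('v \<Rightarrow>\<^sub>0 nat) \<Rightarrow>\<^sub>0 'k::field) set set" where
  "edge_module_grading G d =
    (\<lambda>p. edge_ideal G +>\<^bsub>mpoly_ring (verts G)\<^esub> p) ` mpoly_grading (verts G) d"

definition sequentially_cohen_macaulay_graph :: "'k::field itself \<Rightarrow> 'v graph \<Rightarrow> bool" where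
  "sequentially_cohen_macaulay_graph _ G \<longleftrightarrow>
    sequentially_cohen_macaulay (mpoly_ring (verts G)) (mpoly_grading (verts G))
      (edge_module G :: (('v \<Rightarrow>\<^sub>0 nat) \<Rightarrow>\<^sub>0 'k, _) module) (edge_module_grading G)"

end

theory Submission
  imports Defs "HOL-Library.Set_Algebras"
begin

text \<open>Write \<open>R\<close> for the polynomial ring on the vertices of a graph and call the maximal independent sets
its facets.  An up-closed family \<open>U\<close> of vertex sets determines the ideal of \<open>R\<close> spanned by the monomials
with support in \<open>U\<close>; the edge ideal comes from the family of the sets that are not independent.  For
every \<open>j\<close> let \<open>U\<^sub>j\<close> be the family of the sets that lie only in facets with fewer than \<open>j\<close> elements.
Then \<open>U\<^sub>0\<close> gives the edge ideal, and the ideals of the \<open>U\<^sub>j\<close> induce a filtration of \<open>R\<close> modulo the edge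
ideal in which the step from \<open>U\<^sub>j\<close> to \<open>U\<^bsub>j+1\<^esub>\<close> is proper exactly when there is a facet of size \<open>j\<close>.  So
it suffices that the quotient belonging to this step is Cohen-Macaulay of dimension \<open>j\<close>.

For a vertex decomposable graph, \<open>U\<^bsub>j+1\<^esub>\<close> arises from \<open>U\<^sub>j\<close> by adding one interval of sets \<open>{r..F}\<close>
with \<open>card F = j\<close> after the other, all intermediate families being up-closed
(\<open>chain_below_facets\<close>).  Such a step adds a copy of the polynomial ring on \<open>F\<close> to the module.  The
elementary symmetric polynomials of all variables restrict to those of the variables in \<open>F\<close>, where
\<open>e\<^sub>j, ..., e\<^sub>1\<close> is a regular sequence (\<open>regular_on_elem_syms\<close>): modulo \<open>e\<^sub>j\<close>, the product of the variables,
the ring is built from polynomial rings in \<open>j - 1\<close> variables, again along intervals.  A sequence that is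
regular on a submodule and on the quotient by it is regular on the module (\<open>regular_on_trans\<close>), so
\<open>e\<^sub>j, ..., e\<^sub>1\<close> is regular on the whole quotient, over every field, finite or not.  In the other direction
a count of monomials shows that more than \<open>j\<close> polynomials always satisfy a polynomial relation modulo
the monomials in more than \<open>j\<close> variables (\<open>dependence_exists\<close>), and such a relation can neither be
satisfied by a regular sequence nor by elements chosen from the steps of a chain of primes.  This bounds
depth and dimension by \<open>j\<close>, and primes generated by variables attain the dimension.

It remains to see that the whiskered graph is vertex decomposable.  A vertex \<open>x\<close> is a shedding vertex if
some neighbour of \<open>x\<close> has all its neighbours among \<open>x\<close> and the neighbours of \<open>x\<close>.  This applies to every
vertex of \<open>S\<close> because of the leaf at the other end of its whisker, and passing to either of the two
smaller graphs does not touch the leaves at the remaining vertices of \<open>S\<close>.  When \<open>S\<close> is used up, what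
remains is an induced subgraph of the graph without \<open>S\<close>, plus isolated vertices.  In a chordal graph each neighbour
of a simplicial vertex is a shedding vertex, and simplicial vertices exist by Dirac's theorem
(\<open>exists_simplicial_off\<close>).  In a five-cycle every vertex is a shedding vertex, and in a proper induced subgraph
with an edge the neighbour of an end of a path is one.\<close>

section \<open>Regular sequences on subquotients of a commutative ring\<close>

definition subring_of :: "'r::comm_ring_1 set \<Rightarrow> bool" where
  "subring_of K \<longleftrightarrow> 1 \<in> K \<and> - 1 \<in> K \<and> (\<forall>a\<in>K. \<forall>b\<in>K. a + b \<in> K \<and> a * b \<in> K)"

text \<open>Only the part \<open>K\<close> of the ring acts, so that ideals of a polynomial ring in some of the variables of a
larger type can be treated without a type for that ring.\<close>

definition submod :: "'r::comm_ring_1 set \<Rightarrow> 'r set \<Rightarrow> bool" where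
  "submod K A \<longleftrightarrow> 0 \<in> A \<and> (\<forall>a\<in>A. \<forall>b\<in>A. a + b \<in> A) \<and> (\<forall>r\<in>K. \<forall>a\<in>A. r * a \<in> A)"

text \<open>Regular sequences on the module \<open>A / B\<close>, in terms of the ideals alone: the first element is a
nonzerodivisor, and the others are regular on \<open>A / (B + r A)\<close>.  That the final quotient be nonzero is not
part of this notion, which makes it compatible with extensions.\<close>

fun regular_on :: "'r::comm_ring_1 set \<Rightarrow> 'r set \<Rightarrow> 'r list \<Rightarrow> bool" where
  "regular_on A B [] \<longleftrightarrow> True"
| "regular_on A B (r # rs) \<longleftrightarrow> (\<forall>a\<in>A. r * a \<in> B \<longrightarrow> a \<in> B) \<and> regular_on A (B + r *o A) rs"

lemma submod_zero: "submod K A \<Longrightarrow> 0 \<in> A"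
  and submod_add: "submod K A \<Longrightarrow> a \<in> A \<Longrightarrow> b \<in> A \<Longrightarrow> a + b \<in> A"
  and submod_mult: "submod K A \<Longrightarrow> r \<in> K \<Longrightarrow> a \<in> A \<Longrightarrow> r * a \<in> A"
  by (auto simp: submod_def)

lemma submod_uminus:
  assumes "subring_of K" "submod K A" "a \<in> A" shows "- a \<in> A"
  using submod_mult[of K A "- 1" a] assms by (auto simp: subring_of_def)

lemma submod_diff:
  assumes "subring_of K" "submod K A" "a \<in> A" "b \<in> A" shows "a - b \<in> A"
  using submod_add[OF assms(2,3) submod_uminus[OF assms(1,2,4)]] by simp

lemma submod_sum:
  assumes "submod K A" "\<And>i. i \<in> I \<Longrightarrow> f i \<in> A" shows "sum f I \<in> A"
  using assms(2) by (induction I rule: infinite_finite_induct) (auto intro: submod_zero[OF assms(1)] submod_add[OF assms(1)])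

lemma subring_of_submod:
  assumes "subring_of K" shows "submod K K"
proof -
  have "1 + - 1 \<in> K" using assms unfolding subring_of_def by blast
  then show ?thesis using assms by (auto simp: subring_of_def submod_def)
qed

lemma submod_plus:
  assumes "submod K A" "submod K B" shows "submod K (A + B)"
  unfolding submod_def
proof (intro conjI ballI)
  show "0 \<in> A + B" using assms[THEN submod_zero] by (metis add_0 set_plus_intro)
  fix x y assume "x \<in> A + B" "y \<in> A + B"
  then obtain a b c d where *: "x = a + b" "y = c + d" "a \<in> A" "b \<in> B" "c \<in> A" "d \<in> B"
    by (auto simp: set_plus_def)
  have "x + y = (a + c) + (b + d)" using * by simp
  then show "x + y \<in> A + B" using * assms submod_add by (metis set_plus_intro)
next
  fix r x assume r: "r \<in> K" "x \<in> A + B"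
  then obtain a b where "x = a + b" "a \<in> A" "b \<in> B" by (auto simp: set_plus_def)
  then show "r * x \<in> A + B" using assms r
    by (auto simp: distrib_left intro!: set_plus_intro submod_mult)
qed

lemma submod_times:
  assumes "submod K A" shows "submod K (m *o A)"
  unfolding submod_def elt_set_times_def
proof (intro conjI ballI; clarsimp)
  show "\<exists>b\<in>A. m * b = 0" using submod_zero[OF assms] by (intro bexI[of _ 0]) auto
  show "\<exists>c\<in>A. m * a + m * b = m * c" if "a \<in> A" "b \<in> A" for a b
    using submod_add[OF assms that] by (intro bexI[of _ "a + b"]) (auto simp: distrib_left)
  show "\<exists>c\<in>A. r * (m * a) = m * c" if "a \<in> A" "r \<in> K" for a r
    using submod_mult[OF assms that(2,1)] by (auto intro!: bexI[of _ "r * a"] simp: ac_simps)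
qed

lemma plus_subset:
  assumes "submod K A" "Z \<subseteq> A" "Y \<subseteq> A" shows "Z + Y \<subseteq> A"
  using assms by (auto simp: set_plus_def intro!: submod_add)

lemma times_subset:
  assumes "submod K A" "r \<in> K" "Z \<subseteq> A" shows "r *o Z \<subseteq> A"
  using assms by (auto simp: elt_set_times_def intro!: submod_mult)

lemma subset_plus1: "submod K B \<Longrightarrow> A \<subseteq> A + B"
  using submod_zero by (metis add.right_neutral set_plus_intro subsetI)

lemma subset_plus2: "submod K A \<Longrightarrow> B \<subseteq> A + B"
  using submod_zero by (metis add.left_neutral set_plus_intro subsetI)

text \<open>This transports regularity along the isomorphism of \<open>C / (C \<inter> B')\<close> with \<open>(C + B') / B'\<close>.  By the
modular law, \<open>C \<inter> (B' + r C) = B + r C\<close>, so the hypothesis is preserved when the first element of the sequence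
is divided out.\<close>

lemma regular_on_second_iso:
  assumes "subring_of K" "submod K C" "set rs \<subseteq> K"
    and "submod K B" "submod K B'" "C \<inter> B' = B" "regular_on C B rs"
  shows "regular_on (C + B') B' rs"
  using assms(3-)
proof (induction rs arbitrary: B B')
  case (Cons r rs)
  note K = assms(1) and C = assms(2) and B = Cons.prems(2) and B' = Cons.prems(3)
  have r: "r \<in> K" and CB: "C \<inter> B' = B" using Cons.prems by auto
  have r1: "\<And>a. a \<in> C \<Longrightarrow> r * a \<in> B \<Longrightarrow> a \<in> B" and r2: "regular_on C (B + r *o C) rs"
    using Cons.prems by auto
  have rC: "submod K (r *o C)" using submod_times C by blast
  have rCC: "r *o C \<subseteq> C" by (rule times_subset[OF C r]) simp
  define B'' where "B'' = B' + r *o C"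
  have B'': "submod K B''" unfolding B''_def by (rule submod_plus[OF B' rC])
  have "B' + r *o (C + B') = B''"
  proof
    have "r *o (C + B') \<subseteq> B''"
    proof
      fix x assume "x \<in> r *o (C + B')"
      then obtain c b where "c \<in> C" "b \<in> B'" "x = r * b + r * c"
        by (auto simp: elt_set_times_def set_plus_def distrib_left)
      then show "x \<in> B''" unfolding B''_def
        by (auto intro!: set_plus_intro submod_mult[OF B' r] set_times_intro2)
    qed
    then show "B' + r *o (C + B') \<subseteq> B''"
      by (intro plus_subset[OF B'']) (auto simp: B''_def intro: subset_plus1[OF rC, THEN subsetD])
    show "B'' \<subseteq> B' + r *o (C + B')"
      unfolding B''_def using subset_plus1[OF B', of C]
      by (intro set_plus_mono2) (auto simp: elt_set_times_def)
  qed
  moreover have "C + B'' = C + B'"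
  proof
    show "C + B'' \<subseteq> C + B'" unfolding B''_def
      using submod_plus[OF C B'] rCC subset_plus1[OF B', of C] subset_plus2[OF C, of B']
      by (intro plus_subset[OF submod_plus[OF C B']]) auto
    show "C + B' \<subseteq> C + B''" unfolding B''_def
      using subset_plus1[OF rC, of B'] by (intro set_plus_mono2) auto
  qed
  moreover have "regular_on (C + B'') B'' rs"
  proof (rule Cons.IH[OF _ submod_plus[OF B rC] B''])
    show "C \<inter> B'' = B + r *o C"
    proof
      show "C \<inter> B'' \<subseteq> B + r *o C"
      proof
        fix x assume x: "x \<in> C \<inter> B''"
        then obtain b c where bc: "b \<in> B'" "c \<in> C" "x = b + r * c"
          by (auto simp: B''_def elt_set_times_def set_plus_def)
        have "x - r * c \<in> C" using x submod_diff[OF K C _ submod_mult[OF C r bc(2)]] by auto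
        with bc CB have "b \<in> B" by auto
        then show "x \<in> B + r *o C" using bc by (auto intro!: set_plus_intro set_times_intro2)
      qed
      show "B + r *o C \<subseteq> C \<inter> B''" unfolding B''_def
        using CB rCC by (intro Int_greatest plus_subset[OF C] set_plus_mono2) auto
    qed
    show "regular_on C (B + r *o C) rs" using r2 .
    show "set rs \<subseteq> K" using Cons.prems by auto
  qed
  moreover have "x \<in> B'" if x: "x \<in> C + B'" "r * x \<in> B'" for x
  proof -
    obtain c b where cb: "c \<in> C" "b \<in> B'" "x = c + b" using x by (auto simp: set_plus_def)
    have "r * x - r * b \<in> B'" using x(2) submod_diff[OF K B' _ submod_mult[OF B' r cb(2)]] by auto
    then have "r * c \<in> B'" using cb by (simp add: algebra_simps)
    then have "r * c \<in> B" using CB submod_mult[OF C r cb(1)] by auto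
    then have "c \<in> B'" using r1 cb CB by auto
    then show ?thesis using cb submod_add[OF B'] by auto
  qed
  ultimately show ?case by simp
qed auto

lemma regular_on_refl: "submod K A \<Longrightarrow> set rs \<subseteq> K \<Longrightarrow> regular_on A A rs"
proof (induction rs)
  case (Cons r rs)
  have "r *o A \<subseteq> A" by (rule times_subset[OF Cons.prems(1)]) (use Cons.prems in auto)
  then have "A + r *o A \<subseteq> A" by (intro plus_subset[OF Cons.prems(1)]) auto
  moreover have "A \<subseteq> A + r *o A" by (rule subset_plus1[OF submod_times[OF Cons.prems(1)]])
  ultimately show ?case using Cons by simp
qed simp

text \<open>Since \<open>r\<close> is a nonzerodivisor on \<open>A / C\<close>, we have \<open>C \<inter> r A = r C\<close>; hence \<open>C / (B + r C)\<close> is still a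
submodule of \<open>A / (B + r A)\<close>, with quotient \<open>A / (C + r A)\<close>, and the induction can continue.\<close>

lemma regular_on_trans:
  assumes "subring_of K" "submod K A" "set rs \<subseteq> K"
    and "submod K B" "submod K C" "B \<subseteq> C" "C \<subseteq> A" "regular_on C B rs" "regular_on A C rs"
  shows "regular_on A B rs"
  using assms(3-)
proof (induction rs arbitrary: B C)
  case (Cons r rs)
  note K = assms(1) and A = assms(2) and B = Cons.prems(2) and C = Cons.prems(3)
    and BC = Cons.prems(4) and CA = Cons.prems(5)
  have r: "r \<in> K" using Cons.prems by auto
  have C1: "\<And>a. a \<in> C \<Longrightarrow> r * a \<in> B \<Longrightarrow> a \<in> B" and C2: "regular_on C (B + r *o C) rs"
    and A1: "\<And>a. a \<in> A \<Longrightarrow> r * a \<in> C \<Longrightarrow> a \<in> C" and A2: "regular_on A (C + r *o A) rs"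
    using Cons.prems by auto
  have rA: "submod K (r *o A)" and rC: "submod K (r *o C)" using submod_times A C by blast+
  have rAA: "r *o A \<subseteq> A" by (rule times_subset[OF A r]) simp
  have rCC: "r *o C \<subseteq> C" by (rule times_subset[OF C r]) simp
  have "x \<in> B" if "x \<in> A" "r * x \<in> B" for x using that A1 C1 BC by blast
  moreover have "regular_on A (B + r *o A) rs"
  proof (rule Cons.IH[of _ "C + r *o A"])
    have *: "C \<inter> (B + r *o A) = B + r *o C"
    proof
      show "C \<inter> (B + r *o A) \<subseteq> B + r *o C"
      proof
        fix x assume x: "x \<in> C \<inter> (B + r *o A)"
        then obtain b a where ba: "b \<in> B" "a \<in> A" "x = b + r * a"
          by (auto simp: elt_set_times_def set_plus_def)
        have "x - b \<in> C" using x ba BC submod_diff[OF K C, of x b] by auto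
        with ba A1 have "a \<in> C" by auto
        then show "x \<in> B + r *o C" using ba by (auto intro!: set_plus_intro set_times_intro2)
      qed
      have "r *o C \<subseteq> r *o A" using CA by (auto simp: elt_set_times_def)
      then show "B + r *o C \<subseteq> C \<inter> (B + r *o A)"
        using BC rCC by (auto intro: plus_subset[OF C, THEN subsetD] set_plus_mono2[THEN subsetD])
    qed
    have "C + (B + r *o A) = C + r *o A"
    proof
      show "C + (B + r *o A) \<subseteq> C + r *o A"
        using BC subset_plus1[OF rA, of C] subset_plus2[OF C, of "r *o A"]
        by (intro plus_subset[OF submod_plus[OF C rA]]) auto
      show "C + r *o A \<subseteq> C + (B + r *o A)"
        using subset_plus2[OF B, of "r *o A"] by (intro set_plus_mono2) auto
    qed
    then show "regular_on (C + r *o A) (B + r *o A) rs"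
      using regular_on_second_iso[OF K C _ submod_plus[OF B rC] submod_plus[OF B rA] * C2] Cons.prems(1)
      by auto
    show "B + r *o A \<subseteq> C + r *o A" using BC by (intro set_plus_mono2) auto
    show "C + r *o A \<subseteq> A" using CA rAA by (intro plus_subset[OF A]) auto
  qed (use Cons.prems A2 submod_plus B C rA in auto)
  ultimately show ?case by simp
qed auto

lemma regular_on_times:
  assumes "\<And>a b. m * a = m * b \<Longrightarrow> a = b" and "regular_on A B rs"
  shows "regular_on (m *o A) (m *o B) rs"
  using assms(2)
proof (induction rs arbitrary: B)
  case (Cons r rs)
  have "m *o B + r *o (m *o A) = m *o (B + r *o A)"
    by (simp add: set_times_plus_distrib2 set_times_rearrange2 mult.commute)
  moreover have "x \<in> m *o B" if x: "x \<in> m *o A" "r * x \<in> m *o B" for x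
  proof -
    obtain a b where ab: "x = m * a" "a \<in> A" "r * x = m * b" "b \<in> B"
      using x unfolding elt_set_times_def by blast
    then have "m * (r * a) = m * b" by (simp add: ac_simps)
    then have "r * a = b" by (rule assms(1))
    then show ?thesis using ab Cons.prems by auto
  qed
  ultimately show ?case using Cons by simp
qed auto

section \<open>Monomial ideals\<close>

abbreviation lookup where "lookup \<equiv> Poly_Mapping.lookup"
abbreviation keys where "keys \<equiv> Poly_Mapping.keys"
abbreviation single where "single \<equiv> Poly_Mapping.single"

type_synonym ('v, 'k) mpoly = "('v \<Rightarrow>\<^sub>0 nat) \<Rightarrow>\<^sub>0 'k"

text \<open>For \<open>U = Pow V\<close> this is the polynomial ring in the variables \<open>V\<close>, and for the family of the sets not
contained in \<open>F\<close> it is the prime ideal generated by the variables outside \<open>F\<close>.\<close>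

definition mono_ideal :: "'v set set \<Rightarrow> ('v, 'k::zero) mpoly set" where
  "mono_ideal U = {p. \<forall>m\<in>keys p. keys m \<in> U}"

definition upclosed :: "'v set \<Rightarrow> 'v set set \<Rightarrow> bool" where
  "upclosed V U \<longleftrightarrow> U \<subseteq> Pow V \<and> (\<forall>s\<in>U. \<forall>t. s \<subseteq> t \<longrightarrow> t \<subseteq> V \<longrightarrow> t \<in> U)"

lemma upclosedD: "upclosed V U \<Longrightarrow> s \<in> U \<Longrightarrow> s \<subseteq> t \<Longrightarrow> t \<subseteq> V \<Longrightarrow> t \<in> U"
  by (auto simp: upclosed_def)

lemma keys_add_nat: "keys (m + m' :: 'v \<Rightarrow>\<^sub>0 nat) = keys m \<union> keys m'"
  by (auto simp: in_keys_iff lookup_add)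

lemma keys_uminus_eq: "keys (- p :: 'a \<Rightarrow>\<^sub>0 'k::ab_group_add) = keys p"
  by (auto simp: in_keys_iff)

lemma poly_eq_sum_single:
  "(p :: 'a \<Rightarrow>\<^sub>0 'k::comm_monoid_add) = (\<Sum>m\<in>keys p. single m (lookup p m))"
proof (rule poly_mapping_eqI)
  fix k
  have "lookup (\<Sum>m\<in>keys p. single m (lookup p m)) k =
      (\<Sum>m\<in>keys p. if m = k then lookup p k else 0)"
    unfolding lookup_sum by (rule sum.cong) (auto simp: lookup_single when_def)
  also have "\<dots> = lookup p k" by (auto simp: sum.delta in_keys_iff)
  finally show "lookup p k = lookup (\<Sum>m\<in>keys p. single m (lookup p m)) k" by simp
qed

text \<open>Membership in a submodule may be checked term by term; all later equations between monomial ideals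
are reduced to single monomials in this way.\<close>

lemma in_submod_if_terms:
  assumes "submod K A" "\<And>m. m \<in> keys p \<Longrightarrow> single m (lookup p m) \<in> A"
  shows "p \<in> A"
proof -
  have "(\<Sum>m\<in>keys p. single m (lookup p m)) \<in> A"
    using assms(2) by (rule submod_sum[OF assms(1)])
  then show ?thesis unfolding poly_eq_sum_single[of p, symmetric] .
qed

lemma mono_ideal_mono: "U \<subseteq> U' \<Longrightarrow> mono_ideal U \<subseteq> mono_ideal U'"
  by (auto simp: mono_ideal_def)

lemma single_in_mono_ideal: "keys m \<in> U \<Longrightarrow> single m c \<in> mono_ideal U"
  by (auto simp: mono_ideal_def)

lemma mono_ideal_add:
  "p \<in> mono_ideal U \<Longrightarrow> q \<in> mono_ideal U \<Longrightarrow> (p + q :: ('v, 'k::comm_ring_1) mpoly) \<in> mono_ideal U"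
  using Poly_Mapping.keys_add[of p q] by (auto simp: mono_ideal_def)

lemma subring_of_mono_ideal: "subring_of (mono_ideal (Pow V) :: ('v, 'k::comm_ring_1) mpoly set)"
  unfolding subring_of_def
proof (intro conjI ballI)
  show "1 \<in> mono_ideal (Pow V)" "- 1 \<in> (mono_ideal (Pow V) :: ('v, 'k::comm_ring_1) mpoly set)"
    by (auto simp: mono_ideal_def keys_uminus_eq)
  fix a b :: "('v, 'k) mpoly" assume "a \<in> mono_ideal (Pow V)" "b \<in> mono_ideal (Pow V)"
  then show "a * b \<in> mono_ideal (Pow V)"
    using keys_mult[of a b] by (fastforce simp: mono_ideal_def keys_add_nat)
  show "a + b \<in> mono_ideal (Pow V)" by (rule mono_ideal_add) fact+
qed

lemma submod_mono_ideal:
  assumes "upclosed V U"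
  shows "submod (mono_ideal (Pow V)) (mono_ideal U :: ('v, 'k::comm_ring_1) mpoly set)"
proof -
  have "a * b \<in> mono_ideal U" if ab: "a \<in> mono_ideal (Pow V)" "b \<in> mono_ideal U"
    for a b :: "('v, 'k) mpoly"
    unfolding mono_ideal_def
  proof clarify
    fix m assume "m \<in> keys (a * b)"
    then obtain x y where xy: "m = x + y" "x \<in> keys a" "y \<in> keys b"
      using keys_mult[of a b] by auto
    then have "keys x \<subseteq> V" "keys y \<in> U"
      using ab by (auto simp: mono_ideal_def)
    moreover from this have "keys y \<subseteq> V" using assms by (auto simp: upclosed_def)
    ultimately show "keys m \<in> U"
      using upclosedD[OF assms, of "keys y" "keys m"]
      unfolding xy keys_add_nat by simp
  qed
  moreover have "0 \<in> mono_ideal U" by (auto simp: mono_ideal_def)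
  ultimately show ?thesis by (simp add: submod_def mono_ideal_add)
qed

definition indic :: "'v set \<Rightarrow> 'v \<Rightarrow>\<^sub>0 nat" where
  "indic T = (\<Sum>v\<in>T. single v 1)"

lemma lookup_indic: "finite T \<Longrightarrow> lookup (indic T) v = (if v \<in> T then 1 else 0)"
  by (simp add: indic_def lookup_sum lookup_single when_def)

lemma keys_indic: "finite T \<Longrightarrow> keys (indic T) = T"
proof -
  assume "finite T"
  then have "v \<in> keys (indic T) \<longleftrightarrow> v \<in> T" for v
    unfolding in_keys_iff lookup_indic[OF \<open>finite T\<close>] by simp
  then show ?thesis by blast
qed

lemma lookup_single_mult:
  "lookup (single a c * p) (a + m) = c * lookup (p :: ('v, 'k::comm_ring_1) mpoly) m"
proof -
  let ?f = "\<lambda>m. single m (lookup p m)"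
  have "single a c * p = single a c * sum ?f (keys p)"
    by (rule arg_cong[OF poly_eq_sum_single])
  also have "\<dots> = (\<Sum>m'\<in>keys p. single (a + m') (c * lookup p m'))"
    unfolding sum_distrib_left mult_single ..
  also have "lookup \<dots> (a + m) = (\<Sum>m'\<in>keys p. if m' = m then c * lookup p m else 0)"
    unfolding lookup_sum by (rule sum.cong) (auto simp: lookup_single when_def)
  also have "\<dots> = c * lookup p m"
    unfolding sum.delta[OF finite_keys] by (simp add: in_keys_iff)
  finally show ?thesis .
qed

lemma keys_single_mult:
  "m \<in> keys (p :: ('v, 'k::comm_ring_1) mpoly) \<Longrightarrow>
    a + m \<in> keys (single a 1 * p)"
  unfolding in_keys_iff lookup_single_mult by simp

lemma keys_single_mult_eq:
  "keys (single a 1 * p :: ('v, 'k::comm_ring_1) mpoly) = (+) a ` keys p"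
proof
  show "keys (single a 1 * p) \<subseteq> (+) a ` keys p"
    using keys_mult[of "single a 1" p] by auto
  show "(+) a ` keys p \<subseteq> keys (single a 1 * p)"
    using keys_single_mult by blast
qed

lemma single_mult_cancel:
  assumes "single a 1 * p = single a 1 * (q :: ('v, 'k::comm_ring_1) mpoly)"
  shows "p = q"
proof (rule poly_mapping_eqI)
  fix k
  show "lookup p k = lookup q k"
    using arg_cong[OF assms, of "\<lambda>x. lookup x (a + k)"] by (simp add: lookup_single_mult)
qed

definition xmon :: "'v set \<Rightarrow> ('v, 'k::comm_ring_1) mpoly" where
  "xmon T = single (indic T) 1"

lemma divide_by_indic:
  assumes "finite T" "T \<subseteq> keys m"
  shows "single m c = xmon T * single (m - indic T) c"
    and "keys (m - indic T) \<subseteq> keys m"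
proof -
  have "indic T + (m - indic T) = m"
    by (rule poly_mapping_eqI)
      (use assms in \<open>auto simp: lookup_add lookup_minus lookup_indic in_keys_iff\<close>)
  then show "single m c = xmon T * single (m - indic T) c"
    by (simp add: xmon_def mult_single)
  show "keys (m - indic T) \<subseteq> keys m"
    by (auto simp: in_keys_iff lookup_minus)
qed

section \<open>Elementary symmetric polynomials form a regular sequence\<close>

text \<open>A chain of this kind plays the role of a shelling: the added interval \<open>{r..F}\<close> consists of the faces
contributed by the facet \<open>F\<close>, and \<open>r\<close> is its restriction face.\<close>

inductive interval_chain :: "'v set \<Rightarrow> nat \<Rightarrow> 'v set set \<Rightarrow> 'v set set \<Rightarrow> bool" for V j where
  chain_refl: "upclosed V U \<Longrightarrow> interval_chain V j U U"
| chain_step: "interval_chain V j U U' \<Longrightarrow> r \<subseteq> F \<Longrightarrow> F \<subseteq> V \<Longrightarrow> card F = j \<Longrightarrow> U' \<inter> {r..F} = {} \<Longrightarrow>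
    upclosed V (U' \<union> {r..F}) \<Longrightarrow> interval_chain V j U (U' \<union> {r..F})"

lemma chain_upclosed: "interval_chain V j U U' \<Longrightarrow> upclosed V U \<and> upclosed V U'"
  by (induction rule: interval_chain.induct) auto

lemma chain_subset: "interval_chain V j U U' \<Longrightarrow> U \<subseteq> U'"
  by (induction rule: interval_chain.induct) auto

lemma chain_trans: "interval_chain V j U' U'' \<Longrightarrow> interval_chain V j U U' \<Longrightarrow> interval_chain V j U U''"
proof (induction rule: interval_chain.induct)
  case (chain_step U' U'' r F)
  then show ?case by (intro interval_chain.chain_step) auto
qed

lemma upclosed_Pow: "upclosed V (Pow V)"
  by (auto simp: upclosed_def)

text \<open>Adding an interval to \<open>U\<close> enlarges the module by \<open>x\<^sup>r R\<close> modulo \<open>x\<^sup>r P\<close>, where \<open>P\<close> is generated by the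
variables outside \<open>F\<close>.  So the sequence only has to be regular on \<open>R / P\<close>, the polynomial ring on \<open>F\<close>.\<close>

lemma regular_on_interval:
  fixes U :: "'v set set" and rs :: "('v, 'k::comm_ring_1) mpoly list"
  assumes V: "finite V" and up: "upclosed V U" "upclosed V (U \<union> {r..F})"
    and rF: "r \<subseteq> F" "F \<subseteq> V" "U \<inter> {r..F} = {}"
    and rs: "set rs \<subseteq> mono_ideal (Pow V)"
      "regular_on (mono_ideal (Pow V)) (mono_ideal {t. t \<subseteq> V \<and> \<not> t \<subseteq> F}) rs"
  shows "regular_on (mono_ideal (U \<union> {r..F})) (mono_ideal U) rs"
proof -
  let ?R = "mono_ideal (Pow V) :: ('v, 'k) mpoly set"
  let ?P = "mono_ideal {t. t \<subseteq> V \<and> \<not> t \<subseteq> F} :: ('v, 'k) mpoly set"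
  let ?x = "xmon r :: ('v, 'k) mpoly"
  have finr: "finite r" by (rule finite_subset[OF _ V]) (use rF in auto)
  have R: "submod ?R ?R" by (rule submod_mono_ideal[OF upclosed_Pow])
  have P: "submod ?R ?P" by (rule submod_mono_ideal) (auto simp: upclosed_def)
  have U: "submod ?R (mono_ideal U :: ('v, 'k) mpoly set)" by (rule submod_mono_ideal[OF up(1)])
  have U': "submod ?R (mono_ideal (U \<union> {r..F}) :: ('v, 'k) mpoly set)"
    by (rule submod_mono_ideal[OF up(2)])
  have xin: "?x \<in> mono_ideal (U \<union> {r..F})"
    unfolding xmon_def by (rule single_in_mono_ideal) (use rF finr in \<open>auto simp: keys_indic\<close>)
  have 1: "regular_on (?x *o ?R) (?x *o ?P) rs"
    using rs(2) by (rule regular_on_times[rotated]) (auto simp: xmon_def dest: single_mult_cancel)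
  \<comment> \<open>A multiple of \<open>x\<^sup>r\<close> leaves the interval, and so enters \<open>U\<close>, exactly when it leaves \<open>F\<close>.\<close>
  have key: "r \<union> t \<in> U \<longleftrightarrow> \<not> t \<subseteq> F" if "t \<subseteq> V" for t
  proof (cases "t \<subseteq> F")
    case True
    then show ?thesis using rF by auto
  next
    case False
    have "r \<in> U \<union> {r..F}" "r \<union> t \<subseteq> V" using rF that by auto
    then have "r \<union> t \<in> U \<union> {r..F}" using upclosedD[OF up(2)] by (meson Un_upper1)
    then show ?thesis using False by auto
  qed
  have 2: "?x *o ?R \<inter> mono_ideal U = ?x *o ?P"
  proof
    show "?x *o ?R \<inter> mono_ideal U \<subseteq> ?x *o ?P"
    proof
      fix y assume y: "y \<in> ?x *o ?R \<inter> mono_ideal U"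
      then obtain p where p: "p \<in> ?R" "y = ?x * p" by (auto simp: elt_set_times_def)
      have "p \<in> ?P" using p y key finr
        by (auto simp: mono_ideal_def xmon_def keys_single_mult_eq keys_add_nat keys_indic)
      then show "y \<in> ?x *o ?P" using p by auto
    qed
    have "?x *o ?P \<subseteq> mono_ideal U"
      using key finr
      by (auto simp: elt_set_times_def mono_ideal_def xmon_def keys_single_mult_eq keys_add_nat keys_indic)
    moreover have "?P \<subseteq> ?R" by (rule mono_ideal_mono) auto
    ultimately show "?x *o ?P \<subseteq> ?x *o ?R \<inter> mono_ideal U"
      unfolding elt_set_times_def by blast
  qed
  have 3: "?x *o ?R + mono_ideal U = mono_ideal (U \<union> {r..F})"
  proof
    show "?x *o ?R + mono_ideal U \<subseteq> mono_ideal (U \<union> {r..F})"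
    proof (rule plus_subset[OF U'])
      show "?x *o ?R \<subseteq> mono_ideal (U \<union> {r..F})"
        using submod_mult[OF U' _ xin] by (auto simp: elt_set_times_def mult.commute[of ?x])
    qed (rule mono_ideal_mono, auto)
    show "mono_ideal (U \<union> {r..F}) \<subseteq> ?x *o ?R + mono_ideal U"
    proof
      fix p :: "('v, 'k) mpoly" assume p: "p \<in> mono_ideal (U \<union> {r..F})"
      show "p \<in> ?x *o ?R + mono_ideal U"
      proof (rule in_submod_if_terms[OF submod_plus[OF submod_times[OF R] U]])
        fix m assume "m \<in> keys p"
        then have m: "keys m \<in> U \<union> {r..F}" using p by (auto simp: mono_ideal_def)
        show "single m (lookup p m) \<in> ?x *o ?R + mono_ideal U"
        proof (cases "keys m \<in> U")
          case True
          then show ?thesis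
            using subset_plus2[OF submod_times[OF R], of "mono_ideal U" ?x] single_in_mono_ideal by blast
        next
          case False
          with m have "r \<subseteq> keys m" "keys m \<subseteq> V" using rF by auto
          then have "single m (lookup p m) \<in> ?x *o ?R"
            unfolding divide_by_indic(1)[OF finr \<open>r \<subseteq> keys m\<close>]
            using divide_by_indic(2)[OF finr \<open>r \<subseteq> keys m\<close>]
            by (intro set_times_intro2 single_in_mono_ideal) auto
          then show ?thesis using subset_plus1[OF U] by blast
        qed
      qed
    qed
  qed
  show ?thesis
    using regular_on_second_iso[OF subring_of_mono_ideal submod_times[OF R] rs(1) submod_times[OF P] U 2 1]
    unfolding 3 .
qed

lemma regular_on_chain:
  fixes rs :: "('v, 'k::comm_ring_1) mpoly list"
  assumes "finite V" "interval_chain V j U U'" "set rs \<subseteq> mono_ideal (Pow V)"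
    and "\<And>F. F \<subseteq> V \<Longrightarrow> card F = j \<Longrightarrow>
      regular_on (mono_ideal (Pow V)) (mono_ideal {t. t \<subseteq> V \<and> \<not> t \<subseteq> F}) rs"
  shows "regular_on (mono_ideal U') (mono_ideal U) rs"
  using assms(2)
proof induction
  case (chain_refl U)
  show ?case by (rule regular_on_refl[OF submod_mono_ideal[OF chain_refl] assms(3)])
next
  case (chain_step U U' r F)
  have *: "upclosed V U" "upclosed V U'" using chain_upclosed chain_step by blast+
  have up: "upclosed V (U' \<union> {r..F})" and "regular_on (mono_ideal U') (mono_ideal U) rs"
    and "U \<subseteq> U'" using chain_step chain_subset by blast+
  moreover have "regular_on (mono_ideal (U' \<union> {r..F})) (mono_ideal U') rs"
    using chain_step assms(4)[of F] by (intro regular_on_interval[OF assms(1) *(2) up _ _ _ assms(3)]) auto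
  ultimately show ?case
    by (intro regular_on_trans[OF subring_of_mono_ideal submod_mono_ideal[OF up] assms(3)
        submod_mono_ideal[OF *(1)] submod_mono_ideal[OF *(2)]] mono_ideal_mono) auto
qed

definition elem_sym :: "'v set \<Rightarrow> nat \<Rightarrow> ('v, 'k::comm_ring_1) mpoly" where
  "elem_sym V i = (\<Sum>T | T \<subseteq> V \<and> card T = i. xmon T)"

lemma keys_elem_sym:
  "keys (elem_sym V i :: ('v, 'k::comm_ring_1) mpoly) \<subseteq> indic ` {T. T \<subseteq> V \<and> card T = i}"
proof -
  have "keys (elem_sym V i :: ('v, 'k) mpoly) \<subseteq>
      (\<Union>T\<in>{T. T \<subseteq> V \<and> card T = i}. keys (xmon T :: ('v, 'k) mpoly))"
    unfolding elem_sym_def by (rule Poly_Mapping.keys_sum)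
  then show ?thesis by (fastforce simp: xmon_def)
qed

lemma elem_sym_in: "finite V \<Longrightarrow> elem_sym V i \<in> mono_ideal (Pow V)"
  using keys_elem_sym[of V i] by (fastforce simp: mono_ideal_def keys_indic finite_subset[of _ V])

text \<open>The order from \<open>e\<^sub>j\<close> down to \<open>e\<^sub>1\<close> matters for the induction in \<open>regular_on_elem_syms\<close>, which divides out
the product of all variables first.\<close>

definition elem_syms :: "'v set \<Rightarrow> nat \<Rightarrow> ('v, 'k::comm_ring_1) mpoly list" where
  "elem_syms V j = map (elem_sym V) (rev [1..<Suc j])"

lemma elem_syms_Suc: "elem_syms V (Suc j) = elem_sym V (Suc j) # elem_syms V j"
  by (simp add: elem_syms_def)

lemma elem_syms_in: "finite V \<Longrightarrow> set (elem_syms V j) \<subseteq> mono_ideal (Pow V)"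
  by (auto simp: elem_syms_def elem_sym_in)

text \<open>If \<open>F\<close> is \<open>{x\<^sub>1, ..., x\<^sub>n}\<close>, the proper subsets of \<open>F\<close> are partitioned into the intervals from
\<open>{x\<^sub>1, ..., x\<^sub>i}\<close> to \<open>F - {x\<^bsub>i+1\<^esub>}\<close>.  Below, \<open>H\<close> is the set of the \<open>x\<^bsub>i+1\<^esub>\<close> whose interval has been added.\<close>

lemma chain_proper_subsets:
  assumes "finite V" "F \<subseteq> V" "card F = Suc j"
  shows "interval_chain V j {t. t \<subseteq> V \<and> \<not> t \<subset> F} (Pow V)"
proof -
  have "finite F" by (rule finite_subset[OF assms(2,1)])
  let ?U = "\<lambda>G. {t. t \<subseteq> V \<and> (\<not> t \<subset> F \<or> G \<subseteq> t)}"
  have up: "upclosed V (?U G)" for G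
    unfolding upclosed_def
  proof (intro conjI ballI allI impI)
    fix s t assume "s \<in> ?U G" "s \<subseteq> t" "t \<subseteq> V"
    moreover from this have "s \<subset> F" if "t \<subset> F" using that by (meson order.strict_trans1)
    ultimately show "t \<in> ?U G" by auto
  qed auto
  have "interval_chain V j (?U F) (?U (F - H))" if "H \<subseteq> F" for H
    using finite_subset[OF that \<open>finite F\<close>] that
  proof (induction H rule: finite_induct)
    case empty
    then show ?case using interval_chain.chain_refl[OF up[of F]] by simp
  next
    case (insert x H)
    have sub: "t \<subseteq> V" "t \<subset> F \<longrightarrow> F - insert x H \<subseteq> t" if "F - insert x H \<subseteq> t" "t \<subseteq> F - {x}" for t
      using that assms(2) by blast+
    have eq: "?U (F - insert x H) = ?U (F - H) \<union> {F - insert x H..F - {x}}"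
    proof (intro equalityI subsetI)
      fix t assume t: "t \<in> ?U (F - insert x H)"
      show "t \<in> ?U (F - H) \<union> {F - insert x H..F - {x}}"
      proof (cases "x \<in> t \<or> \<not> t \<subset> F")
        case True
        with t show ?thesis by blast
      next
        case False
        with t show ?thesis by auto
      qed
    next
      fix t assume "t \<in> ?U (F - H) \<union> {F - insert x H..F - {x}}"
      then show "t \<in> ?U (F - insert x H)" using sub[of t] by auto
    qed
    have "interval_chain V j (?U F) (?U (F - H) \<union> {F - insert x H..F - {x}})"
    proof (rule interval_chain.chain_step)
      show "interval_chain V j (?U F) (?U (F - H))" by (rule insert.IH) (use insert.prems in simp)
      show "upclosed V (?U (F - H) \<union> {F - insert x H..F - {x}})"
        unfolding eq[symmetric] by (rule up)
      have "x \<in> F - H" "x \<in> F" using insert.prems insert.hyps by auto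
      then have "\<not> F - H \<subseteq> t \<and> t \<subset> F" if "t \<subseteq> F - {x}" for t using that by blast
      then show "?U (F - H) \<inter> {F - insert x H..F - {x}} = {}" by fastforce
      show "card (F - {x}) = j" using \<open>x \<in> F\<close> assms(3) \<open>finite F\<close> by simp
    qed (use assms(2) in auto)
    then show ?case unfolding eq .
  qed
  from this[of F] have "interval_chain V j (?U F) (?U {})" by simp
  moreover have "?U F = {t. t \<subseteq> V \<and> \<not> t \<subset> F}" "?U {} = Pow V" by auto
  ultimately show ?thesis by simp
qed

text \<open>Modulo the variables outside \<open>F\<close>, the polynomial \<open>e\<^sub>j\<close> is the monomial \<open>x\<^sup>F\<close>, a nonzerodivisor.  After
dividing by it, the proper subsets of \<open>F\<close> remain, and these are filled by intervals below sets of size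
\<open>j - 1\<close>, on which the remaining sequence is regular by induction.\<close>

lemma regular_on_elem_syms:
  fixes V :: "'v set"
  assumes "finite V" "F \<subseteq> V" "card F = j"
  shows "regular_on (mono_ideal (Pow V)) (mono_ideal {t. t \<subseteq> V \<and> \<not> t \<subseteq> F})
    (elem_syms V j :: ('v, 'k::comm_ring_1) mpoly list)"
  using assms(2,3)
proof (induction j arbitrary: F)
  case 0
  then show ?case by (simp add: elem_syms_def)
next
  case (Suc j)
  let ?R = "mono_ideal (Pow V) :: ('v, 'k) mpoly set"
  let ?P = "mono_ideal {t. t \<subseteq> V \<and> \<not> t \<subseteq> F} :: ('v, 'k) mpoly set"
  let ?P' = "mono_ideal {t. t \<subseteq> V \<and> \<not> t \<subset> F} :: ('v, 'k) mpoly set"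
  let ?e = "elem_sym V (Suc j) :: ('v, 'k) mpoly"
  have finF: "finite F" by (rule finite_subset[OF Suc.prems(1) assms(1)])
  have R: "submod ?R ?R" by (rule submod_mono_ideal[OF upclosed_Pow])
  have P: "submod ?R ?P" by (rule submod_mono_ideal) (auto simp: upclosed_def)
  have P': "submod ?R ?P'" by (rule submod_mono_ideal) (auto simp: upclosed_def)
  \<comment> \<open>Every other set of the same size as \<open>F\<close> contains a variable outside \<open>F\<close>.\<close>
  have ePP: "?e - xmon F \<in> ?P"
  proof -
    have "?e = xmon F + (\<Sum>T \<in> {T. T \<subseteq> V \<and> card T = Suc j} - {F}. xmon T)"
      unfolding elem_sym_def using Suc.prems assms(1) by (intro sum.remove) auto
    moreover have "(\<Sum>T \<in> {T. T \<subseteq> V \<and> card T = Suc j} - {F}. xmon T) \<in> ?P"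
    proof (rule submod_sum[OF P])
      fix T assume T: "T \<in> {T. T \<subseteq> V \<and> card T = Suc j} - {F}"
      then have "\<not> T \<subseteq> F" using card_subset_eq[OF finF, of T] Suc.prems(2) by auto
      then show "xmon T \<in> ?P" unfolding xmon_def using T assms(1)
        by (intro single_in_mono_ideal) (auto simp: keys_indic finite_subset[of _ V])
    qed
    ultimately show ?thesis by simp
  qed
  have eR: "?e \<in> ?R" using assms(1) by (rule elem_sym_in)
  have "a \<in> ?P" if a: "a \<in> ?R" "?e * a \<in> ?P" for a
  proof -
    have "?e * a - a * (?e - xmon F) \<in> ?P"
      by (rule submod_diff[OF subring_of_mono_ideal P a(2) submod_mult[OF P a(1) ePP]])
    then have "xmon F * a \<in> ?P" by (simp add: algebra_simps)
    then show ?thesis using a finF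
      by (auto simp: mono_ideal_def xmon_def keys_single_mult_eq keys_add_nat keys_indic)
  qed
  moreover have "?P + ?e *o ?R = ?P'"
  proof
    have xF: "xmon F \<in> ?P'" unfolding xmon_def
      using finF Suc.prems by (intro single_in_mono_ideal) (auto simp: keys_indic)
    have PP': "?P \<subseteq> ?P'" by (rule mono_ideal_mono) auto
    have "(?e - xmon F) + xmon F \<in> ?P'" using xF PP' ePP by (intro submod_add[OF P']) auto
    then have "?e \<in> ?P'" by simp
    then have "?e *o ?R \<subseteq> ?P'"
      using submod_mult[OF P', of _ ?e] by (auto simp: elt_set_times_def mult.commute[of ?e])
    with PP' show "?P + ?e *o ?R \<subseteq> ?P'" by (rule plus_subset[OF P'])
    show "?P' \<subseteq> ?P + ?e *o ?R"
    proof
      fix p assume p: "p \<in> ?P'"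
      show "p \<in> ?P + ?e *o ?R"
      proof (rule in_submod_if_terms[OF submod_plus[OF P submod_times[OF R]]])
        fix m assume "m \<in> keys p"
        then have m: "keys m \<subseteq> V" "\<not> keys m \<subset> F"
          using p by (auto simp: mono_ideal_def)
        show "single m (lookup p m) \<in> ?P + ?e *o ?R"
        proof (cases "keys m \<subseteq> F")
          case False
          then have "single m (lookup p m) \<in> ?P" using m by (intro single_in_mono_ideal) auto
          then show ?thesis using subset_plus1[OF submod_times[OF R]] by blast
        next
          case True
          then have F: "F \<subseteq> keys m" using m by auto
          let ?s = "single (m - indic F) (lookup p m)"
          have s: "?s \<in> ?R" using divide_by_indic(2)[OF finF F] m by (intro single_in_mono_ideal) auto
          have "single m (lookup p m) = - (?s * (?e - xmon F)) + ?e * ?s"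
            using divide_by_indic(1)[OF finF F] by (simp add: algebra_simps)
          also have "\<dots> \<in> ?P + ?e *o ?R"
            using s by (intro set_plus_intro set_times_intro2
                submod_uminus[OF subring_of_mono_ideal P] submod_mult[OF P s ePP])
          finally show ?thesis .
        qed
      qed
    qed
  qed
  moreover have "regular_on ?R ?P' (elem_syms V j)"
    by (rule regular_on_chain[OF assms(1) chain_proper_subsets[OF assms(1) Suc.prems] elem_syms_in[OF assms(1)] Suc.IH])
  ultimately show ?case by (simp add: elem_syms_Suc)
qed

section \<open>Vertex decomposable graphs\<close>

definition indep :: "('v \<Rightarrow> 'v \<Rightarrow> bool) \<Rightarrow> 'v set \<Rightarrow> bool" where
  "indep E F \<longleftrightarrow> (\<forall>u\<in>F. \<forall>v\<in>F. \<not> E u v)"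

definition facets :: "('v \<Rightarrow> 'v \<Rightarrow> bool) \<Rightarrow> 'v set \<Rightarrow> 'v set set" where
  "facets E V = {F. F \<subseteq> V \<and> indep E F \<and> (\<forall>v\<in>V - F. \<not> indep E (insert v F))}"

text \<open>The vertices outside the closed neighbourhood of \<open>x\<close>; the independence complex on this set is the link of
\<open>x\<close>.\<close>

definition away :: "('v \<Rightarrow> 'v \<Rightarrow> bool) \<Rightarrow> 'v set \<Rightarrow> 'v \<Rightarrow> 'v set" where
  "away E V x = {v \<in> V. v \<noteq> x \<and> \<not> E x v}"

text \<open>Here \<open>F\<close> ranges over all independent sets of the link rather than only the maximal ones; this is an equivalent
condition, since every such set lies in a maximal one.\<close>

definition shedding :: "('v \<Rightarrow> 'v \<Rightarrow> bool) \<Rightarrow> 'v set \<Rightarrow> 'v \<Rightarrow> bool" where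
  "shedding E V x \<longleftrightarrow> x \<in> V \<and>
    (\<forall>F. F \<subseteq> away E V x \<longrightarrow> indep E F \<longrightarrow> (\<exists>y\<in>V. E x y \<and> (\<forall>f\<in>F. \<not> E y f)))"

inductive vertex_decomposable :: "('v \<Rightarrow> 'v \<Rightarrow> bool) \<Rightarrow> 'v set \<Rightarrow> bool" for E where
  decomposable_indep: "indep E V \<Longrightarrow> vertex_decomposable E V"
| decomposable_shed: "shedding E V x \<Longrightarrow> vertex_decomposable E (V - {x}) \<Longrightarrow> vertex_decomposable E (away E V x) \<Longrightarrow> vertex_decomposable E V"

text \<open>The family \<open>U\<^sub>j\<close> of the introduction, for an arbitrary set of facets and an ambient vertex set \<open>W\<close> that may
be larger than their union.\<close>

definition below :: "'v set \<Rightarrow> 'v set set \<Rightarrow> nat \<Rightarrow> 'v set set" where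
  "below W Fs j = {t. t \<subseteq> W \<and> (\<forall>F\<in>Fs. t \<subseteq> F \<longrightarrow> card F < j)}"

lemma upclosed_below: "upclosed W (below W Fs j)"
  unfolding upclosed_def below_def by (auto dest: subset_trans)

lemma facets_subset: "F \<in> facets E V \<Longrightarrow> F \<subseteq> V"
  and facets_indep: "F \<in> facets E V \<Longrightarrow> indep E F"
  by (auto simp: facets_def)

lemma indep_subset: "indep E F \<Longrightarrow> G \<subseteq> F \<Longrightarrow> indep E G"
  by (auto simp: indep_def)

lemma extend_to_facet:
  assumes "finite V" "F \<subseteq> V" "indep E F"
  obtains F' where "F' \<in> facets E V" "F \<subseteq> F'"
proof -
  let ?S = "{H. F \<subseteq> H \<and> H \<subseteq> V \<and> indep E H}"
  have "?S \<subseteq> Pow V" by auto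
  then have "finite ?S" using assms(1) by (simp add: finite_subset)
  then obtain H where H: "H \<in> ?S" "\<And>H'. H' \<in> ?S \<Longrightarrow> H \<subseteq> H' \<Longrightarrow> H = H'"
    using finite_has_maximal2[of ?S F] assms by auto
  have "\<not> indep E (insert v H)" if "v \<in> V - H" for v
    using H(1) H(2)[of "insert v H"] that by auto
  then show thesis using H(1) that[of H] by (auto simp: facets_def)
qed

lemma facets_of_indep: "indep E V \<Longrightarrow> facets E V = {V}"
proof -
  assume V: "indep E V"
  have "indep E (insert v F)" if "F \<subseteq> V" "v \<in> V" for v F
    by (rule indep_subset[OF V]) (use that in auto)
  then show ?thesis using V by (fastforce simp: facets_def)
qed

locale sym_graph =
  fixes E :: "'v \<Rightarrow> 'v \<Rightarrow> bool"
  assumes sym: "E u v \<Longrightarrow> E v u" and irrefl: "\<not> E u u"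
begin

lemma indep_insert: "indep E (insert x F) \<longleftrightarrow> indep E F \<and> (\<forall>v\<in>F. \<not> E x v)"
  using sym irrefl by (auto simp: indep_def)

text \<open>A maximal independent set that avoids \<open>x\<close> is one of the graph without \<open>x\<close>.  The converse is the purpose of
shedding vertices: an independent set of the link always extends by a neighbour of \<open>x\<close>.\<close>

lemma facets_shedding:
  assumes "shedding E V x"
  shows "facets E V = facets E (V - {x}) \<union> insert x ` facets E (away E V x)"
proof (intro equalityI subsetI)
  have x: "x \<in> V" using assms by (auto simp: shedding_def)
  fix F assume F: "F \<in> facets E V"
  show "F \<in> facets E (V - {x}) \<union> insert x ` facets E (away E V x)"
  proof (cases "x \<in> F")
    case True
    then have F': "F = insert x (F - {x})" by auto
    have "indep E (insert x (F - {x}))" using F F' by (simp add: facets_def)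
    then have *: "indep E (F - {x})" "\<And>v. v \<in> F - {x} \<Longrightarrow> \<not> E x v" unfolding indep_insert by auto
    have "F - {x} \<in> facets E (away E V x)"
      unfolding facets_def mem_Collect_eq
    proof (intro conjI ballI)
      show "F - {x} \<subseteq> away E V x" using *(2) facets_subset[OF F] by (auto simp: away_def)
      show "indep E (F - {x})" by fact
      fix v assume v: "v \<in> away E V x - (F - {x})"
      then have "v \<in> V - F" "\<not> E x v" by (auto simp: away_def)
      then have "\<not> indep E (insert v F)" using F by (auto simp: facets_def)
      then have "\<not> indep E (insert x (insert v (F - {x})))" by (metis F' insert_commute)
      with \<open>\<not> E x v\<close> * show "\<not> indep E (insert v (F - {x}))" by (auto simp: indep_insert)
    qed
    then show ?thesis using F' by blast
  next
    case False
    then show ?thesis using F by (auto simp: facets_def)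
  qed
next
  have x: "x \<in> V" using assms by (auto simp: shedding_def)
  fix F assume "F \<in> facets E (V - {x}) \<union> insert x ` facets E (away E V x)"
  then show "F \<in> facets E V"
  proof
    assume F: "F \<in> facets E (V - {x})"
    have "\<not> indep E (insert x F)"
    proof
      assume ix: "indep E (insert x F)"
      then have "F \<subseteq> away E V x" using F by (auto simp: indep_insert facets_def away_def)
      then obtain y where y: "y \<in> V" "E x y" "\<forall>f\<in>F. \<not> E y f"
        using assms F by (auto simp: shedding_def facets_def)
      have "y \<noteq> x" "y \<notin> F" using y irrefl ix by (auto simp: indep_insert)
      moreover have "indep E (insert y F)" using F y by (auto simp: indep_insert facets_def)
      ultimately show False using F y by (auto simp: facets_def)
    qed
    then show ?thesis using F by (auto simp: facets_def)
  next
    assume "F \<in> insert x ` facets E (away E V x)"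
    then obtain G where G: "F = insert x G" "G \<in> facets E (away E V x)" by auto
    have Ga: "G \<subseteq> away E V x" by (rule facets_subset[OF G(2)])
    show ?thesis unfolding facets_def mem_Collect_eq
    proof (intro conjI ballI)
      show "F \<subseteq> V" using Ga x G(1) by (auto simp: away_def)
      show "indep E F" using G Ga by (auto simp: indep_insert facets_def away_def)
      fix v assume v: "v \<in> V - F"
      show "\<not> indep E (insert v F)"
      proof
        assume "indep E (insert v F)"
        then have "indep E (insert v G)" "\<not> E v x" using G(1) by (auto simp: indep_insert)
        moreover from this v G(1) have "v \<in> away E V x - G" using sym by (auto simp: away_def)
        ultimately show False using G(2) by (auto simp: facets_def)
      qed
    qed
  qed
qed

text \<open>Every facet of the link lies in a facet without \<open>x\<close> that is at least as large as the facet of the link together with \<open>x\<close>.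
Therefore the size of the largest facet around a set avoiding \<open>x\<close> can be computed in the graph without \<open>x\<close>.\<close>

lemma facet_of_link_extends:
  assumes "finite V" "shedding E V x" "F \<in> facets E (away E V x)"
  obtains F' where "F' \<in> facets E (V - {x})" "F \<subseteq> F'" "card F < card F'"
proof -
  have Fa: "F \<subseteq> away E V x" "indep E F" using assms(3) by (auto simp: facets_def)
  then obtain y where y: "y \<in> V" "E x y" "\<forall>f\<in>F. \<not> E y f"
    using assms(2) by (auto simp: shedding_def)
  have yF: "y \<noteq> x" "y \<notin> F" using y irrefl Fa by (auto simp: away_def)
  have "indep E (insert y F)" using Fa y by (auto simp: indep_insert)
  moreover have "insert y F \<subseteq> V - {x}" using Fa y yF by (auto simp: away_def)
  ultimately obtain F' where F': "F' \<in> facets E (V - {x})" "insert y F \<subseteq> F'"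
    using extend_to_facet[of "V - {x}" "insert y F" E] assms(1) by auto
  have "finite F'" by (rule finite_subset[OF facets_subset[OF F'(1)]]) (use assms(1) in simp)
  moreover have "F \<subset> F'" using F'(2) yF by auto
  ultimately have "card F < card F'" by (rule psubset_card_mono)
  then show thesis using that F' by blast
qed

end

text \<open>The cone over a chain with apex \<open>x\<close>, on top of a family \<open>D\<close> of sets that do not contain \<open>x\<close>; the condition
\<open>D \<subseteq> U\<close> is what keeps all families up-closed.\<close>

lemma chain_insert:
  assumes "interval_chain W j U U'" "x \<notin> W" "finite W" "upclosed W D" "D \<subseteq> U"
  shows "interval_chain (insert x W) (Suc j) (D \<union> insert x ` U) (D \<union> insert x ` U')"
proof -
  have up: "upclosed (insert x W) (D \<union> insert x ` U)" if U: "upclosed W U" "D \<subseteq> U" for U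
    unfolding upclosed_def
  proof (intro conjI ballI allI impI)
    show "D \<union> insert x ` U \<subseteq> Pow (insert x W)" using that assms(4) by (auto simp: upclosed_def)
    fix s t assume s: "s \<in> D \<union> insert x ` U" and st: "s \<subseteq> t" and t: "t \<subseteq> insert x W"
    show "t \<in> D \<union> insert x ` U"
    proof (cases "x \<in> t")
      case True
      from s obtain s' where s': "s' \<in> U" "s' \<subseteq> s" using U(2) by auto
      have "s' \<subseteq> W" using s'(1) U(1) by (auto simp: upclosed_def)
      then have "t - {x} \<in> U" using s' st t assms(2) by (intro upclosedD[OF that(1), of s' "t - {x}"]) auto
      then have "insert x (t - {x}) \<in> insert x ` U" by blast
      then show ?thesis using True by (simp add: insert_absorb)
    next
      case False
      with s st have "s \<in> D" by auto
      then show ?thesis using upclosedD[OF assms(4), of s t] st t False by auto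
    qed
  qed
  show ?thesis
    using assms(1,5)
  proof induction
    case (chain_refl U)
    then show ?case by (intro interval_chain.chain_refl up)
  next
    case (chain_step U U' r F)
    have *: "D \<union> insert x ` (U' \<union> {r..F}) = (D \<union> insert x ` U') \<union> {insert x r..insert x F}"
    proof -
      have "insert x ` {r..F} = {insert x r..insert x F}"
      proof (intro equalityI subsetI)
        fix t assume t: "t \<in> {insert x r..insert x F}"
        have "x \<notin> r" using chain_step.hyps assms(2) by auto
        then have "t - {x} \<in> {r..F}" using t by auto
        moreover have "t = insert x (t - {x})" using t by auto
        ultimately show "t \<in> insert x ` {r..F}" by blast
      qed auto
      then show ?thesis by auto
    qed
    have UW: "U' \<union> {r..F} \<subseteq> Pow W" "D \<subseteq> Pow W"
      using chain_step.hyps assms(4) by (auto simp: upclosed_def)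
    show ?case unfolding *
    proof (rule interval_chain.chain_step)
      show "interval_chain (insert x W) (Suc j) (D \<union> insert x ` U) (D \<union> insert x ` U')" using chain_step by simp
      have "finite F" by (rule finite_subset[OF chain_step.hyps(3) assms(3)])
      moreover have "x \<notin> F" using chain_step.hyps assms(2) by auto
      ultimately show "card (insert x F) = Suc j" using chain_step.hyps by simp
      show "upclosed (insert x W) (D \<union> insert x ` U' \<union> {insert x r..insert x F})"
        unfolding *[symmetric] using chain_step chain_subset[OF chain_step.hyps(1)] by (intro up) auto
      show "(D \<union> insert x ` U') \<inter> {insert x r..insert x F} = {}"
      proof (rule ccontr)
        assume "(D \<union> insert x ` U') \<inter> {insert x r..insert x F} \<noteq> {}"
        then obtain t where "t \<in> D \<union> insert x ` U'" "t \<in> {insert x r..insert x F}" by blast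
        then have t: "t \<in> D \<union> insert x ` U'" "insert x r \<subseteq> t" "t \<subseteq> insert x F" by simp_all
        from t(1,2) UW(2) assms(2) obtain s where s: "s \<in> U'" "t = insert x s" by auto
        have "x \<notin> s" "x \<notin> r" "x \<notin> F" using s UW(1) assms(2) chain_step.hyps by auto
        then have "s \<in> {r..F}" using s t by auto
        then show False using s chain_step.hyps by auto
      qed
    qed (use chain_step.hyps in auto)
  qed
qed

text \<open>A chain of sets that do not contain \<open>x\<close>, on top of a fixed cone over \<open>L\<close>.\<close>

lemma chain_add:
  assumes "interval_chain W j D D'" "x \<notin> W" "upclosed W L" "D' \<subseteq> L"
  shows "interval_chain (insert x W) j (D \<union> insert x ` L) (D' \<union> insert x ` L)"
  using assms(1,4)
proof induction
  have up: "upclosed (insert x W) (D \<union> insert x ` L)" if D: "upclosed W D" "D \<subseteq> L" for D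
    unfolding upclosed_def
  proof (intro conjI ballI allI impI)
    show "D \<union> insert x ` L \<subseteq> Pow (insert x W)" using that assms(3) by (auto simp: upclosed_def)
    fix s t assume s: "s \<in> D \<union> insert x ` L" and st: "s \<subseteq> t" and t: "t \<subseteq> insert x W"
    show "t \<in> D \<union> insert x ` L"
    proof (cases "x \<in> t")
      case True
      from s obtain s' where s': "s' \<in> L" "s' \<subseteq> s" using D(2) by auto
      have "s' \<subseteq> W" using s'(1) assms(3) by (auto simp: upclosed_def)
      then have "t - {x} \<in> L" using s' st t assms(2) by (intro upclosedD[OF assms(3), of s' "t - {x}"]) auto
      then have "insert x (t - {x}) \<in> insert x ` L" by blast
      then show ?thesis using True by (simp add: insert_absorb)
    next
      case False
      with s st have "s \<in> D" by auto
      then show ?thesis using upclosedD[OF that(1), of s t] st t False by auto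
    qed
  qed
  { case (chain_refl D)
    then show ?case by (intro interval_chain.chain_refl up) }
  { case (chain_step D D' r F)
    have *: "D' \<union> {r..F} \<union> insert x ` L = D' \<union> insert x ` L \<union> {r..F}" by auto
    have xF: "x \<notin> F" using chain_step.hyps assms(2) by auto
    show ?case unfolding *
    proof (rule interval_chain.chain_step)
      show "interval_chain (insert x W) j (D \<union> insert x ` L) (D' \<union> insert x ` L)" using chain_step by simp
      show "upclosed (insert x W) (D' \<union> insert x ` L \<union> {r..F})"
        unfolding *[symmetric] using chain_step by (intro up) auto
      have "insert x s \<notin> {r..F}" for s using xF by auto
      then show "(D' \<union> insert x ` L) \<inter> {r..F} = {}" using chain_step.hyps by blast
    qed (use chain_step.hyps in auto) }
qed

text \<open>By \<open>facets_shedding\<close> and \<open>facet_of_link_extends\<close>, the family for \<open>V\<close> splits into the family for \<open>V\<close>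
without \<open>x\<close> at the same level \<open>j\<close> and the cone over the family for the link at level \<open>j - 1\<close>.  The chain first
runs through the cone and then through the rest.\<close>

lemma (in sym_graph) chain_below_facets:
  assumes "vertex_decomposable E V" "finite W" "V \<subseteq> W"
  shows "interval_chain W j (below W (facets E V) j) (below W (facets E V) (Suc j))"
  using assms
proof (induction arbitrary: W j rule: vertex_decomposable.induct)
  case (decomposable_indep V)
  have f: "facets E V = {V}" using decomposable_indep facets_of_indep by auto
  show ?case
  proof (cases "card V = j")
    case False
    then have "below W {V} (Suc j) = below W {V} j" by (auto simp: below_def)
    then show ?thesis unfolding f using interval_chain.chain_refl[OF upclosed_below] by simp
  next
    case True
    have ab: "below W {V} (Suc j) = Pow W" "below W {V} j = {t \<in> Pow W. \<not> t \<subseteq> V}"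
      using True by (auto simp: below_def)
    have "Pow V \<subseteq> Pow W" using decomposable_indep.prems(2) by (rule Pow_mono)
    then have P: "Pow W = {t \<in> Pow W. \<not> t \<subseteq> V} \<union> Pow V" by blast
    have I: "{{}..V} = Pow V" by auto
    have eq: "below W {V} (Suc j) = below W {V} j \<union> {{}..V}" unfolding ab I by (rule P)
    have "interval_chain W j (below W {V} j) (below W {V} j \<union> {{}..V})"
    proof (rule interval_chain.chain_step[OF interval_chain.chain_refl[OF upclosed_below]])
      show "upclosed W (below W {V} j \<union> {{}..V})" unfolding eq[symmetric] by (rule upclosed_below)
      show "below W {V} j \<inter> {{}..V} = {}" using True by (auto simp: below_def)
    qed (use True decomposable_indep.prems in auto)
    then show ?thesis unfolding f eq .
  qed
next
  case (decomposable_shed V x)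
  let ?W = "W - {x}"
  let ?D = "\<lambda>j. below ?W (facets E (V - {x})) j" and ?L = "\<lambda>j. below ?W (facets E (away E V x)) j"
  have x: "x \<in> V" using decomposable_shed.hyps(1) by (auto simp: shedding_def)
  then have W: "insert x ?W = W" using decomposable_shed.prems by auto
  have finV: "finite V" by (rule finite_subset[OF decomposable_shed.prems(2,1)])
  \<comment> \<open>This inclusion makes the families up-closed; it is the step that needs shedding.\<close>
  have DL: "?D (Suc j) \<subseteq> ?L j" for j
  proof
    fix t assume t: "t \<in> ?D (Suc j)"
    have "card F < j" if F: "F \<in> facets E (away E V x)" "t \<subseteq> F" for F
    proof -
      obtain F' where "F' \<in> facets E (V - {x})" "F \<subseteq> F'" "card F < card F'"
        using facet_of_link_extends[OF finV decomposable_shed.hyps(1) F(1)] .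
      moreover from this have "card F' < Suc j" using t F by (auto simp: below_def)
      ultimately show ?thesis by simp
    qed
    then show "t \<in> ?L j" using t by (auto simp: below_def)
  qed
  have D0: "?D 0 \<subseteq> ?D (Suc 0)" "?D j \<subseteq> ?D (Suc j)" for j by (auto simp: below_def)
  have DL': "?D j \<subseteq> ?L (j - 1)" for j using DL[of "j - 1"] D0 by (cases j) auto
  \<comment> \<open>For \<open>j = 0\<close> the truncated subtraction is correct, since both levels \<open>0\<close> and \<open>-1\<close> consist of the non-faces.\<close>
  have split: "below W (facets E V) j = ?D j \<union> insert x ` ?L (j - 1)" for j
  proof (intro equalityI subsetI)
    fix t assume t: "t \<in> below W (facets E V) j"
    show "t \<in> ?D j \<union> insert x ` ?L (j - 1)"
    proof (cases "x \<in> t")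
      case False
      then show ?thesis using t unfolding facets_shedding[OF decomposable_shed.hyps(1)] by (auto simp: below_def)
    next
      case True
      have "card F < j - 1" if F: "F \<in> facets E (away E V x)" "t - {x} \<subseteq> F" for F
      proof -
        have "x \<notin> F" "finite F" using facets_subset[OF F(1)] finV by (auto simp: away_def intro: finite_subset)
        moreover have "insert x F \<in> facets E V"
          unfolding facets_shedding[OF decomposable_shed.hyps(1)] using F(1) by blast
        moreover have "t \<subseteq> insert x F" using F(2) by blast
        ultimately have "card (insert x F) < j" "x \<notin> F" "finite F" using t by (auto simp: below_def)
        then show ?thesis by simp
      qed
      then have "t - {x} \<in> ?L (j - 1)" using t by (auto simp: below_def)
      then have "insert x (t - {x}) \<in> insert x ` ?L (j - 1)" by blast
      then show ?thesis using True by (simp add: insert_absorb)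
    qed
  next
    fix t assume t: "t \<in> ?D j \<union> insert x ` ?L (j - 1)"
    have "x \<in> W" using W by blast
    then have tW: "t \<subseteq> W" using t by (auto simp: below_def)
    have "t - {x} \<in> ?L (j - 1)"
    proof (cases "t \<in> ?D j")
      case True
      then have "x \<notin> t" by (auto simp: below_def)
      then show ?thesis using True DL' by auto
    next
      case False
      with t obtain s where s: "s \<in> ?L (j - 1)" "t = insert x s" by auto
      then have "x \<notin> s" by (auto simp: below_def)
      with s show ?thesis by simp
    qed
    have 1: "card (insert x F) < j" if "F \<in> facets E (away E V x)" "t \<subseteq> insert x F" for F
    proof -
      have "x \<notin> F" "finite F" using facets_subset[OF that(1)] finV by (auto simp: away_def intro: finite_subset)
      moreover have "card F < j - 1"
        using \<open>t - {x} \<in> ?L (j - 1)\<close> that by (auto simp: below_def)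
      ultimately show ?thesis by simp
    qed
    moreover have "card F < j" if F: "F \<in> facets E (V - {x})" "t \<subseteq> F" for F
    proof -
      have "x \<notin> t" using F facets_subset[OF F(1)] by auto
      then show ?thesis using t F by (auto simp: below_def)
    qed
    ultimately show "t \<in> below W (facets E V) j"
      using tW unfolding facets_shedding[OF decomposable_shed.hyps(1)] by (auto simp: below_def)
  qed
  have sub: "V - {x} \<subseteq> ?W" "away E V x \<subseteq> ?W" using decomposable_shed.prems by (auto simp: away_def)
  have finW: "finite ?W" using decomposable_shed.prems by simp
  have 1: "interval_chain W j (?D j \<union> insert x ` ?L (j - 1)) (?D j \<union> insert x ` ?L j)"
  proof (cases j)
    case 0
    have "interval_chain (insert x ?W) 0 (?D 0 \<union> insert x ` ?L 0) (?D 0 \<union> insert x ` ?L 0)"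
      by (rule chain_add[OF interval_chain.chain_refl[OF upclosed_below] _ upclosed_below]) (use DL'[of 0] in auto)
    then show ?thesis unfolding W using 0 by simp
  next
    case (Suc i)
    have "interval_chain (insert x ?W) (Suc i) (?D j \<union> insert x ` ?L i) (?D j \<union> insert x ` ?L (Suc i))"
      by (rule chain_insert[OF decomposable_shed.IH(2)[OF finW sub(2)] _ finW upclosed_below])
        (use DL'[of j] Suc in auto)
    then show ?thesis unfolding W using Suc by simp
  qed
  have 2: "interval_chain W j (?D j \<union> insert x ` ?L j) (?D (Suc j) \<union> insert x ` ?L j)"
    using chain_add[OF decomposable_shed.IH(1)[OF finW sub(1)] _ upclosed_below DL, of x j] W by auto
  show ?case unfolding split using chain_trans[OF 2 1] by simp
qed

section \<open>Presenting modules by pairs of ideals\<close>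

lemma carrier_mpoly_ring: "carrier (mpoly_ring V) = mono_ideal (Pow V)"
  by (auto simp: mpoly_ring_def mono_ideal_def)

lemma mpoly_ring_simps [simp]:
  "x \<otimes>\<^bsub>mpoly_ring V\<^esub> y = x * y" "x \<oplus>\<^bsub>mpoly_ring V\<^esub> y = x + y"
  "\<one>\<^bsub>mpoly_ring V\<^esub> = 1" "\<zero>\<^bsub>mpoly_ring V\<^esub> = 0"
  by (auto simp: mpoly_ring_def)

abbreviation polys :: "'v set \<Rightarrow> ('v, 'k::comm_ring_1) mpoly set" where
  "polys V \<equiv> mono_ideal (Pow V)"

lemma polys_closed:
  fixes a b :: "('v, 'k::comm_ring_1) mpoly"
  shows "a \<in> polys V \<Longrightarrow> b \<in> polys V \<Longrightarrow> a + b \<in> polys V"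
    "a \<in> polys V \<Longrightarrow> b \<in> polys V \<Longrightarrow> a * b \<in> polys V"
    "a \<in> polys V \<Longrightarrow> - a \<in> polys V"
    "(0 :: ('v, 'k) mpoly) \<in> polys V" "(1 :: ('v, 'k) mpoly) \<in> polys V"
proof -
  note K = subring_of_mono_ideal[of V, where 'k = 'k]
  note K' = subring_of_submod[OF K]
  show "a \<in> polys V \<Longrightarrow> b \<in> polys V \<Longrightarrow> a + b \<in> polys V" by (rule submod_add[OF K'])
  show "a \<in> polys V \<Longrightarrow> b \<in> polys V \<Longrightarrow> a * b \<in> polys V" by (rule submod_mult[OF K'])
  show "a \<in> polys V \<Longrightarrow> - a \<in> polys V" by (rule submod_uminus[OF K K'])
  show "(0 :: ('v, 'k) mpoly) \<in> polys V" by (rule submod_zero[OF K'])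
  show "(1 :: ('v, 'k) mpoly) \<in> polys V" using K by (simp add: subring_of_def)
qed

lemma cring_mpoly_ring: "cring (mpoly_ring V :: ('v, 'k::field) mpoly ring)"
proof (rule cringI)
  show "abelian_group (mpoly_ring V :: ('v, 'k) mpoly ring)"
  proof (rule abelian_groupI; (simp add: carrier_mpoly_ring polys_closed add.assoc add.commute)?)
    fix x :: "('v, 'k) mpoly" assume "x \<in> polys V"
    then show "\<exists>y\<in>polys V. x + y = 0" by (intro bexI[of _ "- x"]) (auto simp: polys_closed)
  qed
  show "Group.comm_monoid (mpoly_ring V :: ('v, 'k) mpoly ring)"
    by (rule comm_monoidI) (auto simp: carrier_mpoly_ring polys_closed ac_simps)
qed (auto simp: distrib_right)

lemma ideal_iff_submod:
  "ideal I (mpoly_ring V :: ('v, 'k::field) mpoly ring) \<longleftrightarrow> I \<subseteq> polys V \<and> submod (polys V) I"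
proof -
  interpret cring "mpoly_ring V :: ('v, 'k) mpoly ring" by (rule cring_mpoly_ring)
  show ?thesis
  proof
    assume "ideal I (mpoly_ring V)"
    then interpret ideal I "mpoly_ring V" .
    have "I \<subseteq> polys V" using a_subset by (simp add: carrier_mpoly_ring)
    moreover have "0 \<in> I" using additive_subgroup.zero_closed[OF is_additive_subgroup] by simp
    ultimately show "I \<subseteq> polys V \<and> submod (polys V) I"
      using a_closed I_l_closed by (auto simp: submod_def carrier_mpoly_ring)
  next
    assume I: "I \<subseteq> polys V \<and> submod (polys V) I"
    have "x * a \<in> I" "a * x \<in> I" if "a \<in> I" "x \<in> polys V" for a x
      using I submod_mult[of "polys V" I x a] that by (simp_all add: mult.commute[of a])
    note mult = this
    show "ideal I (mpoly_ring V)"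
    proof (rule idealI[OF ring_axioms])
      show "subgroup I (add_monoid (mpoly_ring V))"
      proof (rule group.subgroupI[OF add.group_axioms])
        fix a assume a: "a \<in> I"
        then have "a \<in> polys V" using I by auto
        then have "a_inv (mpoly_ring V) a = - a"
          by (intro minus_equality) (auto simp: carrier_mpoly_ring polys_closed)
        then show "inv\<^bsub>add_monoid (mpoly_ring V)\<^esub> a \<in> I"
          using I a submod_uminus[OF subring_of_mono_ideal, of V I a] by (simp add: a_inv_def)
      qed (use I in \<open>auto simp: carrier_mpoly_ring submod_def\<close>)
    qed (use mult in \<open>auto simp: carrier_mpoly_ring\<close>)
  qed
qed

text \<open>A module \<open>Q\<close> that is isomorphic to \<open>A / B\<close> by means of \<open>\<phi>\<close>; the module structure of \<open>Q\<close> is then inherited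
from \<open>A\<close>.  All modules below are subquotients of the polynomial ring, and forming submodules and quotients
only changes the pair \<open>(A, B)\<close>.  This keeps the nested cosets in the carrier of \<open>Q\<close> out of all later arguments.\<close>

locale presentation =
  fixes V :: "'v set" and A B :: "('v, 'k::field) mpoly set"
    and Q :: "(('v, 'k) mpoly, 'm, 'c) module_scheme"
    and \<phi> :: "(('v, 'k) mpoly) \<Rightarrow> 'm"
  assumes A: "submod (polys V) A" and B: "submod (polys V) B" and BA: "B \<subseteq> A"
    and carrier_eq: "carrier Q = \<phi> ` A"
    and add_eq: "a \<in> A \<Longrightarrow> b \<in> A \<Longrightarrow> \<phi> a \<oplus>\<^bsub>Q\<^esub> \<phi> b = \<phi> (a + b)"
    and smult_eq: "r \<in> polys V \<Longrightarrow> a \<in> A \<Longrightarrow> r \<odot>\<^bsub>Q\<^esub> \<phi> a = \<phi> (r * a)"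
    and zero_eq: "\<zero>\<^bsub>Q\<^esub> = \<phi> 0"
    and eq_iff: "a \<in> A \<Longrightarrow> b \<in> A \<Longrightarrow> \<phi> a = \<phi> b \<longleftrightarrow> a - b \<in> B"
begin

lemma zeroA: "0 \<in> A" and addA: "a \<in> A \<Longrightarrow> b \<in> A \<Longrightarrow> a + b \<in> A"
  and multA: "r \<in> polys V \<Longrightarrow> a \<in> A \<Longrightarrow> r * a \<in> A"
  and uminusA: "a \<in> A \<Longrightarrow> - a \<in> A"
  using submod_zero[OF A] submod_add[OF A] submod_mult[OF A] submod_uminus[OF subring_of_mono_ideal A]
  by auto

lemma eq_zero_iff: "a \<in> A \<Longrightarrow> \<phi> a = \<zero>\<^bsub>Q\<^esub> \<longleftrightarrow> a \<in> B"
  using eq_iff[of a 0] zeroA by (simp add: zero_eq)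

lemma abelian_group: "abelian_group Q"
proof (rule abelian_groupI)
  fix x assume "x \<in> carrier Q"
  then obtain a where "x = \<phi> a" "a \<in> A" by (auto simp: carrier_eq)
  then show "\<exists>y\<in>carrier Q. y \<oplus>\<^bsub>Q\<^esub> x = \<zero>\<^bsub>Q\<^esub>"
    by (intro bexI[of _ "\<phi> (- a)"]) (auto simp: carrier_eq add_eq uminusA zero_eq)
qed (auto simp: carrier_eq add_eq zero_eq addA zeroA ac_simps)

lemma module: "module (mpoly_ring V) Q"
  by (rule moduleI[OF cring_mpoly_ring abelian_group])
    (auto simp: carrier_mpoly_ring carrier_eq add_eq smult_eq multA addA polys_closed algebra_simps)

lemma a_inv_eq: assumes "a \<in> A" shows "a_inv Q (\<phi> a) = \<phi> (- a)"
proof -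
  interpret abelian_group Q by (rule abelian_group)
  show ?thesis
    by (rule minus_equality) (use assms in \<open>auto simp: carrier_eq add_eq uminusA zero_eq\<close>)
qed

lemma image_submodule:
  assumes "submod (polys V) C" "C \<subseteq> A"
  shows "submodule (\<phi> ` C) (mpoly_ring V) Q"
proof -
  interpret module "mpoly_ring V" Q by (rule module)
  show ?thesis
  proof (rule submoduleI)
    show "\<phi> ` C \<subseteq> carrier Q" using assms by (auto simp: carrier_eq)
    show "\<zero>\<^bsub>Q\<^esub> \<in> \<phi> ` C" using submod_zero[OF assms(1)] by (auto simp: zero_eq)
    fix x assume "x \<in> \<phi> ` C"
    then obtain a where a: "x = \<phi> a" "a \<in> C" by auto
    then show "\<ominus>\<^bsub>Q\<^esub> x \<in> \<phi> ` C"
      using assms submod_uminus[OF subring_of_mono_ideal assms(1)] by (auto simp: a_inv_eq subset_iff)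
    fix y assume "y \<in> \<phi> ` C"
    then obtain b where b: "y = \<phi> b" "b \<in> C" by auto
    then show "x \<oplus>\<^bsub>Q\<^esub> y \<in> \<phi> ` C"
      using a assms add_eq[of a b] submod_add[OF assms(1)] by auto
  next
    fix r :: "('v, 'k) mpoly" and x assume "r \<in> carrier (mpoly_ring V)" "x \<in> \<phi> ` C"
    then obtain a where a: "x = \<phi> a" "a \<in> C" "r \<in> polys V" by (auto simp: carrier_mpoly_ring)
    then show "r \<odot>\<^bsub>Q\<^esub> x \<in> \<phi> ` C" using assms smult_eq[of r a] submod_mult[OF assms(1)] by auto
  qed
qed

lemma submodule_vimage:
  assumes "submodule N (mpoly_ring V) Q"
  shows "submod (polys V) {a \<in> A. \<phi> a \<in> N}"
proof -
  interpret module "mpoly_ring V" Q by (rule module)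
  note N = submoduleE[OF assms]
  have "\<zero>\<^bsub>Q\<^esub> \<in> N" using subgroup.one_closed[OF submodule.axioms(1)[OF assms]] by simp
  then show ?thesis
    using N(4,5) zeroA unfolding submod_def
    by (auto simp: zero_eq addA multA carrier_mpoly_ring simp flip: add_eq smult_eq)
qed

lemma presentation_sub:
  assumes "submod (polys V) C" "B \<subseteq> C" "C \<subseteq> A"
  shows "presentation V C B (Q\<lparr>carrier := \<phi> ` C\<rparr>) \<phi>"
proof
  show "\<phi> a = \<phi> b \<longleftrightarrow> a - b \<in> B" if "a \<in> C" "b \<in> C" for a b
    by (rule eq_iff) (use that assms in auto)
qed (use assms B in \<open>auto simp: add_eq smult_eq zero_eq subset_iff\<close>)

lemma coset_eq:
  assumes "C \<subseteq> A" "a \<in> A"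
  shows "\<phi> ` C +>\<^bsub>Q\<^esub> \<phi> a = \<phi> ` ((\<lambda>c. c + a) ` C)"
proof -
  have "\<phi> ` C +>\<^bsub>Q\<^esub> \<phi> a = (\<lambda>c. \<phi> c \<oplus>\<^bsub>Q\<^esub> \<phi> a) ` C"
    unfolding a_r_coset_def r_coset_def by auto
  also have "\<dots> = (\<lambda>c. \<phi> (c + a)) ` C" by (rule image_cong) (use assms add_eq in auto)
  finally show ?thesis by (simp add: image_image)
qed

lemma coset_eq_iff:
  assumes C: "submod (polys V) C" "B \<subseteq> C" "C \<subseteq> A" and ab: "a \<in> A" "b \<in> A"
  shows "\<phi> ` C +>\<^bsub>Q\<^esub> \<phi> a = \<phi> ` C +>\<^bsub>Q\<^esub> \<phi> b \<longleftrightarrow> a - b \<in> C"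
proof
  assume "\<phi> ` C +>\<^bsub>Q\<^esub> \<phi> a = \<phi> ` C +>\<^bsub>Q\<^esub> \<phi> b"
  then have eq: "\<phi> ` ((\<lambda>c. c + a) ` C) = \<phi> ` ((\<lambda>c. c + b) ` C)" using coset_eq C ab by simp
  have "\<phi> (0 + a) \<in> \<phi> ` ((\<lambda>c. c + a) ` C)" using submod_zero[OF C(1)] by blast
  then obtain c where c: "c \<in> C" "\<phi> a = \<phi> (c + b)" unfolding eq by auto
  then have "a - (c + b) \<in> B" using eq_iff[of a "c + b"] ab C addA by auto
  then have "(a - (c + b)) + c \<in> C" by (intro submod_add[OF C(1)]) (use C c in auto)
  then show "a - b \<in> C" by (simp add: algebra_simps)
next
  assume ab': "a - b \<in> C"
  have "(\<lambda>c. c + a) ` C = (\<lambda>c. c + b) ` C"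
  proof (intro equalityI subsetI)
    fix x assume "x \<in> (\<lambda>c. c + a) ` C"
    then obtain c where "c \<in> C" "x = c + a" by auto
    then have "x = (c + (a - b)) + b" "c + (a - b) \<in> C" using submod_add[OF C(1) _ ab'] by auto
    then show "x \<in> (\<lambda>c. c + b) ` C" by blast
  next
    fix x assume "x \<in> (\<lambda>c. c + b) ` C"
    then obtain c where "c \<in> C" "x = c + b" by auto
    then have "x = (c - (a - b)) + a" "c - (a - b) \<in> C"
      using submod_diff[OF subring_of_mono_ideal C(1) _ ab'] by auto
    then show "x \<in> (\<lambda>c. c + a) ` C" by blast
  qed
  then show "\<phi> ` C +>\<^bsub>Q\<^esub> \<phi> a = \<phi> ` C +>\<^bsub>Q\<^esub> \<phi> b" using coset_eq C ab by simp
qed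

lemma presentation_quot:
  assumes C: "submod (polys V) C" "B \<subseteq> C" "C \<subseteq> A"
  shows "presentation V A C (quot_module Q (\<phi> ` C)) (\<lambda>a. \<phi> ` C +>\<^bsub>Q\<^esub> \<phi> a)"
proof
  show "submod (polys V) A" "submod (polys V) C" "C \<subseteq> A" by (fact A C)+
  show "carrier (quot_module Q (\<phi> ` C)) = (\<lambda>a. \<phi> ` C +>\<^bsub>Q\<^esub> \<phi> a) ` A"
    by (auto simp: quot_module_def A_RCOSETS_def RCOSETS_def carrier_eq a_r_coset_def)
  show "\<phi> ` C +>\<^bsub>Q\<^esub> \<phi> a = \<phi> ` C +>\<^bsub>Q\<^esub> \<phi> b \<longleftrightarrow> a - b \<in> C" if "a \<in> A" "b \<in> A" for a b
    using coset_eq_iff C that by blast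
  show "\<zero>\<^bsub>quot_module Q (\<phi> ` C)\<^esub> = \<phi> ` C +>\<^bsub>Q\<^esub> \<phi> 0"
    using coset_eq[OF C(3) zeroA] by (simp add: quot_module_def)
  show "(\<phi> ` C +>\<^bsub>Q\<^esub> \<phi> a) \<oplus>\<^bsub>quot_module Q (\<phi> ` C)\<^esub> (\<phi> ` C +>\<^bsub>Q\<^esub> \<phi> b) = \<phi> ` C +>\<^bsub>Q\<^esub> \<phi> (a + b)"
    if ab: "a \<in> A" "b \<in> A" for a b
  proof -
    have 1: "\<phi> ((c + a) + (d + b)) = \<phi> (c + a) \<oplus>\<^bsub>Q\<^esub> \<phi> (d + b)" if "c \<in> C" "d \<in> C" for c d
      using that ab C addA add_eq[of "c + a" "d + b"] by (simp add: subset_iff)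
    have "\<phi> ` ((\<lambda>c. c + a) ` C) <+>\<^bsub>Q\<^esub> \<phi> ` ((\<lambda>c. c + b) ` C) = \<phi> ` ((\<lambda>c. c + (a + b)) ` C)"
    proof (intro equalityI subsetI)
      fix x assume "x \<in> \<phi> ` ((\<lambda>c. c + a) ` C) <+>\<^bsub>Q\<^esub> \<phi> ` ((\<lambda>c. c + b) ` C)"
      then obtain u v where "u \<in> \<phi> ` ((\<lambda>c. c + a) ` C)" "v \<in> \<phi> ` ((\<lambda>c. c + b) ` C)" "x = u \<oplus>\<^bsub>Q\<^esub> v"
        unfolding set_add_def set_mult_def by auto
      then obtain c d where cd: "c \<in> C" "d \<in> C" "x = \<phi> (c + a) \<oplus>\<^bsub>Q\<^esub> \<phi> (d + b)" by blast
      then have "x = \<phi> ((c + d) + (a + b))" using 1[OF cd(1,2)] by (simp add: ac_simps)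
      then show "x \<in> \<phi> ` ((\<lambda>c. c + (a + b)) ` C)" using submod_add[OF C(1)] cd by blast
    next
      fix x assume "x \<in> \<phi> ` ((\<lambda>c. c + (a + b)) ` C)"
      then obtain c where c: "c \<in> C" "x = \<phi> (c + (a + b))" by auto
      then have "x = \<phi> (c + a) \<oplus>\<^bsub>Q\<^esub> \<phi> (0 + b)" using 1[OF c(1) submod_zero[OF C(1)]] by (simp add: ac_simps)
      then show "x \<in> \<phi> ` ((\<lambda>c. c + a) ` C) <+>\<^bsub>Q\<^esub> \<phi> ` ((\<lambda>c. c + b) ` C)"
        using c(1) submod_zero[OF C(1)] unfolding set_add_def set_mult_def by fastforce
    qed
    then show ?thesis using coset_eq[OF C(3)] ab addA by (simp add: quot_module_def)
  qed
  show "r \<odot>\<^bsub>quot_module Q (\<phi> ` C)\<^esub> (\<phi> ` C +>\<^bsub>Q\<^esub> \<phi> a) = \<phi> ` C +>\<^bsub>Q\<^esub> \<phi> (r * a)"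
    if ra: "r \<in> polys V" "a \<in> A" for r a
  proof -
    have "\<phi> ` C +>\<^bsub>Q\<^esub> (r \<odot>\<^bsub>Q\<^esub> \<phi> (c + a)) = \<phi> ` C +>\<^bsub>Q\<^esub> \<phi> (r * a)" if "c \<in> C" for c
    proof -
      have "c + a \<in> A" "r * (c + a) \<in> A" "r * a \<in> A" using that ra C addA multA by auto
      moreover have "r * (c + a) - r * a \<in> C" using submod_mult[OF C(1) ra(1) that] by (simp add: algebra_simps)
      ultimately show ?thesis using coset_eq_iff[OF C] smult_eq ra by simp
    qed
    then show ?thesis
      using coset_eq[OF C(3) ra(2)] submod_zero[OF C(1)] by (auto simp: quot_module_def)
  qed
qed

lemma annihilator_eq:
  "annihilator (mpoly_ring V) Q = {r \<in> polys V. \<forall>a\<in>A. r * a \<in> B}"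
  by (auto simp: annihilator_def carrier_mpoly_ring carrier_eq smult_eq eq_zero_iff multA)

lemma nonzerodivisor_iff:
  "r \<in> polys V \<Longrightarrow> nonzerodivisor_on Q r \<longleftrightarrow> (\<forall>a\<in>A. r * a \<in> B \<longrightarrow> a \<in> B)"
  by (auto simp: nonzerodivisor_on_def carrier_eq smult_eq eq_zero_iff multA)

end

text \<open>The ideal \<open>B + (r\<^sub>1, ..., r\<^sub>n) A\<close>, defined by the recursion that matches \<open>regular_on\<close>.\<close>

fun plus_multiples :: "'r::comm_ring_1 set \<Rightarrow> 'r set \<Rightarrow> 'r list \<Rightarrow> 'r set" where
  "plus_multiples A B [] = B"
| "plus_multiples A B (r # rs) = plus_multiples A (B + r *o A) rs"

lemma plus_multiples_props:
  assumes "submod K A" "submod K B" "B \<subseteq> A" "set rs \<subseteq> K"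
  shows "submod K (plus_multiples A B rs) \<and> B \<subseteq> plus_multiples A B rs \<and> plus_multiples A B rs \<subseteq> A \<and>
    (\<forall>r\<in>set rs. \<forall>a\<in>A. r * a \<in> plus_multiples A B rs) \<and>
    (\<forall>C. submod K C \<longrightarrow> B \<subseteq> C \<longrightarrow> (\<forall>r\<in>set rs. \<forall>a\<in>A. r * a \<in> C) \<longrightarrow> plus_multiples A B rs \<subseteq> C)"
  using assms(2-)
proof (induction rs arbitrary: B)
  case (Cons r rs)
  have rA: "submod K (r *o A)" by (rule submod_times[OF assms(1)])
  have B': "submod K (B + r *o A)" by (rule submod_plus[OF Cons.prems(1) rA])
  have sub: "B \<subseteq> B + r *o A" "r *o A \<subseteq> B + r *o A"
    by (rule subset_plus1[OF rA], rule subset_plus2[OF Cons.prems(1)])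
  have "r *o A \<subseteq> A" by (rule times_subset[OF assms(1)]) (use Cons.prems in auto)
  then have B'A: "B + r *o A \<subseteq> A" by (intro plus_subset[OF assms(1)] Cons.prems(2))
  have rs: "set rs \<subseteq> K" using Cons.prems by auto
  note IH = Cons.IH[OF B' B'A rs]
  have "plus_multiples A (B + r *o A) rs \<subseteq> C"
    if C: "submod K C" "B \<subseteq> C" "\<forall>s\<in>set (r # rs). \<forall>a\<in>A. s * a \<in> C" for C
  proof -
    have "r *o A \<subseteq> C" using C(3) by (auto simp: elt_set_times_def)
    then have "B + r *o A \<subseteq> C" by (rule plus_subset[OF C(1,2)])
    then show ?thesis using IH C by simp
  qed
  moreover have "r * a \<in> plus_multiples A (B + r *o A) rs" if "a \<in> A" for a
    using IH sub(2) set_times_intro2[OF that, of r] by blast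
  ultimately show ?case using IH sub(1) by auto
qed auto

lemma plus_multiples_submod:
  "submod K A \<Longrightarrow> submod K B \<Longrightarrow> B \<subseteq> A \<Longrightarrow> set rs \<subseteq> K \<Longrightarrow> submod K (plus_multiples A B rs)"
  and plus_multiples_lower:
  "submod K A \<Longrightarrow> submod K B \<Longrightarrow> B \<subseteq> A \<Longrightarrow> set rs \<subseteq> K \<Longrightarrow> B \<subseteq> plus_multiples A B rs"
  and plus_multiples_upper:
  "submod K A \<Longrightarrow> submod K B \<Longrightarrow> B \<subseteq> A \<Longrightarrow> set rs \<subseteq> K \<Longrightarrow> plus_multiples A B rs \<subseteq> A"
  and plus_multiples_gen:
  "submod K A \<Longrightarrow> submod K B \<Longrightarrow> B \<subseteq> A \<Longrightarrow> set rs \<subseteq> K \<Longrightarrow> r \<in> set rs \<Longrightarrow> a \<in> A \<Longrightarrow>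
    r * a \<in> plus_multiples A B rs"
  by (simp_all only: plus_multiples_props simp_thms)

lemma plus_multiples_least:
  assumes "submod K A" "submod K B" "B \<subseteq> A" "set rs \<subseteq> K"
    and "submod K C" "B \<subseteq> C" "\<And>r a. r \<in> set rs \<Longrightarrow> a \<in> A \<Longrightarrow> r * a \<in> C"
  shows "plus_multiples A B rs \<subseteq> C"
  using plus_multiples_props[OF assms(1-4), THEN conjunct2, THEN conjunct2, THEN conjunct2, THEN conjunct2]
    assms(5-) by simp

lemma regular_on_iff_nth:
  "regular_on A B rs \<longleftrightarrow> (\<forall>i<length rs. \<forall>a\<in>A. rs ! i * a \<in> plus_multiples A B (take i rs) \<longrightarrow> a \<in> plus_multiples A B (take i rs))"
  by (induction rs arbitrary: B) (simp_all add: All_less_Suc2)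

context presentation
begin

lemma list_smult_eq:
  assumes rs: "set rs \<subseteq> polys V"
  shows "list_smult_module (mpoly_ring V) Q rs = \<phi> ` plus_multiples A B rs"
proof -
  note p = plus_multiples_submod[OF A B BA rs] plus_multiples_lower[OF A B BA rs] plus_multiples_upper[OF A B BA rs]
    plus_multiples_gen[OF A B BA rs]
  let ?G = "{r \<odot>\<^bsub>Q\<^esub> x | r x. r \<in> set rs \<and> x \<in> carrier Q}"
  have G: "?G = (\<lambda>(r, a). \<phi> (r * a)) ` (set rs \<times> A)"
  proof (intro equalityI subsetI)
    fix y assume "y \<in> ?G"
    then obtain r a where "r \<in> set rs" "a \<in> A" "y = r \<odot>\<^bsub>Q\<^esub> \<phi> a" by (auto simp: carrier_eq)
    moreover from this have "y = \<phi> (r * a)" using smult_eq rs by auto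
    ultimately show "y \<in> (\<lambda>(r, a). \<phi> (r * a)) ` (set rs \<times> A)"
      by (intro image_eqI[where x = "(r, a)"]) auto
  next
    fix y assume "y \<in> (\<lambda>(r, a). \<phi> (r * a)) ` (set rs \<times> A)"
    then obtain r a where "r \<in> set rs" "a \<in> A" "y = \<phi> (r * a)" by auto
    moreover from this have "y = r \<odot>\<^bsub>Q\<^esub> \<phi> a" "\<phi> a \<in> carrier Q"
      using smult_eq rs by (auto simp: carrier_eq)
    ultimately show "y \<in> ?G" by blast
  qed
  have "submodule (\<phi> ` plus_multiples A B rs) (mpoly_ring V) Q" using p by (intro image_submodule) auto
  moreover have "?G \<subseteq> \<phi> ` plus_multiples A B rs" unfolding G
  proof (rule image_subsetI)
    fix x assume "x \<in> set rs \<times> A"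
    then show "(case x of (r, a) \<Rightarrow> \<phi> (r * a)) \<in> \<phi> ` plus_multiples A B rs" using p by (cases x) auto
  qed
  moreover have "\<phi> ` plus_multiples A B rs \<subseteq> N" if N: "submodule N (mpoly_ring V) Q" "?G \<subseteq> N" for N
  proof -
    interpret N: submodule N "mpoly_ring V" Q by (rule N(1))
    have "\<zero>\<^bsub>Q\<^esub> \<in> N" using N.one_closed by simp
    then have "b \<in> {a \<in> A. \<phi> a \<in> N}" if "b \<in> B" for b
      using that BA eq_zero_iff[of b] by auto
    moreover have "r * a \<in> {a \<in> A. \<phi> a \<in> N}" if "r \<in> set rs" "a \<in> A" for r a
    proof -
      have "\<phi> (r * a) \<in> ?G" unfolding G by (rule image_eqI[where x = "(r, a)"]) (use that in auto)
      moreover have "r * a \<in> A" by (rule multA) (use that rs in auto)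
      ultimately show ?thesis using N(2) by blast
    qed
    ultimately have "plus_multiples A B rs \<subseteq> {a \<in> A. \<phi> a \<in> N}"
      using BA by (intro plus_multiples_least[OF A B BA rs submodule_vimage[OF N(1)]]) blast+
    then show ?thesis by auto
  qed
  ultimately show ?thesis unfolding list_smult_module_def gen_submodule_def
    by (intro equalityI Inter_greatest Inter_lower) simp_all
qed

lemma regular_sequence_iff:
  "regular_sequence (mpoly_ring V) Q rs \<longleftrightarrow>
    set rs \<subseteq> polys V \<and> regular_on A B rs \<and> plus_multiples A B rs \<noteq> A"
proof (cases "set rs \<subseteq> polys V")
  case rs: True
  note p = plus_multiples_submod[OF A B BA rs] plus_multiples_lower[OF A B BA rs] plus_multiples_upper[OF A B BA rs]
  have "\<phi> ` plus_multiples A B rs = carrier Q \<longleftrightarrow> plus_multiples A B rs = A"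
  proof
    assume eq: "\<phi> ` plus_multiples A B rs = carrier Q"
    have "a \<in> plus_multiples A B rs" if "a \<in> A" for a
    proof -
      have "\<phi> a \<in> \<phi> ` plus_multiples A B rs" unfolding eq using that by (simp add: carrier_eq)
      then obtain b where b: "b \<in> plus_multiples A B rs" "\<phi> a = \<phi> b" by auto
      then have "a - b \<in> B" using p(3) that eq_iff[of a b] by auto
      then have "(a - b) + b \<in> plus_multiples A B rs" using b p(2) by (intro submod_add[OF p(1)]) auto
      then show ?thesis by simp
    qed
    then show "plus_multiples A B rs = A" using p(3) by blast
  qed (simp add: carrier_eq)
  moreover have "nonzerodivisor_on (quot_module Q (list_smult_module (mpoly_ring V) Q (take i rs))) (rs ! i)
      \<longleftrightarrow> (\<forall>a\<in>A. rs ! i * a \<in> plus_multiples A B (take i rs) \<longrightarrow> a \<in> plus_multiples A B (take i rs))"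
    if i: "i < length rs" for i
  proof -
    have t: "set (take i rs) \<subseteq> polys V" using rs set_take_subset[of i rs] by blast
    interpret Qi: presentation V A "plus_multiples A B (take i rs)" "quot_module Q (\<phi> ` plus_multiples A B (take i rs))"
      "\<lambda>a. \<phi> ` plus_multiples A B (take i rs) +>\<^bsub>Q\<^esub> \<phi> a"
      by (intro presentation_quot plus_multiples_submod[OF A B BA t] plus_multiples_lower[OF A B BA t]
          plus_multiples_upper[OF A B BA t])
    have "rs ! i \<in> polys V" using rs i by auto
    then show ?thesis unfolding list_smult_eq[OF t] by (rule Qi.nonzerodivisor_iff)
  qed
  ultimately show ?thesis
    using rs unfolding regular_sequence_def regular_on_iff_nth by (simp add: list_smult_eq carrier_mpoly_ring)
next
  case False
  then show ?thesis by (simp add: regular_sequence_def carrier_mpoly_ring)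
qed

end

lemma presentation_ring:
  "presentation V (polys V) {0} (ring_as_module (mpoly_ring V :: ('v, 'k::field) mpoly ring)) (\<lambda>p. p)"
proof
  show "submod (polys V) {0 :: ('v, 'k) mpoly}" by (simp add: submod_def)
  show "submod (polys V) (polys V :: ('v, 'k) mpoly set)"
    by (rule subring_of_submod[OF subring_of_mono_ideal])
  show "{0} \<subseteq> (polys V :: ('v, 'k) mpoly set)" by (simp add: polys_closed)
qed (simp_all add: ring_as_module_def carrier_mpoly_ring)

section \<open>Dependence bounds regular sequences and chains of primes\<close>

text \<open>\<open>dependence K rs z\<close> says that \<open>z\<close> is the value at \<open>rs\<close> of a polynomial whose lexicographically lowest
term has coefficient one, in the nested form
\<open>r\<^sub>1\<^sup>m\<^sup>1 (r\<^sub>2\<^sup>m\<^sup>2 (... (1 + r\<^sub>n h\<^sub>n) ...) + r\<^sub>1 h\<^sub>1)\<close> in which such a relation can be peeled off one element at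
a time.\<close>

inductive dependence :: "'r::comm_ring_1 set \<Rightarrow> 'r list \<Rightarrow> 'r \<Rightarrow> bool" for K where
  dependence_Nil: "dependence K [] 1"
| dependence_Cons: "dependence K rs y \<Longrightarrow> h \<in> K \<Longrightarrow> dependence K (r # rs) (r ^ n * (y + r * h))"

lemma subring_power: "subring_of K \<Longrightarrow> r \<in> K \<Longrightarrow> r ^ n \<in> K"
  by (induction n) (auto simp: subring_of_def)

lemma dependence_in:
  assumes "subring_of K"
  shows "dependence K rs z \<Longrightarrow> set rs \<subseteq> K \<Longrightarrow> z \<in> K"
proof (induction rule: dependence.induct)
  case (dependence_Cons rs y h r n)
  then show ?case using assms subring_power[OF assms, of r n] by (simp add: subring_of_def)
qed (use assms in \<open>simp add: subring_of_def\<close>)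

text \<open>If \<open>z\<close> annihilates \<open>A / B\<close>, the power of the first element can be cancelled, and modulo the first element the rest
of the relation remains.  In the end \<open>1\<close> annihilates the quotient by the whole sequence.\<close>

lemma dependence_regular_on:
  assumes K: "subring_of K" and A: "submod K A"
  shows "dependence K rs z \<Longrightarrow> set rs \<subseteq> K \<Longrightarrow> submod K B \<Longrightarrow> regular_on A B rs \<Longrightarrow> (\<And>a. a \<in> A \<Longrightarrow> z * a \<in> B)
    \<Longrightarrow> A \<subseteq> plus_multiples A B rs"
proof (induction arbitrary: B rule: dependence.induct)
  case dependence_Nil
  then show ?case by auto
next
  case (dependence_Cons rs y h r n)
  have r: "r \<in> K" "set rs \<subseteq> K" and reg1: "\<And>a. a \<in> A \<Longrightarrow> r * a \<in> B \<Longrightarrow> a \<in> B" and reg2: "regular_on A (B + r *o A) rs"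
    using dependence_Cons.prems by auto
  have y: "y \<in> K" by (rule dependence_in[OF K dependence_Cons.hyps(1) r(2)])
  have pow: "a \<in> B" if "a \<in> A" "r ^ m * a \<in> B" for a m
    using that
  proof (induction m)
    case (Suc m)
    have "r ^ m * a \<in> A" by (rule submod_mult[OF A subring_power[OF K r(1)] Suc.prems(1)])
    then show ?case using Suc reg1[of "r ^ m * a"] by (simp add: mult.assoc)
  qed simp
  have "y * a \<in> B + r *o A" if a: "a \<in> A" for a
  proof -
    have "y + r * h \<in> K" using y r dependence_Cons.hyps(2) K by (simp add: subring_of_def)
    then have "(y + r * h) * a \<in> B"
      using pow[of "(y + r * h) * a" n] dependence_Cons.prems(4)[OF a] submod_mult[OF A _ a] by (simp add: mult.assoc)
    moreover have "- (h * a) \<in> A" by (intro submod_uminus[OF K A] submod_mult[OF A] dependence_Cons.hyps a)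
    ultimately have "(y + r * h) * a + r * (- (h * a)) \<in> B + r *o A" by (intro set_plus_intro set_times_intro2)
    then show ?thesis by (simp add: algebra_simps)
  qed
  then show ?case
    using dependence_Cons.IH[OF r(2) submod_plus[OF dependence_Cons.prems(2) submod_times[OF A]] reg2] by simp
qed

text \<open>The same peeling for primes: the first element is not in \<open>P\<^sub>0\<close>, so its power can be cancelled, but it is in
\<open>P\<^sub>1\<close>, so the rest of the relation lies in \<open>P\<^sub>1\<close>.  In the end \<open>1\<close> would lie in the last prime.\<close>

lemma dependence_prime_chain:
  fixes P :: "nat \<Rightarrow> ('v, 'k::field) mpoly set"
  shows "dependence (polys V) rs z \<Longrightarrow> set rs \<subseteq> polys V \<Longrightarrow>
    (\<And>i. i \<le> length rs \<Longrightarrow> primeideal (P i) (mpoly_ring V)) \<Longrightarrow>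
    (\<And>i. i < length rs \<Longrightarrow> P i \<subseteq> P (Suc i) \<and> rs ! i \<in> P (Suc i) \<and> rs ! i \<notin> P i) \<Longrightarrow> z \<notin> P 0"
proof (induction arbitrary: P rule: dependence.induct)
  case dependence_Nil
  then interpret primeideal "P 0" "mpoly_ring V" by simp
  show ?case using one_imp_carrier I_notcarr by auto
next
  case (dependence_Cons rs y h r n)
  note K = subring_of_mono_ideal[of V, where 'k = 'k]
  have 0: "P 0 \<subseteq> P (Suc 0)" "r \<in> P (Suc 0)" "r \<notin> P 0" using dependence_Cons.prems(3)[of 0] by auto
  interpret P0: primeideal "P 0" "mpoly_ring V" using dependence_Cons.prems(2)[of 0] by simp
  interpret P1: primeideal "P (Suc 0)" "mpoly_ring V" using dependence_Cons.prems(2)[of 1] by simp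
  have rs: "r \<in> polys V" "set rs \<subseteq> polys V" using dependence_Cons.prems by auto
  have y: "y \<in> polys V" by (rule dependence_in[OF K dependence_Cons.hyps(1) rs(2)])
  have yrh: "y + r * h \<in> polys V" using y rs dependence_Cons.hyps(2) by (intro polys_closed)
  have "y \<notin> P (Suc 0)"
    using dependence_Cons.IH[of "\<lambda>i. P (Suc i)"] rs dependence_Cons.prems(2)[of "Suc _"] dependence_Cons.prems(3)[of "Suc _"] by simp
  moreover have "w \<in> P 0" if "r ^ m * w \<in> P 0" "w \<in> polys V" for w m
    using that
  proof (induction m)
    case (Suc m)
    have "r ^ m * w \<in> polys V" using Suc.prems subring_power[OF K rs(1)] by (intro polys_closed)
    then have "r \<in> P 0 \<or> r ^ m * w \<in> P 0"
      using P0.I_prime[of r "r ^ m * w"] Suc.prems rs by (simp add: carrier_mpoly_ring mult.assoc)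
    then show ?case using 0 Suc by auto
  qed simp
  moreover have "y \<in> P (Suc 0)" if "y + r * h \<in> P 0"
  proof -
    have s: "submod (polys V) (P (Suc 0))" using P1.ideal_axioms by (simp add: ideal_iff_submod)
    have "h * r \<in> P (Suc 0)" by (rule submod_mult[OF s dependence_Cons.hyps(2) 0(2)])
    then have "(y + r * h) - h * r \<in> P (Suc 0)" using submod_diff[OF K s] that 0 by blast
    then show ?thesis by (simp add: mult.commute)
  qed
  ultimately show ?case using yrh by blast
qed

section \<open>Algebraic dependence by counting monomials\<close>

text \<open>Gaussian elimination of one equation and one unknown at a time, for the system with coefficients \<open>f x y\<close>,
unknowns \<open>x\<close> and equations \<open>y\<close>.\<close>

lemma nontrivial_solution:
  fixes f :: "'x \<Rightarrow> 'y \<Rightarrow> 'k::field"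
  assumes "finite Y" "finite Z" "card Y < card Z"
  shows "\<exists>c. (\<exists>x\<in>Z. c x \<noteq> 0) \<and> (\<forall>y\<in>Y. (\<Sum>x\<in>Z. c x * f x y) = 0)"
  using assms
proof (induction Y arbitrary: Z f rule: finite_induct)
  case empty
  then have "Z \<noteq> {}" by auto
  then show ?case by (intro exI[of _ "\<lambda>_. 1"]) auto
next
  case (insert y Y)
  show ?case
  proof (cases "\<forall>x\<in>Z. f x y = 0")
    case True
    have "card Y < card Z" using insert by simp
    then obtain c where "\<exists>x\<in>Z. c x \<noteq> 0" "\<forall>y\<in>Y. (\<Sum>x\<in>Z. c x * f x y) = 0"
      using insert.IH[of Z f] insert.prems by blast
    then show ?thesis using True by (intro exI[of _ c]) auto
  next
    case False
    then obtain x0 where x0: "x0 \<in> Z" "f x0 y \<noteq> 0" by auto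
    let ?Z = "Z - {x0}"
    define g where "g x z = f x z - f x y / f x0 y * f x0 z" for x z
    have "card Y < card ?Z" using insert x0 by simp
    then obtain c where c: "\<exists>x\<in>?Z. c x \<noteq> 0" "\<forall>z\<in>Y. (\<Sum>x\<in>?Z. c x * g x z) = 0"
      using insert.IH[of ?Z g] insert.prems by blast
    \<comment> \<open>The value at the pivot \<open>x0\<close> is forced by the equation \<open>y\<close>.\<close>
    define s where "s = (\<Sum>x\<in>?Z. c x * f x y)"
    define c' where "c' = c(x0 := - (s / f x0 y))"
    have sum: "(\<Sum>x\<in>Z. c' x * f x z) = - (s / f x0 y) * f x0 z + (\<Sum>x\<in>?Z. c x * f x z)" for z
    proof -
      have "(\<Sum>x\<in>?Z. c' x * f x z) = (\<Sum>x\<in>?Z. c x * f x z)"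
        by (rule sum.cong) (auto simp: c'_def)
      then show ?thesis using sum.remove[OF insert.prems(1) x0(1), of "\<lambda>x. c' x * f x z"]
        by (simp add: c'_def)
    qed
    have "(\<Sum>x\<in>Z. c' x * f x z) = 0" if "z \<in> insert y Y" for z
    proof (cases "z = y")
      case True
      then show ?thesis unfolding sum using x0 by (simp add: s_def)
    next
      case False
      have "0 = (\<Sum>x\<in>?Z. c x * g x z)" using c that False by simp
      also have "\<dots> = (\<Sum>x\<in>?Z. c x * f x z - (c x * f x y) * (f x0 z / f x0 y))"
        by (rule sum.cong) (auto simp: g_def algebra_simps)
      also have "\<dots> = (\<Sum>x\<in>?Z. c x * f x z) - s * (f x0 z / f x0 y)"
        unfolding sum_subtractf s_def sum_distrib_right ..
      finally show ?thesis unfolding sum by simp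
    qed
    moreover have "\<exists>x\<in>Z. c' x \<noteq> 0" using c(1) by (auto simp: c'_def)
    ultimately show ?thesis by blast
  qed
qed

fun prod_pow :: "'r::comm_ring_1 list \<Rightarrow> nat list \<Rightarrow> 'r" where
  "prod_pow (r # rs) (a # as) = r ^ a * prod_pow rs as"
| "prod_pow _ _ = 1"

definition exps :: "nat \<Rightarrow> nat \<Rightarrow> nat list set" where
  "exps L n = {\<alpha>. set \<alpha> \<subseteq> {..<L} \<and> length \<alpha> = n}"

lemma finite_exps: "finite (exps L n)"
  and card_exps: "card (exps L n) = L ^ n"
  unfolding exps_def using card_lists_length_eq[of "{..<L}" n] finite_lists_length_eq[of "{..<L}" n] by auto

lemma sum_exps_Suc: "(\<Sum>\<alpha>\<in>exps L (Suc n). g \<alpha>) = (\<Sum>a<L. \<Sum>\<beta>\<in>exps L n. g (a # \<beta>))"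
proof -
  have eq: "exps L (Suc n) = (\<lambda>(a, \<beta>). a # \<beta>) ` ({..<L} \<times> exps L n)"
  proof (intro equalityI subsetI)
    fix \<alpha> assume "\<alpha> \<in> exps L (Suc n)"
    then show "\<alpha> \<in> (\<lambda>(a, \<beta>). a # \<beta>) ` ({..<L} \<times> exps L n)"
      by (cases \<alpha>) (auto simp: exps_def)
  qed (auto simp: exps_def)
  have inj: "inj_on (\<lambda>(a, \<beta>). a # \<beta>) ({..<L} \<times> exps L n)" by (auto simp: inj_on_def)
  have "(\<Sum>\<alpha>\<in>exps L (Suc n). g \<alpha>) = (\<Sum>(a, \<beta>)\<in>{..<L} \<times> exps L n. g (a # \<beta>))"
    unfolding eq sum.reindex[OF inj] by (rule sum.cong) auto
  then show ?thesis by (simp add: sum.cartesian_product)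
qed

abbreviation scal :: "'k \<Rightarrow> ('v, 'k::comm_ring_1) mpoly" where
  "scal c \<equiv> single 0 c"

lemma scal_mult: "scal c * scal d = scal (c * d)"
  by (simp add: mult_single)

lemma scal_in: "scal c \<in> polys V"
  by (rule single_in_mono_ideal) simp

lemma lookup_scal_mult: "lookup (scal c * p) m = c * lookup (p :: ('v, 'k::comm_ring_1) mpoly) m"
  using lookup_single_mult[of 0 c p m] by simp

lemma polys_power: "r \<in> polys V \<Longrightarrow> r ^ n \<in> polys V"
  by (rule subring_power[OF subring_of_mono_ideal])

lemma polys_sum: "(\<And>i. i \<in> I \<Longrightarrow> f i \<in> polys V) \<Longrightarrow>
    (sum f I :: ('v, 'k::comm_ring_1) mpoly) \<in> polys V"
  by (rule submod_sum[OF subring_of_submod[OF subring_of_mono_ideal]])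

lemma prod_pow_in: "set rs \<subseteq> polys V \<Longrightarrow> prod_pow rs \<alpha> \<in> (polys V :: ('v, 'k::comm_ring_1) mpoly set)"
  by (induction rs \<alpha> rule: prod_pow.induct) (auto intro!: polys_closed polys_power)

text \<open>Any nontrivial linear relation between monomials in \<open>rs\<close> can be brought into the nested form: factor out
the least power of the first element that occurs, and apply induction to its coefficient.\<close>

lemma dependence_of_relation:
  fixes rs :: "('v, 'k::field) mpoly list"
  assumes "set rs \<subseteq> polys V" "\<exists>\<alpha>\<in>exps L (length rs). c \<alpha> \<noteq> 0"
  shows "\<exists>z c0. c0 \<noteq> 0 \<and> dependence (polys V) rs z \<and>
    (\<Sum>\<alpha>\<in>exps L (length rs). scal (c \<alpha>) * prod_pow rs \<alpha>) = scal c0 * z"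
  using assms
proof (induction rs arbitrary: c)
  case Nil
  have ex: "exps L (length []) = {[]}" by (auto simp: exps_def)
  have "c [] \<noteq> 0" using Nil.prems(2) unfolding ex by simp
  moreover have "(\<Sum>\<alpha>\<in>exps L (length []). scal (c \<alpha>) * prod_pow [] \<alpha>) = scal (c []) * 1"
    unfolding ex by simp
  ultimately show ?case using dependence_Nil by blast
next
  case (Cons r rs)
  let ?n = "length rs"
  have r: "r \<in> polys V" and rs: "set rs \<subseteq> polys V" using Cons.prems(1) by simp_all
  define S where "S a = (\<Sum>\<beta>\<in>exps L ?n. scal (c (a # \<beta>)) * prod_pow rs \<beta>)" for a
  have S_in: "S a \<in> polys V" for a
    unfolding S_def by (intro polys_sum polys_closed scal_in prod_pow_in rs)
  let ?P = "\<lambda>a. \<exists>\<beta>\<in>exps L ?n. c (a # \<beta>) \<noteq> 0"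
  define m where "m = (LEAST a. ?P a)"
  obtain \<alpha> where \<alpha>: "\<alpha> \<in> exps L (Suc ?n)" "c \<alpha> \<noteq> 0" using Cons.prems(2) by auto
  obtain a \<beta> where a: "\<alpha> = a # \<beta>" "a < L" "\<beta> \<in> exps L ?n"
    using \<alpha>(1) by (cases \<alpha>) (auto simp: exps_def)
  have Pa: "?P a" using \<alpha> a by blast
  have m: "?P m" unfolding m_def by (rule LeastI[of ?P, OF Pa])
  have "m \<le> a" unfolding m_def by (rule Least_le[of ?P, OF Pa])
  then have mL: "m < L" using a by simp
  have S0: "S b = 0" if "b < m" for b
  proof -
    have "\<not> ?P b" using not_less_Least[of b ?P] that unfolding m_def by blast
    then have "scal (c (b # \<beta>)) * prod_pow rs \<beta> = 0" if "\<beta> \<in> exps L ?n" for \<beta> using that by simp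
    then show ?thesis unfolding S_def by (intro sum.neutral) blast
  qed
  obtain y c0 where y: "c0 \<noteq> 0" "dependence (polys V) rs y" "S m = scal c0 * y"
    using Cons.IH[OF rs m] unfolding S_def by blast
  \<comment> \<open>Dividing by the lowest coefficient \<open>c0\<close> makes the lowest term monic.\<close>
  define h where "h = scal (1 / c0) * (\<Sum>b\<in>{m<..<L}. r ^ (b - Suc m) * S b)"
  have h: "h \<in> polys V"
    unfolding h_def by (intro polys_closed scal_in polys_sum polys_power r S_in)
  have "(\<Sum>\<alpha>\<in>exps L (Suc ?n). scal (c \<alpha>) * prod_pow (r # rs) \<alpha>) = (\<Sum>b<L. r ^ b * S b)"
    unfolding sum_exps_Suc S_def sum_distrib_left
    by (rule sum.cong[OF refl], rule sum.cong[OF refl]) (simp add: mult.left_commute)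
  also have "{..<L} = {..<m} \<union> ({m} \<union> {m<..<L})" using mL by auto
  also have "(\<Sum>b\<in>{..<m} \<union> ({m} \<union> {m<..<L}). r ^ b * S b) =
      (\<Sum>b<m. r ^ b * S b) + (r ^ m * S m + (\<Sum>b\<in>{m<..<L}. r ^ b * S b))"
  proof -
    have "(\<Sum>b\<in>{..<m} \<union> ({m} \<union> {m<..<L}). r ^ b * S b) =
        (\<Sum>b<m. r ^ b * S b) + (\<Sum>b\<in>{m} \<union> {m<..<L}. r ^ b * S b)"
      by (rule sum.union_disjoint) auto
    then show ?thesis by simp
  qed
  also have "(\<Sum>b<m. r ^ b * S b) = 0" by (rule sum.neutral) (use S0 in auto)
  also have "(\<Sum>b\<in>{m<..<L}. r ^ b * S b) = r ^ m * (r * (\<Sum>b\<in>{m<..<L}. r ^ (b - Suc m) * S b))"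
    unfolding sum_distrib_left
  proof (rule sum.cong[OF refl])
    fix b assume "b \<in> {m<..<L}"
    then have "b = m + Suc (b - Suc m)" by auto
    then have "r ^ b = r ^ m * (r * r ^ (b - Suc m))" by (metis power_Suc power_add)
    then show "r ^ b * S b = r ^ m * (r * (r ^ (b - Suc m) * S b))" by (simp add: mult.assoc)
  qed
  also have "(\<Sum>b\<in>{m<..<L}. r ^ (b - Suc m) * S b) = scal c0 * h"
  proof -
    have "scal c0 * h = (scal c0 * scal (1 / c0)) * (\<Sum>b\<in>{m<..<L}. r ^ (b - Suc m) * S b)"
      unfolding h_def by (simp only: mult.assoc)
    also have "scal c0 * scal (1 / c0) = (1 :: ('v, 'k) mpoly)"
      unfolding scal_mult using y(1) by simp
    finally show ?thesis by simp
  qed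
  also have "0 + (r ^ m * S m + r ^ m * (r * (scal c0 * h))) = scal c0 * (r ^ m * (y + r * h))"
    unfolding y(3) by (simp add: algebra_simps)
  finally have "(\<Sum>\<alpha>\<in>exps L (Suc ?n). scal (c \<alpha>) * prod_pow (r # rs) \<alpha>) = scal c0 * (r ^ m * (y + r * h))" .
  moreover have "dependence (polys V) (r # rs) (r ^ m * (y + r * h))" by (rule dependence_Cons[OF y(2) h])
  ultimately show ?case using y(1) by auto
qed

definition exp_bound :: "nat \<Rightarrow> (('v, 'k::zero) mpoly) \<Rightarrow> bool" where
  "exp_bound N p \<longleftrightarrow> (\<forall>m\<in>keys p. \<forall>v. lookup m v \<le> N)"

lemma exp_bound_mono: "exp_bound N p \<Longrightarrow> N \<le> M \<Longrightarrow> exp_bound M p"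
  unfolding exp_bound_def by (meson le_trans)

lemma exp_bound_one: "exp_bound 0 (1 :: ('v, 'k::comm_ring_1) mpoly)"
  by (simp add: exp_bound_def)

lemma exp_bound_mult:
  fixes p q :: "('v, 'k::comm_ring_1) mpoly"
  assumes "exp_bound N p" "exp_bound M q" shows "exp_bound (N + M) (p * q)"
  unfolding exp_bound_def
proof (intro ballI allI)
  fix m v assume "m \<in> keys (p * q)"
  then obtain a b where "m = a + b" "a \<in> keys p" "b \<in> keys q"
    using keys_mult[of p q] by auto
  then show "lookup m v \<le> N + M" using assms by (simp add: exp_bound_def lookup_add add_mono)
qed

lemma exp_bound_power:
  fixes p :: "('v, 'k::comm_ring_1) mpoly"
  assumes "exp_bound N p" shows "exp_bound (a * N) (p ^ a)"
proof (induction a)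
  case (Suc a)
  show ?case using exp_bound_mult[OF assms Suc] by simp
qed (simp add: exp_bound_one)

lemma exp_bound_prod_pow:
  fixes rs :: "('v, 'k::comm_ring_1) mpoly list"
  shows "(\<And>r. r \<in> set rs \<Longrightarrow> exp_bound N r) \<Longrightarrow> exp_bound (sum_list \<alpha> * N) (prod_pow rs \<alpha>)"
proof (induction rs \<alpha> rule: prod_pow.induct)
  case (1 r rs a as)
  then show ?case
    using exp_bound_mult[OF exp_bound_power[of N r a], of "sum_list as * N" "prod_pow rs as"]
    by (simp add: distrib_right)
qed (auto intro: exp_bound_mono[OF exp_bound_one])

lemma exp_bound_exists:
  fixes p :: "('v, 'k::zero) mpoly"
  shows "\<exists>N. exp_bound N p"
proof -
  let ?T = "\<Union>m\<in>keys p. lookup m ` keys m"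
  have "lookup m v \<le> Max (insert 0 ?T)" if "m \<in> keys p" for m v
  proof (cases "v \<in> keys m")
    case True
    then show ?thesis using that by (intro Max_ge) auto
  next
    case False
    then show ?thesis by (simp add: in_keys_iff)
  qed
  then show ?thesis unfolding exp_bound_def by blast
qed

lemma exp_bound_list:
  fixes rs :: "('v, 'k::zero) mpoly list"
  shows "\<exists>N. \<forall>r\<in>set rs. exp_bound N r"
proof (induction rs)
  case (Cons r rs)
  then obtain N where N: "\<forall>r\<in>set rs. exp_bound N r" by blast
  obtain M where "exp_bound M r" using exp_bound_exists[of r] by blast
  with N have "\<forall>s\<in>set (r # rs). exp_bound (max N M) s" by (auto intro: exp_bound_mono)
  then show ?case by blast
qed simp

definition small_monomials :: "'v set \<Rightarrow> nat \<Rightarrow> nat \<Rightarrow> ('v \<Rightarrow>\<^sub>0 nat) set" where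
  "small_monomials V j N =
    {m. keys m \<subseteq> V \<and> card (keys m) \<le> j \<and> (\<forall>v. lookup m v \<le> N)}"

text \<open>The bound is a polynomial of degree \<open>j\<close> in \<open>N\<close>; the factor \<open>2 ^ card V\<close> accounts for the choice of the
support.\<close>

lemma card_small_monomials:
  fixes V :: "'v set"
  assumes "finite V"
  shows "finite (small_monomials V j N) \<and> card (small_monomials V j N) \<le> 2 ^ card V * (N + 1) ^ j"
proof -
  define M where "M T = {m. keys m \<subseteq> T \<and> (\<forall>v. lookup m v \<le> N)}" for T :: "'v set"
  have M: "finite (M T) \<and> card (M T) \<le> (N + 1) ^ card T" if "finite T" for T
  proof -
    let ?f = "\<lambda>m. restrict (lookup m) T"
    have inj: "inj_on ?f (M T)"
    proof (rule inj_onI)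
      fix m m' assume m: "m \<in> M T" "m' \<in> M T" and eq: "?f m = ?f m'"
      show "m = m'"
      proof (rule poly_mapping_eqI)
        fix v
        show "lookup m v = lookup m' v"
        proof (cases "v \<in> T")
          case True
          then show ?thesis using fun_cong[OF eq, of v] by simp
        next
          case False
          then have "v \<notin> keys m" "v \<notin> keys m'" using m by (auto simp: M_def)
          then show ?thesis by (simp add: in_keys_iff)
        qed
      qed
    qed
    have sub: "?f ` M T \<subseteq> PiE T (\<lambda>_. {..N})" by (auto simp: M_def)
    have fin: "finite (PiE T (\<lambda>_. {..N}))" using that by (intro finite_PiE) auto
    have "finite (M T)" by (rule inj_on_finite[OF inj sub fin])
    moreover have "card (M T) \<le> card (PiE T (\<lambda>_. {..N}))" by (rule card_inj_on_le[OF inj sub fin])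
    ultimately show ?thesis using that by (simp add: card_PiE)
  qed
  let ?S = "{T. T \<subseteq> V \<and> card T \<le> j}"
  have finS: "finite ?S" using assms by simp
  have finT: "finite T" if "T \<in> ?S" for T using that finite_subset[OF _ assms, of T] by simp
  have sub: "small_monomials V j N \<subseteq> (\<Union>T\<in>?S. M T)" by (auto simp: small_monomials_def M_def)
  have fin: "finite (\<Union>T\<in>?S. M T)" by (rule finite_UN_I[OF finS]) (rule conjunct1[OF M[OF finT]])
  have "card (\<Union>T\<in>?S. M T) \<le> (\<Sum>T\<in>?S. card (M T))" by (rule card_UN_le[OF finS])
  also have "\<dots> \<le> (\<Sum>T\<in>?S. (N + 1) ^ j)"
  proof (rule sum_mono)
    fix T assume T: "T \<in> ?S"
    have "card (M T) \<le> (N + 1) ^ card T" by (rule conjunct2[OF M[OF finT[OF T]]])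
    also have "\<dots> \<le> (N + 1) ^ j" using T by (intro power_increasing) auto
    finally show "card (M T) \<le> (N + 1) ^ j" .
  qed
  also have "\<dots> = card ?S * (N + 1) ^ j" by simp
  also have "\<dots> \<le> 2 ^ card V * (N + 1) ^ j"
  proof (rule mult_right_mono)
    have "card ?S \<le> card (Pow V)" using assms by (intro card_mono) auto
    then show "card ?S \<le> 2 ^ card V" using assms by (simp add: card_Pow)
  qed simp
  finally show ?thesis using finite_subset[OF sub fin] card_mono[OF fin sub] by simp
qed

text \<open>The \<open>L ^ n\<close> power products of \<open>n > j\<close> given polynomials with exponents below \<open>L\<close> involve, modulo the monomials in
more than \<open>j\<close> variables, only \<open>O(L ^ j)\<close> monomials.  For large \<open>L\<close> they are linearly dependent.\<close>

lemma dependence_exists: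
  fixes rs :: "('v, 'k::field) mpoly list"
  assumes V: "finite V" and rs: "set rs \<subseteq> polys V" and j: "j < length rs"
  shows "\<exists>z. dependence (polys V) rs z \<and> z \<in> mono_ideal {s. s \<subseteq> V \<and> j < card s}"
proof -
  let ?n = "length rs"
  obtain D where D: "\<forall>r\<in>set rs. exp_bound D r" using exp_bound_list by blast
  define B where "B = 2 ^ card V * (?n * D + 1) ^ j"
  \<comment> \<open>With this choice the number \<open>B * L ^ j\<close> of monomials is less than \<open>L ^ Suc j\<close>.\<close>
  define L where "L = B + 1"
  define N where "N = ?n * L * D"
  let ?Y = "small_monomials V j N"
  have "N + 1 \<le> L * (?n * D + 1)" by (simp add: N_def L_def algebra_simps)
  then have "(N + 1) ^ j \<le> (L * (?n * D + 1)) ^ j" by (rule power_mono) simp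
  then have "2 ^ card V * (N + 1) ^ j \<le> 2 ^ card V * (L * (?n * D + 1)) ^ j" by (rule mult_left_mono) simp
  also have "\<dots> = B * L ^ j" unfolding B_def power_mult_distrib by (simp only: ac_simps)
  also have "\<dots> < L * L ^ j" by (simp add: L_def)
  also have "\<dots> = L ^ Suc j" by simp
  also have "\<dots> \<le> L ^ ?n" using j by (intro power_increasing) (auto simp: L_def)
  finally have "card ?Y < card (exps L ?n)"
    using card_small_monomials[OF V, of j N] unfolding card_exps by linarith
  then obtain c where c: "\<exists>\<alpha>\<in>exps L ?n. c \<alpha> \<noteq> 0"
    "\<forall>m\<in>?Y. (\<Sum>\<alpha>\<in>exps L ?n. c \<alpha> * lookup (prod_pow rs \<alpha>) m) = 0"
    using nontrivial_solution[of ?Y "exps L ?n" "\<lambda>\<alpha> m. lookup (prod_pow rs \<alpha>) m"]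
      card_small_monomials[OF V, of j N] finite_exps[of L ?n] by blast
  define p where "p = (\<Sum>\<alpha>\<in>exps L ?n. scal (c \<alpha>) * prod_pow rs \<alpha>)"
  have p_in: "p \<in> polys V" unfolding p_def by (intro polys_sum polys_closed scal_in prod_pow_in rs)
  have lookup_p: "lookup p m = (\<Sum>\<alpha>\<in>exps L ?n. c \<alpha> * lookup (prod_pow rs \<alpha>) m)" for m
    unfolding p_def lookup_sum lookup_scal_mult ..
  have "exp_bound N p"
    unfolding exp_bound_def
  proof (intro ballI allI)
    fix m v assume "m \<in> keys p"
    then have "(\<Sum>\<alpha>\<in>exps L ?n. c \<alpha> * lookup (prod_pow rs \<alpha>) m) \<noteq> 0" by (simp add: in_keys_iff lookup_p)
    then obtain \<alpha> where \<alpha>: "\<alpha> \<in> exps L ?n" "c \<alpha> * lookup (prod_pow rs \<alpha>) m \<noteq> 0"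
      by (meson sum.neutral)
    then have "m \<in> keys (prod_pow rs \<alpha>)" by (simp add: in_keys_iff)
    then have "lookup m v \<le> sum_list \<alpha> * D" using exp_bound_prod_pow[of rs D \<alpha>] D by (auto simp: exp_bound_def)
    also have "sum_list \<alpha> \<le> sum_list (map (\<lambda>_. L) \<alpha>)"
      using sum_list_mono[of \<alpha> "\<lambda>a. a" "\<lambda>_. L"] \<alpha>(1) by (force simp: exps_def)
    then have "sum_list \<alpha> * D \<le> N" using \<alpha>(1) by (simp add: exps_def N_def sum_list_triv)
    finally show "lookup m v \<le> N" .
  qed
  have p_mem: "p \<in> mono_ideal {s. s \<subseteq> V \<and> j < card s}"
    unfolding mono_ideal_def mem_Collect_eq
  proof (intro ballI conjI)
    fix m assume m: "m \<in> keys p"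
    show mV: "keys m \<subseteq> V" using m p_in by (auto simp: mono_ideal_def)
    have "lookup p m \<noteq> 0" using m by (simp add: in_keys_iff)
    then have "m \<notin> ?Y" using c(2) lookup_p by auto
    then show "j < card (keys m)"
      using mV m \<open>exp_bound N p\<close> by (auto simp: small_monomials_def exp_bound_def)
  qed
  obtain z c0 where z: "c0 \<noteq> 0" "dependence (polys V) rs z" "p = scal c0 * z"
    using dependence_of_relation[OF rs c(1)] unfolding p_def by blast
  have "z = scal (1 / c0) * p"
    unfolding z(3) mult.assoc[symmetric] scal_mult using z(1) by simp
  moreover have "keys (scal (1 / c0) * p) \<subseteq> keys p"
    by (auto simp: in_keys_iff lookup_scal_mult)
  ultimately have "z \<in> mono_ideal {s. s \<subseteq> V \<and> j < card s}"
    using p_mem by (auto simp: mono_ideal_def)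
  then show ?thesis using z(2) by blast
qed

section \<open>Dimension and depth of the quotient of an interval chain\<close>

lemma chain_card_le: "interval_chain V j U U' \<Longrightarrow> finite V \<Longrightarrow> s \<in> U' \<Longrightarrow> s \<notin> U \<Longrightarrow> card s \<le> j"
proof (induction rule: interval_chain.induct)
  case (chain_step U U' r F)
  have "finite F" by (rule finite_subset[OF chain_step.hyps(3) chain_step.prems(1)])
  then have "card s \<le> card F" if "s \<subseteq> F" using that by (rule card_mono)
  then show ?case using chain_step by auto
qed simp

lemma chain_top: "interval_chain V j U U' \<Longrightarrow> U \<noteq> U' \<Longrightarrow> \<exists>F\<in>U'. F \<subseteq> V \<and> F \<notin> U \<and> card F = j"
proof (induction rule: interval_chain.induct)
  case (chain_step U U' r F)
  have "F \<notin> U'" using chain_step.hyps by auto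
  then have "F \<notin> U" using chain_subset[OF chain_step.hyps(1)] by blast
  then show ?case using chain_step.hyps by (intro bexI[of _ F]) auto
qed simp

lemma lookup_mult_unique:
  fixes a b :: "('v, 'k::field) mpoly"
  assumes "\<And>x y. x \<in> keys a \<Longrightarrow> y \<in> keys b \<Longrightarrow> x + y = m1 + m2 \<Longrightarrow> x = m1"
  shows "lookup (a * b) (m1 + m2) = lookup a m1 * lookup b m2"
proof -
  let ?f = "\<lambda>x. single x (lookup a x)"
  have "a * b = sum ?f (keys a) * b"
    by (rule arg_cong[OF poly_eq_sum_single])
  also have "\<dots> = (\<Sum>x\<in>keys a. ?f x * b)" by (rule sum_distrib_right)
  finally have "lookup (a * b) (m1 + m2) = (\<Sum>x\<in>keys a. lookup (?f x * b) (m1 + m2))"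
    by (simp add: lookup_sum)
  also have "\<dots> = (\<Sum>x\<in>keys a. if x = m1 then lookup a m1 * lookup b m2 else 0)"
  proof (rule sum.cong[OF refl])
    fix x assume x: "x \<in> keys a"
    show "lookup (?f x * b) (m1 + m2) = (if x = m1 then lookup a m1 * lookup b m2 else 0)"
    proof (cases "x = m1")
      case True
      then show ?thesis by (simp add: lookup_single_mult)
    next
      case False
      have "m1 + m2 \<notin> keys (?f x * b)"
      proof
        assume "m1 + m2 \<in> keys (?f x * b)"
        then obtain x' y where "m1 + m2 = x' + y" "x' \<in> keys (?f x)" "y \<in> keys b"
          using keys_mult[of "?f x" b] by blast
        moreover from this have "x' = x" by (simp split: if_splits)
        ultimately show False using assms[OF x, of y] False by simp
      qed
      then show ?thesis using False by (simp add: in_keys_iff)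
    qed
  qed
  also have "\<dots> = lookup a m1 * lookup b m2"
    by (simp add: sum.delta in_keys_iff)
  finally show ?thesis .
qed

text \<open>The quotient is a polynomial ring in finitely many variables, hence a domain.  Enumerating the variables
sends monomials to the type \<open>nat \<Rightarrow>\<^sub>0 nat\<close>, whose linear order is compatible with addition; then the product of
the leading terms of two polynomials cannot cancel.\<close>

lemma primeideal_variables:
  assumes "finite V" "F \<subseteq> V"
  shows "primeideal (mono_ideal {t. t \<subseteq> V \<and> \<not> t \<subseteq> F})
    (mpoly_ring V :: ('v, 'k::field) mpoly ring)"
proof (rule primeidealI)
  let ?P = "mono_ideal {t. t \<subseteq> V \<and> \<not> t \<subseteq> F} :: ('v, 'k) mpoly set"
  have PR: "?P \<subseteq> polys V" by (rule mono_ideal_mono) auto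
  have "submod (polys V) ?P" by (rule submod_mono_ideal) (auto simp: upclosed_def)
  then show "ideal ?P (mpoly_ring V)" unfolding ideal_iff_submod using PR by blast
  show "cring (mpoly_ring V :: ('v, 'k) mpoly ring)" by (rule cring_mpoly_ring)
  have "1 \<notin> ?P" by (simp add: mono_ideal_def)
  then show "carrier (mpoly_ring V) \<noteq> ?P" using polys_closed(5) unfolding carrier_mpoly_ring by blast
  fix a b :: "('v, 'k) mpoly"
  assume "a \<in> carrier (mpoly_ring V)" "b \<in> carrier (mpoly_ring V)"
    and ab': "a \<otimes>\<^bsub>mpoly_ring V\<^esub> b \<in> ?P"
  then have a: "a \<in> polys V" and b: "b \<in> polys V" and ab: "a * b \<in> ?P"
    by (simp_all add: carrier_mpoly_ring)
  have finF: "finite F" by (rule finite_subset[OF assms(2,1)])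
  obtain e :: "'v \<Rightarrow> nat" where e: "inj_on e F" using finite_imp_inj_to_nat_seg[OF finF] by blast
  \<comment> \<open>\<open>g\<close> renames the variables in \<open>F\<close> to their numbers and drops all others.\<close>
  define g :: "('v \<Rightarrow>\<^sub>0 nat) \<Rightarrow> (nat \<Rightarrow>\<^sub>0 nat)" where
    "g m = (\<Sum>v\<in>F. single (e v) (lookup m v))" for m
  have g_add: "g (m + m') = g m + g m'" for m m'
    by (simp add: g_def lookup_add single_add sum.distrib)
  have g_lookup: "lookup (g m) (e v) = lookup m v" if "v \<in> F" for m v
  proof -
    have "lookup (g m) (e v) = (\<Sum>w\<in>F. if w = v then lookup m v else 0)"
      unfolding g_def lookup_sum
      by (rule sum.cong[OF refl]) (use e that in \<open>auto simp: lookup_single when_def inj_on_def\<close>)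
    then show ?thesis using that finF by (simp add: sum.delta)
  qed
  have g_inj: "m = m'" if "g m = g m'" "keys m \<subseteq> F" "keys m' \<subseteq> F" for m m'
  proof (rule poly_mapping_eqI)
    fix v
    show "lookup m v = lookup m' v"
    proof (cases "v \<in> F")
      case True
      then show ?thesis using g_lookup[of v m] g_lookup[of v m'] that(1) by simp
    next
      case False
      then have "v \<notin> keys m" "v \<notin> keys m'" using that by auto
      then show ?thesis by (simp add: in_keys_iff)
    qed
  qed
  have max: "\<exists>m\<in>keys p. keys m \<subseteq> F \<and>
      (\<forall>x\<in>keys p. keys x \<subseteq> F \<longrightarrow> g x \<le> g m)"
    if "p \<in> polys V" "p \<notin> ?P" for p :: "('v, 'k) mpoly"
  proof -
    let ?K = "{m \<in> keys p. keys m \<subseteq> F}"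
    have "finite ?K" "?K \<noteq> {}" using that by (auto simp: mono_ideal_def)
    then have "Max (g ` ?K) \<in> g ` ?K" by (intro Max_in) auto
    then obtain m where m: "m \<in> ?K" "g m = Max (g ` ?K)" by auto
    have "g x \<le> g m" if "x \<in> ?K" for x using that \<open>finite ?K\<close> unfolding m(2) by (intro Max_ge) auto
    then show ?thesis using m(1) by blast
  qed
  show "a \<in> ?P \<or> b \<in> ?P"
  proof (rule ccontr)
    assume neg: "\<not> (a \<in> ?P \<or> b \<in> ?P)"
    obtain m1 where m1: "m1 \<in> keys a" "keys m1 \<subseteq> F"
      "\<And>x. x \<in> keys a \<Longrightarrow> keys x \<subseteq> F \<Longrightarrow> g x \<le> g m1"
      using max[OF a] neg by blast
    obtain m2 where m2: "m2 \<in> keys b" "keys m2 \<subseteq> F"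
      "\<And>x. x \<in> keys b \<Longrightarrow> keys x \<subseteq> F \<Longrightarrow> g x \<le> g m2"
      using max[OF b] neg by blast
    have "x = m1" if x: "x \<in> keys a" and y: "y \<in> keys b" and xy: "x + y = m1 + m2" for x y
    proof -
      have "keys x \<union> keys y \<subseteq> F"
        using arg_cong[OF xy, of keys] m1(2) m2(2) by (simp add: keys_add_nat)
      then have xF: "keys x \<subseteq> F" and yF: "keys y \<subseteq> F" by auto
      have le: "g x \<le> g m1" "g y \<le> g m2" using m1(3)[OF x xF] m2(3)[OF y yF] .
      have "g x + g y = g m1 + g m2" using arg_cong[OF xy, of g] by (simp add: g_add)
      then have "\<not> g x < g m1" using add_less_le_mono[OF _ le(2), of "g x" "g m1"] by auto
      then have "g x = g m1" using le(1) by (simp add: order.order_iff_strict)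
      then show ?thesis by (rule g_inj[OF _ xF m1(2)])
    qed
    then have "lookup (a * b) (m1 + m2) = lookup a m1 * lookup b m2" by (rule lookup_mult_unique)
    also have "\<dots> \<noteq> 0" using m1(1) m2(1) by (simp add: in_keys_iff)
    finally have "m1 + m2 \<in> keys (a * b)" by (simp add: in_keys_iff)
    then have "\<not> keys (m1 + m2) \<subseteq> F" using ab unfolding mono_ideal_def by blast
    then show False using m1(2) m2(2) by (simp add: keys_add_nat)
  qed
qed

lemma monomial_degree_eq:
  assumes "finite T" "keys m \<subseteq> T"
  shows "monomial_degree m = (\<Sum>v\<in>T. lookup m v)"
  unfolding monomial_degree_def
  by (rule sum.mono_neutral_left[OF assms]) (simp add: in_keys_iff)

lemma monomial_degree_add: "monomial_degree (m + m') = monomial_degree m + monomial_degree m'"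
proof -
  let ?T = "keys m \<union> keys m'"
  have "monomial_degree x = (\<Sum>v\<in>?T. lookup x v)" if "keys x \<subseteq> ?T" for x
    by (rule monomial_degree_eq) (use that in simp_all)
  then show ?thesis by (simp add: keys_add_nat lookup_add sum.distrib)
qed

lemma monomial_degree_indic: "finite T \<Longrightarrow> monomial_degree (indic T) = card T"
  unfolding monomial_degree_def by (simp add: keys_indic lookup_indic)

lemma elem_sym_homogeneous:
  "finite V \<Longrightarrow> elem_sym V i \<in> (mpoly_grading V (int i) :: ('v, 'k::field) mpoly set)"
proof -
  assume V: "finite V"
  have "monomial_degree m = i" if "m \<in> keys (elem_sym V i :: ('v, 'k) mpoly)" for m
  proof -
    obtain T where T: "T \<subseteq> V" "card T = i" "m = indic T" using keys_elem_sym[of V i] \<open>m \<in> _\<close> by blast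
    show ?thesis using T(2) monomial_degree_indic[OF finite_subset[OF T(1) V]] by (simp add: T(3))
  qed
  then show ?thesis using elem_sym_in[OF V] by (simp add: mpoly_grading_def carrier_mpoly_ring)
qed

lemma grading_subset_irrelevant:
  "0 < i \<Longrightarrow> mpoly_grading V i \<subseteq> (irrelevant_ideal (mpoly_ring V) (mpoly_grading V) :: ('v, 'k::field) mpoly set)"
proof -
  let ?R = "mpoly_ring V :: ('v, 'k) mpoly ring"
  interpret cring ?R by (rule cring_mpoly_ring)
  have sub: "(\<Union>i\<in>{0<..}. mpoly_grading V i) \<subseteq> carrier ?R" by (auto simp: mpoly_grading_def)
  show "mpoly_grading V i \<subseteq> irrelevant_ideal ?R (mpoly_grading V)" if "0 < i"
    using genideal_self[OF sub] that unfolding irrelevant_ideal_def by blast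
qed

lemma Sup_ereal_eq:
  assumes "P n" "\<And>m. P m \<Longrightarrow> m \<le> n"
  shows "Sup {ereal (real m) | m. P m} = ereal (real n)"
proof (rule antisym)
  show "Sup {ereal (real m) | m. P m} \<le> ereal (real n)" by (rule Sup_least) (use assms(2) in auto)
  show "ereal (real n) \<le> Sup {ereal (real m) | m. P m}" by (rule Sup_upper) (use assms(1) in auto)
qed

text \<open>Take a minimal set \<open>\<tau>\<close> among those in \<open>U'\<close> but not in \<open>U\<close>.  Within the ideal of \<open>U'\<close>, the squarefree monomial \<open>x\<^sup>\<tau>\<close> is
a multiple of no other monomial, so multiplication by elements without constant term never produces it.\<close>

lemma plus_multiples_elem_syms_neq:
  fixes U :: "'v set set"
  assumes V: "finite V" and ch: "interval_chain V j U U'" and ne: "U \<noteq> U'"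
  shows "plus_multiples (mono_ideal U') (mono_ideal U) (elem_syms V j) \<noteq>
    (mono_ideal U' :: ('v, 'k::field) mpoly set)"
proof -
  let ?A = "mono_ideal U' :: ('v, 'k) mpoly set"
  let ?B = "mono_ideal U :: ('v, 'k) mpoly set"
  have up: "upclosed V U" "upclosed V U'" using chain_upclosed[OF ch] by auto
  have UU': "U \<subseteq> U'" by (rule chain_subset[OF ch])
  have U'V: "U' \<subseteq> Pow V" using up by (simp add: upclosed_def)
  then have "finite (U' - U)" using V by (meson finite_Diff finite_Pow_iff finite_subset)
  moreover have "U' - U \<noteq> {}" using UU' ne by blast
  ultimately obtain \<tau> where \<tau>: "\<tau> \<in> U' - U" "\<And>t. t \<in> U' - U \<Longrightarrow> t \<subseteq> \<tau> \<Longrightarrow> t = \<tau>"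
    using finite_has_minimal[of "U' - U"] by blast
  have fin\<tau>: "finite \<tau>" by (rule finite_subset[OF _ V]) (use \<tau>(1) U'V in blast)
  have key: "y = indic \<tau> \<and> x = 0" if xy: "indic \<tau> = x + y" and y: "keys y \<in> U'" for x y
  proof -
    have sub: "keys y \<subseteq> \<tau>" using arg_cong[OF xy, of keys] fin\<tau>
      by (auto simp: keys_add_nat keys_indic)
    have "\<tau> \<subseteq> V" using \<tau>(1) U'V by blast
    then have "keys y \<notin> U" using upclosedD[OF up(1) _ sub] \<tau>(1) by blast
    then have eq: "keys y = \<tau>" using \<tau>(2) y sub by blast
    have l: "lookup (indic \<tau>) v = lookup x v + lookup y v" for v
      using arg_cong[OF xy, of "\<lambda>m. lookup m v"] by (simp add: lookup_add)
    have x0: "lookup x v = 0" for v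
    proof (cases "v \<in> \<tau>")
      case True
      then have "v \<in> keys y" using eq by simp
      then have "lookup y v \<noteq> 0" unfolding in_keys_iff .
      then show ?thesis using l[of v] True fin\<tau> by (simp add: lookup_indic)
    next
      case False
      then show ?thesis using l[of v] fin\<tau> by (simp add: lookup_indic)
    qed
    have "x = 0" by (rule poly_mapping_eqI) (simp add: x0)
    then show ?thesis using xy by simp
  qed
  let ?C = "{p \<in> ?A. lookup p (indic \<tau>) = 0}"
  have A: "submod (polys V) ?A" and B: "submod (polys V) ?B" using submod_mono_ideal up by blast+
  have mult: "lookup (r * p) (indic \<tau>) = 0"
    if p: "p \<in> ?A" and or: "lookup p (indic \<tau>) = 0 \<or> 0 \<notin> keys r" for r p
  proof (rule ccontr)
    assume "lookup (r * p) (indic \<tau>) \<noteq> 0"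
    then have "indic \<tau> \<in> keys (r * p)" by (simp add: in_keys_iff)
    then obtain x y where xy: "indic \<tau> = x + y" "x \<in> keys r" "y \<in> keys p"
      using keys_mult[of r p] by blast
    have "keys y \<in> U'" using p xy(3) by (auto simp: mono_ideal_def)
    then have "y = indic \<tau>" "x = 0" using key[OF xy(1)] by auto
    then show False using xy(2,3) or by (auto simp: in_keys_iff)
  qed
  have C: "submod (polys V) ?C"
    unfolding submod_def using submod_zero[OF A] submod_add[OF A] submod_mult[OF A] mult
    by (simp add: lookup_add)
  have "?B \<subseteq> ?C"
  proof
    fix p assume p: "p \<in> ?B"
    have "indic \<tau> \<notin> keys p" using p \<tau>(1) fin\<tau> by (auto simp: mono_ideal_def keys_indic)
    then show "p \<in> ?C" using p mono_ideal_mono[OF UU'] by (auto simp: in_keys_iff)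
  qed
  moreover have "r * a \<in> ?C" if r: "r \<in> set (elem_syms V j)" and a: "a \<in> ?A" for r a
  proof -
    obtain i where i: "r = elem_sym V i" "0 < i" using r by (auto simp: elem_syms_def)
    have "0 \<notin> keys r"
    proof
      assume "0 \<in> keys r"
      then obtain T where T: "T \<subseteq> V" "card T = i" "0 = indic T" using keys_elem_sym[of V i] i(1) by blast
      have "T = {}" using arg_cong[OF T(3), of keys] keys_indic[OF finite_subset[OF T(1) V]]
        by simp
      then show False using T(2) i(2) by simp
    qed
    moreover have "r \<in> polys V" unfolding i(1) by (rule elem_sym_in[OF V])
    ultimately show ?thesis using mult[OF a] submod_mult[OF A _ a] by simp
  qed
  ultimately have "plus_multiples ?A ?B (elem_syms V j) \<subseteq> ?C"
    by (rule plus_multiples_least[OF A B mono_ideal_mono[OF UU'] elem_syms_in[OF V] C])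
  moreover have "xmon \<tau> \<in> ?A" unfolding xmon_def
    by (rule single_in_mono_ideal) (use \<tau>(1) fin\<tau> in \<open>simp add: keys_indic\<close>)
  moreover have "xmon \<tau> \<notin> ?C" by (simp add: xmon_def)
  ultimately show ?thesis by blast
qed

text \<open>Both invariants are at most \<open>j\<close> because all monomials in more than \<open>j\<close> variables annihilate the module.
A set \<open>F\<close> of size \<open>j\<close> in the difference gives a chain of \<open>j + 1\<close> primes generated by variables, and the
elementary symmetric polynomials give a regular sequence of length \<open>j\<close>.\<close>

lemma chain_quotient_dim_depth:
  fixes U :: "'v set set" and Q :: "(('v, 'k::field) mpoly, 'm, 'c) module_scheme"
  assumes V: "finite V" and ch: "interval_chain V j U U'" and ne: "U \<noteq> U'"
    and pres: "presentation V (mono_ideal U') (mono_ideal U) Q \<phi>"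
  shows "krull_dim (mpoly_ring V) Q = ereal (real j)"
    and "depth (mpoly_ring V) (irrelevant_ideal (mpoly_ring V) (mpoly_grading V)) Q = ereal (real j)"
proof -
  interpret presentation V "mono_ideal U'" "mono_ideal U" Q \<phi> by (rule pres)
  have up: "upclosed V U" "upclosed V U'" using chain_upclosed[OF ch] by auto
  obtain F where F: "F \<in> U'" "F \<subseteq> V" "F \<notin> U" "card F = j" using chain_top[OF ch ne] by blast
  have finF: "finite F" by (rule finite_subset[OF F(2) V])
  have big: "z * a \<in> mono_ideal U"
    if z: "z \<in> mono_ideal {s. s \<subseteq> V \<and> j < card s}" and a: "a \<in> mono_ideal U'"
    for z a :: "('v, 'k) mpoly"
    unfolding mono_ideal_def mem_Collect_eq
  proof
    fix m assume "m \<in> keys (z * a)"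
    then obtain x y where m: "m = x + y" and xy: "x \<in> keys z" "y \<in> keys a"
      using keys_mult[of z a] by blast
    let ?s = "keys x \<union> keys y"
    have x: "keys x \<subseteq> V" "j < card (keys x)" and y: "keys y \<in> U'"
      using xy z a by (auto simp: mono_ideal_def)
    have sV: "?s \<subseteq> V" using x(1) y up(2) by (auto simp: upclosed_def)
    have "?s \<in> U'" by (rule upclosedD[OF up(2) y _ sV]) simp
    moreover have "card (keys x) \<le> card ?s" by (rule card_mono) auto
    then have "\<not> card ?s \<le> j" using x(2) by simp
    ultimately have "?s \<in> U" using chain_card_le[OF ch V] by blast
    then show "keys m \<in> U" unfolding m keys_add_nat .
  qed
  have mono_sub: "mono_ideal {s. s \<subseteq> V \<and> j < card s} \<subseteq> polys V" by (rule mono_ideal_mono) auto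
  show "krull_dim (mpoly_ring V) Q = ereal (real j)"
    unfolding krull_dim_def
  proof (rule Sup_ereal_eq)
    obtain fs where fs: "set fs = F" "distinct fs" using finite_distinct_list[OF finF] by blast
    have len: "length fs = j" using distinct_card[OF fs(2)] F(4) fs(1) by simp
    define P where "P i = (mono_ideal {t. t \<subseteq> V \<and> \<not> t \<subseteq> set (drop i fs)} :: ('v, 'k) mpoly set)" for i
    have dropF: "set (drop i fs) \<subseteq> F" for i using set_drop_subset[of i fs] fs(1) by simp
    have "primeideal (P i) (mpoly_ring V)" for i
      unfolding P_def by (rule primeideal_variables[OF V]) (use dropF F(2) in blast)
    moreover have "annihilator (mpoly_ring V) Q \<subseteq> P i" for i
    proof
      fix r assume "r \<in> annihilator (mpoly_ring V) Q"
      then have r: "r \<in> polys V" "\<forall>a\<in>mono_ideal U'. r * a \<in> mono_ideal U"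
        unfolding annihilator_eq by auto
      have "xmon F \<in> (mono_ideal U' :: ('v, 'k) mpoly set)"
        unfolding xmon_def by (rule single_in_mono_ideal) (use F(1) finF in \<open>simp add: keys_indic\<close>)
      then have "r * xmon F \<in> mono_ideal U" using r(2) by blast
      then have "xmon F * r \<in> mono_ideal U" by (subst mult.commute)
      then have "F \<union> keys m \<in> U" if "m \<in> keys r" for m
        using keys_single_mult[OF that, of "indic F"] finF
        by (auto simp: mono_ideal_def xmon_def keys_add_nat keys_indic)
      then have "\<not> keys m \<subseteq> F" if "m \<in> keys r" for m
        using that F(3) by (metis Un_absorb2)
      then show "r \<in> P i" using r(1) dropF[of i] unfolding P_def mono_ideal_def by blast
    qed
    moreover have "P i \<subset> P (Suc i)" if i: "i < j" for i
    proof -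
      have "drop i fs = fs ! i # drop (Suc i) fs" using i len by (simp add: Cons_nth_drop_Suc)
      moreover have "distinct (drop i fs)" using fs(2) by simp
      ultimately have D: "set (drop (Suc i) fs) \<subset> set (drop i fs)" by auto
      have "P i \<subseteq> P (Suc i)" unfolding P_def by (rule mono_ideal_mono) (use D in blast)
      moreover have "xmon (set (drop i fs)) \<in> P (Suc i)" unfolding P_def xmon_def
        by (rule single_in_mono_ideal) (use D dropF[of i] F(2) in \<open>simp add: keys_indic; blast\<close>)
      moreover have "xmon (set (drop i fs)) \<notin> P i"
        unfolding P_def xmon_def mono_ideal_def by (simp add: keys_indic)
      ultimately show ?thesis by blast
    qed
    ultimately show "\<exists>P. (\<forall>i\<le>j. primeideal (P i) (mpoly_ring V) \<and> annihilator (mpoly_ring V) Q \<subseteq> P i) \<and>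
        (\<forall>i<j. P i \<subset> P (Suc i))" by blast
  next
    fix n assume "\<exists>P. (\<forall>i\<le>n. primeideal (P i) (mpoly_ring V) \<and> annihilator (mpoly_ring V) Q \<subseteq> P i) \<and>
        (\<forall>i<n. P i \<subset> P (Suc i))"
    then obtain P where P: "\<And>i. i \<le> n \<Longrightarrow> primeideal (P i) (mpoly_ring V)"
      "annihilator (mpoly_ring V) Q \<subseteq> P 0" "\<And>i. i < n \<Longrightarrow> P i \<subset> P (Suc i)" by blast
    show "n \<le> j"
    proof (rule ccontr)
      assume "\<not> n \<le> j"
      have "\<exists>r. r \<in> P (Suc i) \<and> r \<notin> P i" if "i < n" for i using P(3)[OF that] by blast
      then obtain f where f: "\<And>i. i < n \<Longrightarrow> f i \<in> P (Suc i) \<and> f i \<notin> P i" by metis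
      let ?rs = "map f [0..<n]"
      have Psub: "P i \<subseteq> polys V" if "i \<le> n" for i
        using primeideal.axioms(1)[OF P(1)[OF that]] by (simp add: ideal_iff_submod)
      have rs: "set ?rs \<subseteq> polys V"
      proof
        fix r assume "r \<in> set ?rs"
        then obtain i where "i < n" "r = f i" by auto
        then show "r \<in> polys V" using f[of i] Psub[of "Suc i"] by auto
      qed
      have "j < length ?rs" using \<open>\<not> n \<le> j\<close> by simp
      then obtain z where z: "dependence (polys V) ?rs z" "z \<in> mono_ideal {s. s \<subseteq> V \<and> j < card s}"
        using dependence_exists[OF V rs, of j] by blast
      have "z \<in> annihilator (mpoly_ring V) Q" unfolding annihilator_eq using big z(2) mono_sub by blast
      moreover have "z \<notin> P 0"
      proof (rule dependence_prime_chain[OF z(1) rs])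
        fix i
        show "i \<le> length ?rs \<Longrightarrow> primeideal (P i) (mpoly_ring V)" using P(1)[of i] by simp
        show "i < length ?rs \<Longrightarrow> P i \<subseteq> P (Suc i) \<and> ?rs ! i \<in> P (Suc i) \<and> ?rs ! i \<notin> P i"
          using P(3)[of i] f[of i] by auto
      qed
      ultimately show False using P(2) by blast
    qed
  qed
  let ?I = "irrelevant_ideal (mpoly_ring V) (mpoly_grading V) :: ('v, 'k) mpoly set"
  let ?good = "\<lambda>rs. set rs \<subseteq> ?I \<and> regular_sequence (mpoly_ring V) Q rs"
  have upper: "length rs \<le> j" if rs: "regular_sequence (mpoly_ring V) Q rs" for rs
  proof (rule ccontr)
    assume "\<not> length rs \<le> j"
    then have j: "j < length rs" by simp
    from rs have sub: "set rs \<subseteq> polys V" and r: "regular_on (mono_ideal U') (mono_ideal U) rs"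
      and neq: "plus_multiples (mono_ideal U') (mono_ideal U) rs \<noteq> mono_ideal U'"
      unfolding regular_sequence_iff by auto
    obtain z where z: "dependence (polys V) rs z" "z \<in> mono_ideal {s. s \<subseteq> V \<and> j < card s}"
      using dependence_exists[OF V sub j] by blast
    have "mono_ideal U' \<subseteq> plus_multiples (mono_ideal U') (mono_ideal U) rs"
      by (rule dependence_regular_on[OF subring_of_mono_ideal A z(1) sub B r]) (rule big[OF z(2)])
    then show False using neq plus_multiples_upper[OF A B BA sub] by blast
  qed
  have "length (elem_syms V j :: ('v, 'k) mpoly list) = j" by (simp add: elem_syms_def)
  moreover have "?good (elem_syms V j)"
  proof
    show "set (elem_syms V j) \<subseteq> ?I"
    proof
      fix r :: "('v, 'k) mpoly" assume "r \<in> set (elem_syms V j)"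
      then obtain i where i: "r = elem_sym V i" "0 < i" by (auto simp: elem_syms_def)
      have "r \<in> mpoly_grading V (int i)" unfolding i(1) by (rule elem_sym_homogeneous[OF V])
      then show "r \<in> ?I" using grading_subset_irrelevant[of "int i" V] i(2) by auto
    qed
    show "regular_sequence (mpoly_ring V) Q (elem_syms V j)"
      unfolding regular_sequence_iff
      using elem_syms_in[OF V] regular_on_chain[OF V ch elem_syms_in[OF V] regular_on_elem_syms[OF V]]
        plus_multiples_elem_syms_neq[OF V ch ne] by blast
  qed
  ultimately have "\<exists>rs. j = length rs \<and> ?good rs" by metis
  then have "Sup {ereal (real n) | n. \<exists>rs. n = length rs \<and> ?good rs} = ereal (real j)"
    by (rule Sup_ereal_eq) (use upper in auto)
  moreover have "{ereal (real (length rs)) | rs. ?good rs} = {ereal (real n) | n. \<exists>rs. n = length rs \<and> ?good rs}"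
    by blast
  ultimately show "depth (mpoly_ring V) ?I Q = ereal (real j)" unfolding depth_def by simp
qed

section \<open>Gradings\<close>

text \<open>Monomial ideals contain the homogeneous parts of their elements, which is why all modules below are
graded.\<close>

definition homogeneous_part :: "(('v, 'k::comm_ring_1) mpoly) \<Rightarrow> int \<Rightarrow> ('v, 'k) mpoly" where
  "homogeneous_part p d = (\<Sum>m | m \<in> keys p \<and> int (monomial_degree m) = d. single m (lookup p m))"

lemma lookup_homogeneous_part: "lookup (homogeneous_part p d) m = (if int (monomial_degree m) = d then lookup p m else 0)"
proof -
  let ?K = "{m \<in> keys p. int (monomial_degree m) = d}"
  have "lookup (homogeneous_part p d) m = (\<Sum>m'\<in>?K. if m' = m then lookup p m else 0)"
    unfolding homogeneous_part_def lookup_sum by (rule sum.cong) (auto simp: lookup_single when_def)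
  also have "\<dots> = (if m \<in> ?K then lookup p m else 0)" by (subst sum.delta) simp_all
  finally show ?thesis by (simp add: in_keys_iff)
qed

lemma keys_homogeneous_part: "keys (homogeneous_part p d) \<subseteq> keys p"
  unfolding in_keys_iff subset_iff lookup_homogeneous_part by simp

lemma homogeneous_part_mono_ideal: "p \<in> mono_ideal U \<Longrightarrow> homogeneous_part p d \<in> mono_ideal U"
  using keys_homogeneous_part[of p d] unfolding mono_ideal_def by blast

lemma mpoly_grading_eq:
  "mpoly_grading V d = {p \<in> polys V. \<forall>m. lookup p m \<noteq> 0 \<longrightarrow> int (monomial_degree m) = d}"
  unfolding mpoly_grading_def carrier_mpoly_ring Ball_def in_keys_iff ..

lemma homogeneous_part_in_grading: "p \<in> polys V \<Longrightarrow> homogeneous_part p d \<in> mpoly_grading V d"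
  unfolding mpoly_grading_eq using homogeneous_part_mono_ideal[of p "Pow V" d] by (simp add: lookup_homogeneous_part)

lemma homogeneous_part_diff: "homogeneous_part (p - q) d = homogeneous_part p d - homogeneous_part q d"
  by (rule poly_mapping_eqI) (simp add: lookup_homogeneous_part lookup_minus)

lemma homogeneous_part_sum: "homogeneous_part (sum f S) d = (\<Sum>i\<in>S. homogeneous_part (f i) d)"
  by (rule poly_mapping_eqI) (simp add: lookup_homogeneous_part lookup_sum)

lemma homogeneous_part_homogeneous: "p \<in> mpoly_grading V e \<Longrightarrow> homogeneous_part p d = (if d = e then p else 0)"
  by (rule poly_mapping_eqI) (auto simp: lookup_homogeneous_part mpoly_grading_eq)

lemma sum_homogeneous_part:
  assumes "finite D" "(\<lambda>m. int (monomial_degree m)) ` keys p \<subseteq> D"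
  shows "(\<Sum>d\<in>D. homogeneous_part p d) = p"
proof (rule poly_mapping_eqI)
  fix m
  have "lookup (\<Sum>d\<in>D. homogeneous_part p d) m = (\<Sum>d\<in>D. if d = int (monomial_degree m) then lookup p m else 0)"
    unfolding lookup_sum lookup_homogeneous_part by (rule sum.cong) auto
  also have "\<dots> = (if int (monomial_degree m) \<in> D then lookup p m else 0)"
    using assms(1) by (rule sum.delta)
  also have "\<dots> = lookup p m"
  proof (cases "m \<in> keys p")
    case True
    then show ?thesis using assms(2) by auto
  next
    case False
    then show ?thesis by (simp add: in_keys_iff)
  qed
  finally show "lookup (\<Sum>d\<in>D. homogeneous_part p d) m = lookup p m" .
qed

lemma grading_zero: "0 \<in> mpoly_grading V d"
  unfolding mpoly_grading_eq by (simp add: mono_ideal_def)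

lemma grading_add:
  fixes p q :: "('v, 'k::field) mpoly"
  assumes "p \<in> mpoly_grading V d" "q \<in> mpoly_grading V d"
  shows "p + q \<in> mpoly_grading V d"
proof -
  have "int (monomial_degree m) = d" if m: "lookup (p + q) m \<noteq> 0" for m
  proof (cases "lookup p m = 0")
    case True
    then have "lookup q m \<noteq> 0" using m by (simp add: lookup_add)
    then show ?thesis using assms(2) by (simp add: mpoly_grading_eq)
  next
    case False
    then show ?thesis using assms(1) by (simp add: mpoly_grading_eq)
  qed
  moreover have "p + q \<in> polys V" using assms by (intro polys_closed) (simp_all add: mpoly_grading_eq)
  ultimately show ?thesis by (simp add: mpoly_grading_eq)
qed

lemma grading_uminus:
  fixes p :: "('v, 'k::field) mpoly"
  shows "p \<in> mpoly_grading V d \<Longrightarrow> - p \<in> mpoly_grading V d"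
  using polys_closed(3)[of p V] unfolding mpoly_grading_eq mem_Collect_eq lookup_uminus by auto

lemma grading_mult:
  fixes p q :: "('v, 'k::field) mpoly"
  assumes "p \<in> mpoly_grading V d" "q \<in> mpoly_grading V e"
  shows "p * q \<in> mpoly_grading V (d + e)"
proof -
  have "int (monomial_degree m) = d + e" if m: "m \<in> keys (p * q)" for m
  proof -
    obtain a b where "m = a + b" "a \<in> keys p" "b \<in> keys q"
      using keys_mult[of p q] m by blast
    then show ?thesis using assms by (simp add: mpoly_grading_def monomial_degree_add)
  qed
  moreover have "p * q \<in> polys V"
    using assms by (intro polys_closed) (simp_all add: mpoly_grading_def carrier_mpoly_ring)
  ultimately show ?thesis by (simp add: mpoly_grading_def carrier_mpoly_ring)
qed

lemma (in presentation) finsum_eq: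
  assumes "finite S" "\<And>d. d \<in> S \<Longrightarrow> g d \<in> A"
  shows "finsum Q (\<lambda>d. \<phi> (g d)) S = \<phi> (sum g S)"
proof -
  interpret abelian_group Q by (rule abelian_group)
  show ?thesis
    using assms
  proof (induction S rule: finite_induct)
    case empty
    then show ?case by (simp add: zero_eq)
  next
    case (insert d S)
    have gd: "g d \<in> A" and gS: "\<And>e. e \<in> S \<Longrightarrow> g e \<in> A" using insert.prems by simp_all
    have "finsum Q (\<lambda>d. \<phi> (g d)) (insert d S) = \<phi> (g d) \<oplus>\<^bsub>Q\<^esub> finsum Q (\<lambda>d. \<phi> (g d)) S"
      using insert.hyps gd gS by (intro finsum_insert) (auto simp: carrier_eq)
    also have "\<dots> = \<phi> (g d) \<oplus>\<^bsub>Q\<^esub> \<phi> (sum g S)" using insert.IH[OF gS] by simp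
    also have "\<dots> = \<phi> (g d + sum g S)"
      by (rule add_eq[OF gd]) (rule submod_sum[OF A gS])
    finally show ?case using insert.hyps by simp
  qed
qed

text \<open>A homogeneous decomposition of a residue class is the image of one in the polynomial ring.  It is unique
because \<open>mono_ideal U\<close> contains the homogeneous parts of each of its elements.\<close>

lemma graded_module_if_presentation:
  fixes Q :: "(('v, 'k::field) mpoly, 'm, 'c) module_scheme"
  assumes pres: "presentation V (mono_ideal U') (mono_ideal U) Q \<phi>" and U': "U' \<subseteq> Pow V"
  shows "graded_module (mpoly_ring V) (mpoly_grading V) Q (\<lambda>d. \<phi> ` (mono_ideal U' \<inter> mpoly_grading V d))"
proof -
  interpret presentation V "mono_ideal U'" "mono_ideal U" Q \<phi> by (rule pres)
  interpret Q: abelian_group Q by (rule abelian_group)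
  let ?A = "mono_ideal U' :: ('v, 'k) mpoly set"
  let ?G = "\<lambda>d. \<phi> ` (?A \<inter> mpoly_grading V d)"
  have AV: "?A \<subseteq> polys V" using U' by (rule mono_ideal_mono)
  have sub: "additive_subgroup (?G d) Q" for d
  proof (rule additive_subgroupI, rule group.subgroupI[OF Q.add.group_axioms])
    show "?G d \<subseteq> carrier (add_monoid Q)" by (auto simp: carrier_eq)
    show "?G d \<noteq> {}" using zeroA grading_zero by blast
    fix a assume "a \<in> ?G d"
    then obtain p where p: "a = \<phi> p" "p \<in> ?A" "p \<in> mpoly_grading V d" by blast
    have "a_inv Q a = \<phi> (- p)" unfolding p(1) by (rule a_inv_eq[OF p(2)])
    then show "inv\<^bsub>add_monoid Q\<^esub> a \<in> ?G d"
      using uminusA[OF p(2)] grading_uminus[OF p(3)] by (simp add: a_inv_def)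
    fix b assume "b \<in> ?G d"
    then obtain q where q: "b = \<phi> q" "q \<in> ?A" "q \<in> mpoly_grading V d" by blast
    have "a \<oplus>\<^bsub>Q\<^esub> b = \<phi> (p + q)" unfolding p(1) q(1) by (rule add_eq[OF p(2) q(2)])
    then show "a \<otimes>\<^bsub>add_monoid Q\<^esub> b \<in> ?G d"
      using addA[OF p(2) q(2)] grading_add[OF p(3) q(3)] by simp
  qed
  have smult: "r \<odot>\<^bsub>Q\<^esub> x \<in> ?G (i + j)" if r: "r \<in> mpoly_grading V i" and x: "x \<in> ?G j" for i j r x
  proof -
    obtain p where p: "x = \<phi> p" "p \<in> ?A" "p \<in> mpoly_grading V j" using x by blast
    have rV: "r \<in> polys V" using r by (simp add: mpoly_grading_eq)
    have "r \<odot>\<^bsub>Q\<^esub> x = \<phi> (r * p)" unfolding p(1) by (rule smult_eq[OF rV p(2)])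
    then show ?thesis using multA[OF rV p(2)] grading_mult[OF r p(3)] by blast
  qed
  have decomp: "\<exists>!c. (\<forall>i. c i \<in> ?G i) \<and> finite {i. c i \<noteq> \<zero>\<^bsub>Q\<^esub>} \<and> x = finsum Q c {i. c i \<noteq> \<zero>\<^bsub>Q\<^esub>}"
    if x: "x \<in> carrier Q" for x
  proof -
    obtain p where p: "x = \<phi> p" "p \<in> ?A" using x by (auto simp: carrier_eq)
    let ?c = "\<lambda>d. \<phi> (homogeneous_part p d)"
    have hA: "homogeneous_part p d \<in> ?A" for d by (rule homogeneous_part_mono_ideal[OF p(2)])
    let ?S = "{d. ?c d \<noteq> \<zero>\<^bsub>Q\<^esub>}"
    define D where "D = (\<lambda>m. int (monomial_degree m)) ` keys p"
    have finD: "finite D" by (simp add: D_def)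
    have SD: "?S \<subseteq> D"
    proof
      fix d assume "d \<in> ?S"
      then have "homogeneous_part p d \<notin> mono_ideal U" using eq_zero_iff[OF hA] by blast
      then have "homogeneous_part p d \<noteq> 0" using submod_zero[OF B] by metis
      then obtain m where "lookup (homogeneous_part p d) m \<noteq> 0" by (metis poly_mapping_eqI lookup_zero)
      then show "d \<in> D" unfolding D_def lookup_homogeneous_part by (auto simp: in_keys_iff split: if_splits)
    qed
    have finS: "finite ?S" by (rule finite_subset[OF SD finD])
    have pD: "p = (\<Sum>d\<in>?S. homogeneous_part p d) + (\<Sum>d\<in>D - ?S. homogeneous_part p d)"
      using sum_homogeneous_part[OF finD, of p] sum.subset_diff[OF SD finD, of "homogeneous_part p"] by (simp add: D_def add.commute)
    have zero: "homogeneous_part p d \<in> mono_ideal U" if "d \<notin> ?S" for d using that eq_zero_iff[OF hA] by blast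
    have "(\<Sum>d\<in>D - ?S. homogeneous_part p d) \<in> mono_ideal U" by (rule submod_sum[OF B]) (use zero in blast)
    then have "p - (\<Sum>d\<in>?S. homogeneous_part p d) \<in> mono_ideal U" using pD by (metis add_diff_cancel_left')
    moreover have "(\<Sum>d\<in>?S. homogeneous_part p d) \<in> ?A" by (rule submod_sum[OF A hA])
    ultimately have "\<phi> p = \<phi> (\<Sum>d\<in>?S. homogeneous_part p d)" using eq_iff[OF p(2)] by simp
    then have ex: "x = finsum Q ?c ?S" using finsum_eq[OF finS hA] p(1) by simp
    show ?thesis
    proof (rule ex1I[of _ ?c])
      show "(\<forall>i. ?c i \<in> ?G i) \<and> finite ?S \<and> x = finsum Q ?c ?S"
      proof (intro conjI allI)
        show "?c d \<in> ?G d" for d using hA homogeneous_part_in_grading[OF subsetD[OF AV p(2)]] by blast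
      qed (fact finS, fact ex)
      fix c assume c: "(\<forall>i. c i \<in> ?G i) \<and> finite {i. c i \<noteq> \<zero>\<^bsub>Q\<^esub>} \<and> x = finsum Q c {i. c i \<noteq> \<zero>\<^bsub>Q\<^esub>}"
      have "\<forall>i. \<exists>q. c i = \<phi> q \<and> q \<in> ?A \<and> q \<in> mpoly_grading V i" using c by blast
      then obtain g where g: "\<And>i. c i = \<phi> (g i)" "\<And>i. g i \<in> ?A" "\<And>i. g i \<in> mpoly_grading V i" by metis
      define T where "T = {i. c i \<noteq> \<zero>\<^bsub>Q\<^esub>}"
      have finT: "finite T" and xT: "x = finsum Q c T" using c by (simp_all add: T_def)
      have "c = (\<lambda>i. \<phi> (g i))" using g(1) by (rule ext)
      then have "\<phi> p = \<phi> (sum g T)" using xT finsum_eq[OF finT g(2)] p(1) by simp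
      moreover have "sum g T \<in> ?A" by (rule submod_sum[OF A g(2)])
      ultimately have diff: "p - sum g T \<in> mono_ideal U" using eq_iff[OF p(2)] by simp
      show "c = ?c"
      proof
        fix d
        have "homogeneous_part (p - sum g T) d \<in> mono_ideal U" by (rule homogeneous_part_mono_ideal[OF diff])
        moreover have "homogeneous_part (sum g T) d = (if d \<in> T then g d else 0)"
        proof -
          have "homogeneous_part (sum g T) d = (\<Sum>i\<in>T. if d = i then g d else 0)"
            unfolding homogeneous_part_sum by (rule sum.cong) (use homogeneous_part_homogeneous[OF g(3)] in auto)
          then show ?thesis using finT by simp
        qed
        ultimately have h: "homogeneous_part p d - (if d \<in> T then g d else 0) \<in> mono_ideal U" by (simp add: homogeneous_part_diff)
        show "c d = ?c d"
        proof (cases "d \<in> T")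
          case True
          then have "\<phi> (homogeneous_part p d) = \<phi> (g d)" using h eq_iff[OF hA g(2)] by simp
          then show ?thesis using g(1) by simp
        next
          case False
          then have "?c d = \<zero>\<^bsub>Q\<^esub>" using h eq_zero_iff[OF hA] by simp
          then show ?thesis using False by (simp add: T_def)
        qed
      qed
    qed
  qed
  show ?thesis unfolding graded_module_def using module sub smult decomp by blast
qed

section \<open>Vertex decomposable graphs are sequentially Cohen-Macaulay\<close>

lemma xmon_pair: "u \<noteq> v \<Longrightarrow> xmon {u, v} = poly_var u * poly_var v"
  by (simp add: xmon_def indic_def poly_var_def mult_single)

lemma upclosed_nonindep: "upclosed V {t. t \<subseteq> V \<and> \<not> indep E t}"
  unfolding upclosed_def using indep_subset by blast

lemma edge_ideal_eq:
  assumes G: "simple_graph G"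
  shows "edge_ideal G = (mono_ideal {t. t \<subseteq> verts G \<and> \<not> indep (\<lambda>u v. {u, v} \<in> edges G) t} ::
    ('v, 'k::field) mpoly set)"
proof -
  let ?V = "verts G" and ?E = "\<lambda>u v. {u, v} \<in> edges G"
  let ?R = "mpoly_ring ?V :: ('v, 'k) mpoly ring"
  let ?J = "mono_ideal {t. t \<subseteq> ?V \<and> \<not> indep ?E t} :: ('v, 'k) mpoly set"
  let ?X = "{poly_var u * poly_var v | u v. {u, v} \<in> edges G} :: ('v, 'k) mpoly set"
  interpret cring ?R by (rule cring_mpoly_ring)
  have edge: "u \<noteq> v \<and> u \<in> ?V \<and> v \<in> ?V" if "?E u v" for u v
    using G that unfolding simple_graph_def by (metis doubleton_eq_iff)
  have JV: "?J \<subseteq> polys ?V" by (rule mono_ideal_mono) auto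
  have J: "ideal ?J ?R"
    unfolding ideal_iff_submod using JV submod_mono_ideal[OF upclosed_nonindep] by blast
  have XJ: "?X \<subseteq> ?J"
  proof
    fix p assume "p \<in> ?X"
    then obtain u v where uv: "?E u v" "p = poly_var u * poly_var v" by blast
    have "p = xmon {u, v}" unfolding uv(2) by (rule xmon_pair[symmetric]) (use edge[OF uv(1)] in simp)
    moreover have "\<not> indep ?E {u, v}" using uv(1) by (auto simp: indep_def)
    ultimately show "p \<in> ?J" using edge[OF uv(1)]
      unfolding xmon_def by (auto intro!: single_in_mono_ideal simp: keys_indic)
  qed
  have XR: "?X \<subseteq> carrier ?R" using XJ JV unfolding carrier_mpoly_ring by blast
  have I: "submod (polys ?V) (edge_ideal G :: ('v, 'k) mpoly set)"
    using genideal_ideal[OF XR] unfolding edge_ideal_def ideal_iff_submod by blast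
  show ?thesis
  proof
    show "edge_ideal G \<subseteq> ?J" unfolding edge_ideal_def by (rule genideal_minimal[OF J XJ])
    show "?J \<subseteq> edge_ideal G"
    proof
      fix p assume p: "p \<in> ?J"
      show "p \<in> edge_ideal G"
      proof (rule in_submod_if_terms[OF I])
        fix m assume m: "m \<in> keys p"
        then have mV: "keys m \<subseteq> ?V" and "\<not> indep ?E (keys m)"
          using p by (simp_all add: mono_ideal_def)
        then obtain u v where uv: "?E u v" "{u, v} \<subseteq> keys m" by (auto simp: indep_def)
        let ?q = "single (m - indic {u, v}) (lookup p m)"
        have "?q \<in> polys ?V"
          by (rule single_in_mono_ideal) (use divide_by_indic(2)[of "{u, v}" m] uv(2) mV in auto)
        moreover have "xmon {u, v} \<in> (edge_ideal G :: ('v, 'k) mpoly set)"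
        proof -
          have "xmon {u, v} = (poly_var u * poly_var v :: ('v, 'k) mpoly)"
            by (rule xmon_pair) (use edge[OF uv(1)] in simp)
          then have "xmon {u, v} \<in> ?X" using uv(1) by (intro CollectI exI conjI)
          then show ?thesis unfolding edge_ideal_def by (rule subsetD[OF genideal_self[OF XR]])
        qed
        ultimately have "?q * xmon {u, v} \<in> edge_ideal G" by (rule submod_mult[OF I])
        moreover have "single m (lookup p m) = ?q * xmon {u, v}"
          by (subst mult.commute, rule divide_by_indic(1)) (use uv(2) in auto)
        ultimately show "single m (lookup p m) \<in> edge_ideal G" by simp
      qed
    qed
  qed
qed

lemma below_facets_0:
  assumes "finite V"
  shows "below V (facets E V) 0 = {t. t \<subseteq> V \<and> \<not> indep E t}"
proof (intro equalityI subsetI)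
  fix t assume t: "t \<in> below V (facets E V) 0"
  have "\<not> indep E t"
  proof
    assume "indep E t"
    then obtain F where "F \<in> facets E V" "t \<subseteq> F" using extend_to_facet[OF assms, of t E] t by (auto simp: below_def)
    then show False using t by (auto simp: below_def)
  qed
  then show "t \<in> {t. t \<subseteq> V \<and> \<not> indep E t}" using t by (simp add: below_def)
next
  fix t assume t: "t \<in> {t. t \<subseteq> V \<and> \<not> indep E t}"
  then have "\<not> t \<subseteq> F" if "F \<in> facets E V" for F using indep_subset[OF facets_indep[OF that]] by blast
  then show "t \<in> below V (facets E V) 0" using t by (simp add: below_def)
qed

text \<open>The quotient is formed from the ring seen as a module, whereas the cosets in the grading are those of
the ring; both are the same sets.\<close>

lemma presentation_edge_module:
  fixes G :: "'v graph"
  assumes G: "simple_graph G"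
  defines "I \<equiv> edge_ideal G :: ('v, 'k::field) mpoly set"
  shows "presentation (verts G) (polys (verts G)) I (edge_module G) (\<lambda>p. I +>\<^bsub>mpoly_ring (verts G)\<^esub> p)"
proof -
  let ?M = "ring_as_module (mpoly_ring (verts G) :: ('v, 'k) mpoly ring)"
  interpret presentation "verts G" "polys (verts G)" "{0}" ?M "\<lambda>p. p" by (rule presentation_ring)
  have I_eq: "I = mono_ideal {t. t \<subseteq> verts G \<and> \<not> indep (\<lambda>u v. {u, v} \<in> edges G) t}"
    unfolding I_def by (rule edge_ideal_eq[OF G])
  have I: "submod (polys (verts G)) I" unfolding I_eq by (rule submod_mono_ideal[OF upclosed_nonindep])
  have "presentation (verts G) (polys (verts G)) I (quot_module ?M ((\<lambda>p. p) ` I)) (\<lambda>a. (\<lambda>p. p) ` I +>\<^bsub>?M\<^esub> a)"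
  proof (rule presentation_quot[OF I])
    show "{0} \<subseteq> I" using submod_zero[OF I] by simp
    show "I \<subseteq> polys (verts G)" unfolding I_eq by (rule mono_ideal_mono) auto
  qed
  moreover have "(\<lambda>a. I +>\<^bsub>?M\<^esub> a) = (\<lambda>p. I +>\<^bsub>mpoly_ring (verts G)\<^esub> p)"
    by (simp add: a_r_coset_def r_coset_def ring_as_module_def)
  ultimately show ?thesis by (simp add: edge_module_def I_def)
qed

lemma (in presentation) image_Int_homogeneous:
  assumes A_eq: "A = polys V" and C: "submod (polys V) C" "B \<subseteq> C" "C \<subseteq> A"
  shows "\<phi> ` mpoly_grading V d \<inter> \<phi> ` C = \<phi> ` (C \<inter> mpoly_grading V d)"
proof (intro equalityI subsetI)
  fix x assume "x \<in> \<phi> ` mpoly_grading V d \<inter> \<phi> ` C"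
  then obtain p c where pc: "p \<in> mpoly_grading V d" "c \<in> C" "x = \<phi> p" "\<phi> p = \<phi> c" by auto
  have "p \<in> A" using pc(1) unfolding A_eq by (simp add: mpoly_grading_eq)
  then have "p - c \<in> B" using eq_iff[of p c] pc(2,4) C(3) by blast
  then have "(p - c) + c \<in> C" using C(2) pc(2) by (intro submod_add[OF C(1)]) auto
  then show "x \<in> \<phi> ` (C \<inter> mpoly_grading V d)" using pc(1,3) by simp
qed auto

text \<open>The filtration is given by the families of sets that lie only in small facets, at the sizes of
the facets in increasing order.  At other sizes the family does not change, so that consecutive members
differ as in \<open>chain_below_facets\<close>, and the dimensions of the quotients are the sizes of the facets.\<close>

lemma sequentially_cohen_macaulay_if_vertex_decomposable:
  fixes G :: "'v graph"
  assumes G: "simple_graph G" and vertex_decomposable: "vertex_decomposable (\<lambda>u v. {u, v} \<in> edges G) (verts G)"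
  shows "sequentially_cohen_macaulay_graph TYPE('k::field) G"
proof -
  let ?V = "verts G" and ?E = "\<lambda>u v. {u, v} \<in> edges G"
  let ?R = "mpoly_ring ?V :: ('v, 'k) mpoly ring"
  let ?M = "edge_module G :: (('v, 'k) mpoly, _) module"
  let ?Mg = "edge_module_grading G :: int \<Rightarrow> ('v, 'k) mpoly set set"
  let ?Fs = "facets ?E ?V"
  define U where "U j = below ?V ?Fs j" for j
  define I where "I = (edge_ideal G :: ('v, 'k) mpoly set)"
  define \<phi> where "\<phi> p = I +>\<^bsub>?R\<^esub> p" for p
  have V: "finite ?V" using G by (simp add: simple_graph_def)
  interpret sym_graph ?E
    by unfold_locales (use G in \<open>auto simp: simple_graph_def insert_commute\<close>)
  have I_eq: "I = mono_ideal (U 0)"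
    unfolding I_def U_def below_facets_0[OF V] by (rule edge_ideal_eq[OF G])
  interpret M: presentation ?V "polys ?V" "mono_ideal (U 0)" ?M \<phi>
    unfolding I_eq[symmetric] \<phi>_def unfolding I_def by (rule presentation_edge_module[OF G])
  have up: "upclosed ?V (U j)" for j unfolding U_def by (rule upclosed_below)
  have UV: "U j \<subseteq> Pow ?V" for j using up[of j] by (simp add: upclosed_def)
  have U_mono: "U i \<subseteq> U j" if "i \<le> j" for i j using that by (auto simp: U_def below_def)
  have sm: "submod (polys ?V) (mono_ideal (U j) :: ('v, 'k) mpoly set)" for j
    by (rule submod_mono_ideal[OF up])
  have U0: "mono_ideal (U 0) \<subseteq> (mono_ideal (U j) :: ('v, 'k) mpoly set)" for j
    by (rule mono_ideal_mono[OF U_mono]) simp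
  have UR: "mono_ideal (U j) \<subseteq> (polys ?V :: ('v, 'k) mpoly set)" for j
    by (rule mono_ideal_mono[OF UV])
  have Mg: "?Mg = (\<lambda>d. \<phi> ` mpoly_grading ?V d)"
    unfolding edge_module_grading_def \<phi>_def I_def by (rule ext) simp
  have gr_V: "polys ?V \<inter> mpoly_grading ?V d = (mpoly_grading ?V d :: ('v, 'k) mpoly set)" for d
    by (auto simp: mpoly_grading_eq)
  have graded: "graded_module ?R (mpoly_grading ?V) ?M ?Mg"
    using graded_module_if_presentation[OF M.presentation_axioms] unfolding Mg gr_V by blast
  define N where "N j = \<phi> ` mono_ideal (U j)" for j
  have pres_N: "presentation ?V (mono_ideal (U j)) (mono_ideal (U 0)) (?M\<lparr>carrier := N j\<rparr>) \<phi>" for j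
    unfolding N_def by (rule M.presentation_sub[OF sm U0 UR])
  have graded_N: "graded_submodule ?R (mpoly_grading ?V) ?M ?Mg (N j)" for j
  proof -
    have "submodule (N j) ?R ?M" unfolding N_def by (rule M.image_submodule[OF sm UR])
    moreover have "?Mg d \<inter> N j = \<phi> ` (mono_ideal (U j) \<inter> mpoly_grading ?V d)" for d
      unfolding Mg N_def by (rule M.image_Int_homogeneous[OF _ sm U0 UR]) simp
    ultimately show ?thesis
      using graded_module_if_presentation[OF pres_N UV] unfolding graded_submodule_def by simp
  qed
  have N_mono_iff: "p \<in> mono_ideal (U j)" if p: "p \<in> polys ?V" "\<phi> p \<in> N j" for p j
  proof -
    obtain c where c: "c \<in> mono_ideal (U j)" "\<phi> p = \<phi> c" using p(2) unfolding N_def by blast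
    then have "p - c \<in> mono_ideal (U 0)" using M.eq_iff[OF p(1)] UR by blast
    then have "(p - c) + c \<in> mono_ideal (U j)" using U0 c(1) by (intro submod_add[OF sm]) auto
    then show ?thesis by simp
  qed
  have finFs: "finite ?Fs"
    by (rule finite_subset[of _ "Pow ?V"]) (use V facets_subset in auto)
  have "\<exists>F. F \<in> ?Fs" using extend_to_facet[OF V, of "{}" ?E] by (auto simp: indep_def)
  then have Fs_ne: "card ` ?Fs \<noteq> {}" by blast
  define sz where "sz = sorted_list_of_set (card ` ?Fs)"
  have sz: "set sz = card ` ?Fs" "sorted_wrt (<) sz"
    unfolding sz_def using finFs by simp_all
  define r where "r = length sz"
  \<comment> \<open>The last value exceeds all sizes of facets, so that the filtration ends with the whole module.\<close>
  define J where "J i = (if i < r then sz ! i else Suc (card ?V))" for i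
  have r0: "0 < r" using Fs_ne sz(1) unfolding r_def by force
  have card_le: "card F \<le> card ?V" if "F \<in> ?Fs" for F by (rule card_mono[OF V facets_subset[OF that]])
  have J_mem: "\<exists>F\<in>?Fs. card F = J i" if "i < r" for i
  proof -
    have "sz ! i \<in> card ` ?Fs" using that sz(1) nth_mem[of i sz] unfolding r_def by simp
    then show ?thesis using that by (auto simp: J_def)
  qed
  have J_less: "J i < J k" if "i < k" "k \<le> r" for i k
  proof (cases "k < r")
    case True
    then show ?thesis using that sorted_wrt_nth_less[OF sz(2), of i k] unfolding J_def r_def by simp
  next
    case False
    have "J k = Suc (card ?V)" using False by (simp add: J_def)
    moreover obtain F where "F \<in> ?Fs" "card F = J i" using J_mem[of i] \<open>i < k\<close> \<open>k \<le> r\<close> by auto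
    ultimately show ?thesis using card_le[of F] by simp
  qed
  have J_gap: "J (Suc i) \<le> card F" if i: "i < r" and F: "F \<in> ?Fs" "J i < card F" for i F
  proof -
    have "card F \<in> set sz" unfolding sz(1) using F(1) by (rule imageI)
    then obtain k where k: "k < r" "sz ! k = card F" unfolding in_set_conv_nth r_def by blast
    have "i < k"
    proof (rule ccontr)
      assume "\<not> i < k"
      then have "J k \<le> J i" using J_less[of k i] i by (cases "k = i") auto
      then show False using k F(2) by (simp add: J_def)
    qed
    then have "J (Suc i) \<le> J k" using J_less[of "Suc i" k] k(1) by (cases "Suc i = k") auto
    then show ?thesis using k by (simp add: J_def)
  qed
  have U_Suc: "U (J (Suc i)) = U (Suc (J i))" if i: "i < r" for i
  proof -
    have "card F < J (Suc i) \<longleftrightarrow> card F < Suc (J i)" if "F \<in> ?Fs" for F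
      using J_gap[OF i that] J_less[of i "Suc i"] i by fastforce
    then show ?thesis unfolding U_def below_def by blast
  qed
  have U_J0: "U (J 0) = U 0"
  proof -
    have "J 0 \<le> card F" if F: "F \<in> ?Fs" for F
    proof -
      have "card F \<in> set sz" unfolding sz(1) using F by (rule imageI)
      then obtain k where k: "k < r" "sz ! k = card F" unfolding in_set_conv_nth r_def by blast
      have "J 0 \<le> J k" using J_less[of 0 k] k(1) by (cases "k = 0") auto
      then show ?thesis using k by (simp add: J_def)
    qed
    then have "card F < J 0 \<longleftrightarrow> card F < 0" if "F \<in> ?Fs" for F using that by fastforce
    then show ?thesis unfolding U_def below_def by blast
  qed
  have "J r = Suc (card ?V)" by (simp add: J_def)
  then have U_Jr: "U (J r) = Pow ?V" using card_le by (auto simp: U_def below_def less_Suc_eq_le)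
  have U_ne: "U (J i) \<noteq> U (J (Suc i))" and N_strict: "N (J i) \<subset> N (J (Suc i))" if i: "i < r" for i
  proof -
    obtain F where F: "F \<in> ?Fs" "card F = J i" using J_mem[OF i] by blast
    have FV: "F \<subseteq> ?V" and finF: "finite F"
      using facets_subset[OF F(1)] finite_subset[OF facets_subset[OF F(1)] V] by simp_all
    have notin: "F \<notin> U (J i)" using F by (auto simp: U_def below_def)
    have uniq: "F' = F" if F': "F' \<in> ?Fs" "F \<subseteq> F'" for F'
    proof (rule ccontr)
      assume "F' \<noteq> F"
      then obtain v where v: "v \<in> F'" "v \<notin> F" using F'(2) by blast
      have "indep ?E (insert v F)" by (rule indep_subset[OF facets_indep[OF F'(1)]]) (use v F'(2) in simp)
      moreover have "v \<in> ?V - F" using v facets_subset[OF F'(1)] by blast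
      ultimately show False using F(1) unfolding facets_def by blast
    qed
    have "card F' < J (Suc i)" if "F' \<in> ?Fs" "F \<subseteq> F'" for F'
      unfolding uniq[OF that] F(2) using i by (intro J_less) simp_all
    then have isin: "F \<in> U (J (Suc i))" using FV unfolding U_def below_def by simp
    show "U (J i) \<noteq> U (J (Suc i))" using notin isin by blast
    have x: "xmon F \<in> (polys ?V :: ('v, 'k) mpoly set)"
      "xmon F \<in> (mono_ideal (U (J (Suc i))) :: ('v, 'k) mpoly set)"
      "xmon F \<notin> (mono_ideal (U (J i)) :: ('v, 'k) mpoly set)"
      using FV notin isin finF by (simp_all add: xmon_def mono_ideal_def keys_indic)
    have "U (J i) \<subseteq> U (J (Suc i))" using J_less[of i "Suc i"] i by (intro U_mono) simp
    then have "N (J i) \<subseteq> N (J (Suc i))" unfolding N_def by (intro image_mono mono_ideal_mono)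
    moreover have "\<phi> (xmon F) \<in> N (J (Suc i))" unfolding N_def using x(2) by blast
    moreover have "\<phi> (xmon F) \<notin> N (J i)" using N_mono_iff[OF x(1)] x(3) by blast
    ultimately show "N (J i) \<subset> N (J (Suc i))" by blast
  qed
  let ?Q = "\<lambda>i. quot_module (?M\<lparr>carrier := N (J (Suc i))\<rparr>) (N (J i))"
  have dims: "krull_dim ?R (?Q i) = ereal (real (J i))"
    "depth ?R (irrelevant_ideal ?R (mpoly_grading ?V)) (?Q i) = ereal (real (J i))" if i: "i < r" for i
  proof -
    interpret P: presentation ?V "mono_ideal (U (J (Suc i)))" "mono_ideal (U 0)"
      "?M\<lparr>carrier := N (J (Suc i))\<rparr>" \<phi> by (rule pres_N)
    have le: "U (J i) \<subseteq> U (J (Suc i))" using J_less[of i "Suc i"] i by (intro U_mono) simp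
    have pres: "presentation ?V (mono_ideal (U (J (Suc i)))) (mono_ideal (U (J i))) (?Q i)
        (\<lambda>a. \<phi> ` mono_ideal (U (J i)) +>\<^bsub>?M\<lparr>carrier := N (J (Suc i))\<rparr>\<^esub> \<phi> a)"
      using P.presentation_quot[OF sm U0 mono_ideal_mono[OF le]] unfolding N_def .
    have ch: "interval_chain ?V (J i) (U (J i)) (U (J (Suc i)))"
      unfolding U_Suc[OF i] unfolding U_def by (rule chain_below_facets[OF vertex_decomposable V]) simp
    show "krull_dim ?R (?Q i) = ereal (real (J i))"
      "depth ?R (irrelevant_ideal ?R (mpoly_grading ?V)) (?Q i) = ereal (real (J i))"
      using chain_quotient_dim_depth[OF V ch U_ne[OF i] pres] by simp_all
  qed
  have fin_gen: "fin_gen_module ?R ?M"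
    unfolding fin_gen_module_def
  proof (intro exI[of _ "{\<phi> 1}"] conjI)
    show "{\<phi> 1} \<subseteq> carrier ?M" using polys_closed(5) by (auto simp: M.carrier_eq)
    interpret module ?R ?M by (rule M.module)
    have "carrier ?M \<subseteq> L" if L: "submodule L ?R ?M" "{\<phi> 1} \<subseteq> L" for L
    proof
      fix x assume "x \<in> carrier ?M"
      then obtain p where p: "x = \<phi> p" "p \<in> polys ?V" by (auto simp: M.carrier_eq)
      have "p \<odot>\<^bsub>?M\<^esub> \<phi> 1 \<in> L" using submoduleE(4)[OF L(1)] L(2) p(2) by (simp add: carrier_mpoly_ring)
      then show "x \<in> L" using M.smult_eq[OF p(2) polys_closed(5)] p(1) by simp
    qed
    moreover have "submodule (carrier ?M) ?R ?M" by (rule carrier_is_submodule)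
    ultimately show "gen_submodule ?R ?M {\<phi> 1} = carrier ?M"
      using \<open>{\<phi> 1} \<subseteq> carrier ?M\<close> unfolding gen_submodule_def by blast
  qed simp
  have N0: "N (J 0) = {\<zero>\<^bsub>?M\<^esub>}"
  proof -
    have "\<phi> p = \<zero>\<^bsub>?M\<^esub>" if "p \<in> mono_ideal (U 0)" for p using that M.eq_zero_iff UR by blast
    moreover have "\<zero>\<^bsub>?M\<^esub> \<in> \<phi> ` mono_ideal (U 0)" using submod_zero[OF sm] unfolding M.zero_eq by blast
    ultimately show ?thesis unfolding N_def U_J0 by blast
  qed
  have Nr: "N (J r) = carrier ?M" unfolding N_def U_Jr M.carrier_eq ..
  show ?thesis
    unfolding sequentially_cohen_macaulay_graph_def sequentially_cohen_macaulay_def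
  proof (intro conjI exI[of _ r] exI[of _ "\<lambda>i. N (J i)"] allI impI)
    show "cohen_macaulay ?R (irrelevant_ideal ?R (mpoly_grading ?V)) (?Q i)" if "i < r" for i
      unfolding cohen_macaulay_def dims[OF that] ..
    show "krull_dim ?R (?Q i) < krull_dim ?R (?Q (Suc i))" if "Suc i < r" for i
      using dims(1)[of i] dims(1)[of "Suc i"] J_less[of i "Suc i"] that by simp
    show "N (J i) \<subset> N (J (Suc i))" if "i < r" for i by (rule N_strict[OF that])
  qed (rule graded fin_gen N0 Nr graded_N)+
qed

section \<open>Chordal graphs and five-cycles\<close>

text \<open>Unlike vertex decomposability, this property passes to induced subgraphs by definition.\<close>

definition hered_shedding :: "('v \<Rightarrow> 'v \<Rightarrow> bool) \<Rightarrow> 'v set \<Rightarrow> bool" where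
  "hered_shedding E V \<longleftrightarrow> (\<forall>W\<subseteq>V. \<not> indep E W \<longrightarrow> (\<exists>x. shedding E W x))"

lemma vertex_decomposable_if_hered_shedding:
  "finite V \<Longrightarrow> hered_shedding E V \<Longrightarrow> vertex_decomposable E V"
proof (induction "card V" arbitrary: V rule: less_induct)
  case less
  show ?case
  proof (cases "indep E V")
    case True
    then show ?thesis by (rule decomposable_indep)
  next
    case False
    then obtain x where x: "shedding E V x" using less.prems(2) by (auto simp: hered_shedding_def)
    then have xV: "x \<in> V" by (simp add: shedding_def)
    have sub: "vertex_decomposable E W" if "W \<subseteq> V - {x}" for W
    proof (rule less.hyps)
      have "W \<subset> V" using that xV by auto
      then show "card W < card V" by (rule psubset_card_mono[OF less.prems(1)])
      show "finite W" by (rule finite_subset[OF _ less.prems(1)]) (use that in auto)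
      show "hered_shedding E W" using less.prems(2) \<open>W \<subset> V\<close> unfolding hered_shedding_def by blast
    qed
    show ?thesis by (rule decomposable_shed[OF x]) (auto simp: away_def intro!: sub)
  qed
qed

context sym_graph
begin

text \<open>All neighbours of \<open>y\<close> lie in the closed neighbourhood of \<open>x\<close>, so that \<open>y\<close> can be added to every independent
set of the link of \<open>x\<close>.\<close>

lemma shedding_if_dominated:
  assumes "x \<in> V" "y \<in> V" "E x y" "\<And>z. z \<in> V \<Longrightarrow> E y z \<Longrightarrow> z = x \<or> E x z"
  shows "shedding E V x"
  unfolding shedding_def
proof (intro conjI allI impI)
  fix F assume F: "F \<subseteq> away E V x" "indep E F"
  have "\<not> E y f" if "f \<in> F" for f using that F(1) assms(4)[of f] by (auto simp: away_def)
  then show "\<exists>y\<in>V. E x y \<and> (\<forall>f\<in>F. \<not> E y f)" using assms(2,3) by blast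
qed fact

lemma shedding_add_isolated:
  assumes "shedding E (W \<inter> V) x" "\<And>u v. u \<in> W - V \<Longrightarrow> v \<in> W \<Longrightarrow> \<not> E u v"
  shows "shedding E W x"
  unfolding shedding_def
proof (intro conjI allI impI)
  show "x \<in> W" using assms(1) by (simp add: shedding_def)
  fix F assume F: "F \<subseteq> away E W x" "indep E F"
  have "F \<inter> V \<subseteq> away E (W \<inter> V) x" using F(1) by (auto simp: away_def)
  moreover have "indep E (F \<inter> V)" by (rule indep_subset[OF F(2)]) simp
  ultimately obtain y where y: "y \<in> W \<inter> V" "E x y" "\<forall>f\<in>F \<inter> V. \<not> E y f"
    using assms(1) unfolding shedding_def by meson
  have "\<not> E y f" if f: "f \<in> F" for f
  proof (cases "f \<in> V")
    case True
    then show ?thesis using y(3) f by blast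
  next
    case False
    then have "\<not> E f y" using assms(2)[of f y] f F(1) y(1) by (auto simp: away_def)
    then show ?thesis using sym[of y f] by blast
  qed
  then show "\<exists>y\<in>W. E x y \<and> (\<forall>f\<in>F. \<not> E y f)" using y by blast
qed

lemma hered_shedding_isolated:
  assumes "hered_shedding E V" "\<And>u v. u \<in> I \<Longrightarrow> v \<in> V \<union> I \<Longrightarrow> \<not> E u v"
  shows "hered_shedding E (V \<union> I)"
  unfolding hered_shedding_def
proof (intro allI impI)
  fix W assume W: "W \<subseteq> V \<union> I" "\<not> indep E W"
  have iso: "\<not> E u v" if "u \<in> W - V" "v \<in> W" for u v using assms(2)[of u v] that W(1) by blast
  obtain u v where uv: "u \<in> W" "v \<in> W" "E u v" using W(2) by (auto simp: indep_def)
  have "u \<in> V" using iso[of u v] uv by blast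
  moreover have "v \<in> V" using iso[of v u] uv sym[OF uv(3)] by blast
  ultimately have "\<not> indep E (W \<inter> V)" using uv by (auto simp: indep_def)
  then obtain x where "shedding E (W \<inter> V) x" using assms(1) unfolding hered_shedding_def by blast
  then show "\<exists>x. shedding E W x" using shedding_add_isolated iso by blast
qed

text \<open>Each vertex \<open>s\<close> of \<open>S\<close> dominates its leaf, hence is a shedding vertex.  The leaf of another vertex \<open>t\<close> is
adjacent to \<open>t\<close> only, so it survives in the link of \<open>s\<close> whenever \<open>t\<close> does, and the hypothesis is inherited by
both smaller graphs.\<close>

lemma vertex_decomposable_if_leaves:
  assumes "finite V" "hered_shedding E (V - S)"
    and "\<And>s. s \<in> S \<inter> V \<Longrightarrow> \<exists>l\<in>V - S. E s l \<and> (\<forall>v\<in>V. E l v \<longrightarrow> v = s)"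
  shows "vertex_decomposable E V"
  using assms
proof (induction "card V" arbitrary: V rule: less_induct)
  case less
  show ?case
  proof (cases "S \<inter> V = {}")
    case True
    then have "V - S = V" by blast
    then show ?thesis using vertex_decomposable_if_hered_shedding less.prems by metis
  next
    case False
    then obtain s where s: "s \<in> S" "s \<in> V" by blast
    obtain l where l: "l \<in> V" "E s l" "\<And>v. v \<in> V \<Longrightarrow> E l v \<Longrightarrow> v = s" using less.prems(3)[of s] s by blast
    have sh: "shedding E V s" by (rule shedding_if_dominated[OF s(2) l(1,2)]) (use l(3) in blast)
    have sub: "vertex_decomposable E W" if W: "W \<subseteq> V - {s}" "\<And>t l. t \<in> S \<inter> W \<Longrightarrow> l \<in> V - S \<Longrightarrow> E t l \<Longrightarrow>
        \<forall>v\<in>V. E l v \<longrightarrow> v = t \<Longrightarrow> l \<in> W" for W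
    proof (rule less.hyps)
      have WV: "W \<subset> V" using W(1) s by auto
      then show "card W < card V" by (rule psubset_card_mono[OF less.prems(1)])
      show "finite W" by (rule finite_subset[OF _ less.prems(1)]) (use WV in auto)
      show "hered_shedding E (W - S)"
        using less.prems(2) WV unfolding hered_shedding_def by (meson Diff_mono order.refl order.trans psubset_imp_subset)
      fix t assume t: "t \<in> S \<inter> W"
      then obtain l where l: "l \<in> V - S" "E t l" "\<forall>v\<in>V. E l v \<longrightarrow> v = t" using less.prems(3)[of t] WV by blast
      then have "l \<in> W" using W(2) t by blast
      then show "\<exists>l\<in>W - S. E t l \<and> (\<forall>v\<in>W. E l v \<longrightarrow> v = t)" using l WV by blast
    qed
    show ?thesis
    proof (rule decomposable_shed[OF sh])
      show "vertex_decomposable E (V - {s})" by (rule sub) (use s in auto)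
      show "vertex_decomposable E (away E V s)"
      proof (rule sub)
        show "away E V s \<subseteq> V - {s}" by (auto simp: away_def)
        fix t l assume t: "t \<in> S \<inter> away E V s" and l: "l \<in> V - S" "E t l" "\<forall>v\<in>V. E l v \<longrightarrow> v = t"
        have "l \<noteq> s" using l s by blast
        moreover have "\<not> E s l"
        proof
          assume "E s l"
          then have "s = t" using l(3) s(2) sym[of s l] by blast
          then show False using t by (auto simp: away_def)
        qed
        ultimately show "l \<in> away E V s" using l by (simp add: away_def)
      qed
    qed
  qed
qed

definition simplicial :: "'v set \<Rightarrow> 'v \<Rightarrow> bool" where
  "simplicial V y \<longleftrightarrow> y \<in> V \<and> (\<forall>a\<in>V. \<forall>b\<in>V. E y a \<longrightarrow> E y b \<longrightarrow> a \<noteq> b \<longrightarrow> E a b)"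

text \<open>A neighbour of a simplicial vertex dominates it.  The simplicial vertex is chosen among the vertices that are not
isolated, so that it has a neighbour.\<close>

lemma hered_shedding_if_simplicial:
  assumes "\<And>W. W \<subseteq> V \<Longrightarrow> W \<noteq> {} \<Longrightarrow> \<exists>y. simplicial W y"
  shows "hered_shedding E V"
  unfolding hered_shedding_def
proof (intro allI impI)
  fix W assume W: "W \<subseteq> V" "\<not> indep E W"
  let ?N = "{u \<in> W. \<exists>v\<in>W. E u v}"
  have "?N \<noteq> {}" "?N \<subseteq> V" using W by (auto simp: indep_def)
  then obtain y where y: "simplicial ?N y" using assms by blast
  then have "y \<in> ?N" by (simp only: simplicial_def)
  then obtain x where x: "x \<in> W" "E y x" and yW: "y \<in> W" by blast
  have xN: "x \<in> ?N" using x yW sym[OF x(2)] by blast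
  have "shedding E W x"
  proof (rule shedding_if_dominated[OF x(1) yW])
    show "E x y" by (rule sym[OF x(2)])
    fix z assume z: "z \<in> W" "E y z"
    then have "z \<in> ?N" using yW sym[OF z(2)] by blast
    then show "z = x \<or> E x z" using y xN x(2) z(2) unfolding simplicial_def by blast
  qed
  then show "\<exists>x. shedding E W x" by blast
qed

text \<open>Chordality of the subgraph induced by \<open>V\<close>, with cycles as closed walks of vertices and with positions \<open>i < j\<close>
for the ends of a chord.\<close>

definition chordal_on :: "'v set \<Rightarrow> bool" where
  "chordal_on V \<longleftrightarrow> (\<forall>c. 4 \<le> length c \<longrightarrow> distinct c \<longrightarrow> set c \<subseteq> V \<longrightarrow>
     (\<forall>i. Suc i < length c \<longrightarrow> E (c ! i) (c ! Suc i)) \<longrightarrow> E (last c) (hd c) \<longrightarrow>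
     (\<exists>i j. i < j \<and> j < length c \<and> j \<noteq> Suc i \<and> \<not> (i = 0 \<and> Suc j = length c) \<and> E (c ! i) (c ! j)))"

lemma chordal_on_subset: "chordal_on V \<Longrightarrow> W \<subseteq> V \<Longrightarrow> chordal_on W"
  unfolding chordal_on_def by (meson subset_trans)

definition walk :: "'v list \<Rightarrow> bool" where
  "walk p \<longleftrightarrow> (\<forall>i. Suc i < length p \<longrightarrow> E (p ! i) (p ! Suc i))"

definition joins :: "'v set \<Rightarrow> 'v \<Rightarrow> 'v \<Rightarrow> 'v list \<Rightarrow> bool" where
  "joins C a b p \<longleftrightarrow> p \<noteq> [] \<and> hd p = a \<and> last p = b \<and> walk p \<and> set p \<subseteq> insert a (insert b C)"

text \<open>A walk of minimal length has no repeated vertex and no chord: otherwise the part between the two positions can be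
cut out.\<close>

lemma shortcut:
  assumes p: "joins C a b p" and ij: "i < j" "j < length p" and e: "p ! i = p ! j \<or> (E (p ! i) (p ! j) \<and> j \<noteq> Suc i)"
  shows "\<exists>q. joins C a b q \<and> length q < length p"
proof -
  have w: "E (p ! k) (p ! Suc k)" if "Suc k < length p" for k
    using p that by (simp add: joins_def walk_def)
  have pp: "hd p = a" "last p = b" "set p \<subseteq> insert a (insert b C)" using p by (simp_all add: joins_def)
  show ?thesis
  proof (cases "p ! i = p ! j")
    case True
    let ?q = "take i p @ drop j p"
    have len: "length ?q < length p" using ij by simp
    have ne: "drop j p \<noteq> []" using ij by simp
    have hd_q: "hd ?q = hd p"
    proof (cases i)
      case 0
      have "p \<noteq> []" using ij by auto
      then show ?thesis using True ij 0 by (simp add: hd_drop_conv_nth hd_conv_nth[of p])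
    next
      case (Suc k)
      then show ?thesis using ij by (cases p) auto
    qed
    have last_q: "last ?q = last p" using ij ne by (simp add: last_append last_drop)
    have nth_q: "?q ! k = (if k < i then p ! k else p ! (k - i + j))" if "k < length ?q" for k
      using that ij by (auto simp: nth_append min_def ac_simps)
    have "walk ?q"
      unfolding walk_def
    proof (intro allI impI)
      fix k assume k: "Suc k < length ?q"
      consider "Suc k < i" | "Suc k = i" | "i \<le> k" by linarith
      then show "E (?q ! k) (?q ! Suc k)"
      proof cases
        case 1
        then show ?thesis using k nth_q[of k] nth_q[of "Suc k"] w[of k] ij by simp
      next
        case 2
        have "E (p ! k) (p ! Suc k)" by (rule w) (use ij 2 in simp)
        then have "E (p ! k) (p ! j)" using True 2 by simp
        then show ?thesis using k nth_q[of k] nth_q[of "Suc k"] 2 by simp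
      next
        case 3
        then have "Suc k - i + j = Suc (k - i + j)" by simp
        moreover have "Suc (k - i + j) < length p" using k 3 ij by simp
        then have "E (p ! (k - i + j)) (p ! Suc (k - i + j))" by (rule w)
        ultimately show ?thesis using k nth_q[of k] nth_q[of "Suc k"] 3 by simp
      qed
    qed
    moreover have "set ?q \<subseteq> set p" using set_take_subset[of i p] set_drop_subset[of j p] by auto
    ultimately have "joins C a b ?q" using pp ne hd_q last_q unfolding joins_def by auto
    then show ?thesis using len by blast
  next
    case False
    then have e: "E (p ! i) (p ! j)" "j \<noteq> Suc i" using assms(4) by auto
    let ?q = "take (Suc i) p @ drop j p"
    have len: "length ?q < length p" using ij e(2) by simp
    have ne: "drop j p \<noteq> []" using ij by simp
    have hd_q: "hd ?q = hd p" using ij by (cases p) auto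
    have last_q: "last ?q = last p" using ij ne by (simp add: last_append last_drop)
    have nth_q: "?q ! k = (if k \<le> i then p ! k else p ! (k - Suc i + j))" if "k < length ?q" for k
      using that ij by (auto simp: nth_append min_def ac_simps)
    have "walk ?q"
      unfolding walk_def
    proof (intro allI impI)
      fix k assume k: "Suc k < length ?q"
      consider "Suc k \<le> i" | "k = i" | "Suc i \<le> k" by linarith
      then show "E (?q ! k) (?q ! Suc k)"
      proof cases
        case 1
        then show ?thesis using k nth_q[of k] nth_q[of "Suc k"] w[of k] ij by simp
      next
        case 2
        then show ?thesis using k nth_q[of k] nth_q[of "Suc k"] e by simp
      next
        case 3
        then have "Suc k - Suc i + j = Suc (k - Suc i + j)" by simp
        moreover have "Suc (k - Suc i + j) < length p" using k 3 ij by simp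
        then have "E (p ! (k - Suc i + j)) (p ! Suc (k - Suc i + j))" by (rule w)
        ultimately show ?thesis using k nth_q[of k] nth_q[of "Suc k"] 3 by simp
      qed
    qed
    moreover have "set ?q \<subseteq> set p" using set_take_subset[of "Suc i" p] set_drop_subset[of j p] by auto
    ultimately have "joins C a b ?q" using pp ne hd_q last_q unfolding joins_def by auto
    then show ?thesis using len by blast
  qed
qed

text \<open>A shortest walk from \<open>a\<close> to \<open>b\<close> through \<open>C\<close>, closed by way of \<open>x\<close>, is a cycle.  It has at least four vertices if \<open>a\<close> and
\<open>b\<close> are not adjacent, and then it has no chord: there is none within a shortest walk, and \<open>x\<close> has no neighbours in \<open>C\<close>.\<close>

lemma separator_clique:
  assumes ch: "chordal_on V" and C: "C \<subseteq> V" "\<And>c. c \<in> C \<Longrightarrow> c \<noteq> x \<and> \<not> E x c"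
    and x: "x \<in> V" and ab: "a \<in> V" "b \<in> V" "E x a" "E x b" "a \<noteq> b"
    and p: "joins C a b p"
  shows "E a b"
proof (rule ccontr)
  assume nab: "\<not> E a b"
  obtain q where q: "joins C a b q" and min: "\<And>r. joins C a b r \<Longrightarrow> length q \<le> length r"
    using ex_has_least_nat[of "joins C a b" p length] p by blast
  have noshort: "\<not> (q ! i = q ! j \<or> (E (q ! i) (q ! j) \<and> j \<noteq> Suc i))" if "i < j" "j < length q" for i j
    using shortcut[OF q that] min by (meson leD)
  have hd: "q ! 0 = a" and last: "q ! (length q - 1) = b" and ne: "q \<noteq> []"
    using q by (auto simp: joins_def hd_conv_nth last_conv_nth)
  have len: "3 \<le> length q"
  proof (rule ccontr)
    assume "\<not> 3 \<le> length q"
    moreover have "length q \<noteq> 0" using ne by simp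
    ultimately consider "length q = 1" | "length q = 2" by linarith
    then show False
    proof cases
      case 1
      then show ?thesis using hd last ab by simp
    next
      case 2
      then have "E (q ! 0) (q ! Suc 0)" using q by (simp add: joins_def walk_def)
      then show ?thesis using hd last 2 nab by simp
    qed
  qed
  have distinct_q: "distinct q"
    unfolding distinct_conv_nth using noshort by (metis linorder_neqE_nat)
  have inner: "q ! i \<in> C" if "0 < i" "i < length q - 1" for i
  proof -
    have iq: "i < length q" "length q - 1 < length q" using that by simp_all
    have "q ! i \<in> set q" using iq by simp
    moreover have "q ! i \<noteq> a" using noshort[OF that(1) iq(1)] hd by force
    moreover have "q ! i \<noteq> b" using noshort[OF that(2) iq(2)] last by force
    ultimately show ?thesis using q by (auto simp: joins_def)
  qed
  have "x \<noteq> a" "x \<noteq> b" using ab irrefl by auto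
  then have "x \<notin> insert a (insert b C)" using C(2) by blast
  then have xq: "x \<notin> set q" using q unfolding joins_def by blast
  let ?c = "x # q"
  have "\<exists>i j. i < j \<and> j < length ?c \<and> j \<noteq> Suc i \<and> \<not> (i = 0 \<and> Suc j = length ?c) \<and> E (?c ! i) (?c ! j)"
  proof (rule ch[unfolded chordal_on_def, rule_format])
    show "4 \<le> length ?c" using len by simp
    show "distinct ?c" using distinct_q xq by simp
    show "set ?c \<subseteq> V" using q x ab C(1) by (auto simp: joins_def)
    show "E (List.last ?c) (List.hd ?c)" using q ne ab sym by (auto simp: joins_def)
    fix i assume "Suc i < length ?c"
    then show "E (?c ! i) (?c ! Suc i)" using hd ab q by (cases i) (auto simp: joins_def walk_def)
  qed
  then obtain i j where ij: "i < j" "j < length ?c" "j \<noteq> Suc i" "\<not> (i = 0 \<and> Suc j = length ?c)"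
    "E (?c ! i) (?c ! j)" by blast
  show False
  proof (cases i)
    case 0
    then have "q ! (j - 1) \<in> C" using ij by (intro inner) auto
    moreover have "E x (q ! (j - 1))" using ij 0 by simp
    ultimately show False using C(2) by blast
  next
    case (Suc k)
    then have "E (q ! k) (q ! (j - 1))" "k < j - 1" "j - 1 < length q" "j - 1 \<noteq> Suc k" using ij by auto
    then show False using noshort[of k "j - 1"] by blast
  qed
qed

lemma walk_rev:
  assumes "walk p" shows "walk (rev p)"
  unfolding walk_def
proof (intro allI impI)
  fix i assume i: "Suc i < length (rev p)"
  then have "E (p ! (length p - Suc (Suc i))) (p ! Suc (length p - Suc (Suc i)))"
    using assms unfolding walk_def by simp
  moreover have "Suc (length p - Suc (Suc i)) = length p - Suc i" using i by simp
  ultimately have "E (p ! (length p - Suc i)) (p ! (length p - Suc (Suc i)))" using sym by simp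
  then show "E (rev p ! i) (rev p ! Suc i)" using i by (simp add: rev_nth)
qed

lemma walk_append:
  assumes "walk p" "walk q" "p \<noteq> []" "q \<noteq> []" "E (last p) (hd q)"
  shows "walk (p @ q)"
  unfolding walk_def
proof (intro allI impI)
  fix i assume i: "Suc i < length (p @ q)"
  consider "Suc i < length p" | "Suc i = length p" | "length p \<le> i" by linarith
  then show "E ((p @ q) ! i) ((p @ q) ! Suc i)"
  proof cases
    case 1
    then show ?thesis using assms(1) by (simp add: walk_def nth_append)
  next
    case 2
    then have "i = length p - 1" by simp
    then show ?thesis using assms 2 by (simp add: nth_append last_conv_nth hd_conv_nth)
  next
    case 3
    then show ?thesis using assms(2) i by (simp add: walk_def nth_append Suc_diff_le)
  qed
qed

lemma walk_snoc: "walk p \<Longrightarrow> p \<noteq> [] \<Longrightarrow> E (last p) v \<Longrightarrow> walk (p @ [v])"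
  by (rule walk_append) (simp_all add: walk_def)

lemma walk_Cons: "walk p \<Longrightarrow> p \<noteq> [] \<Longrightarrow> E v (hd p) \<Longrightarrow> walk (v # p)"
  using walk_append[of "[v]" p] by (simp add: walk_def)

lemma walk_ConsD:
  assumes "walk (v # p)"
  shows "walk p" "p \<noteq> [] \<Longrightarrow> E v (hd p)"
proof -
  have *: "E ((v # p) ! i) ((v # p) ! Suc i)" if "Suc i < length (v # p)" for i
    using assms that by (simp only: walk_def)
  show "walk p" unfolding walk_def using *[of "Suc _"] by simp
  show "p \<noteq> [] \<Longrightarrow> E v (hd p)" using *[of 0] by (simp add: hd_conv_nth)
qed

text \<open>A form of Dirac's theorem that is suited to induction.  Let \<open>C\<close> be a component of the graph outside the
closed neighbourhood of \<open>x\<close>, and \<open>T\<close> the set of the neighbours of \<open>x\<close> that are adjacent to \<open>C\<close>.  By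
\<open>separator_clique\<close>, \<open>T\<close> is a clique.  A vertex of \<open>C\<close> is simplicial in the whole graph if it is so in the smaller
graph on \<open>C \<union> T\<close>.  If that graph is not complete, the induction hypothesis applied to a suitable vertex of it gives a
simplicial vertex not adjacent to that vertex, which then has to lie in \<open>C\<close>.\<close>

lemma exists_simplicial_off:
  "finite V \<Longrightarrow> chordal_on V \<Longrightarrow> x \<in> V \<Longrightarrow> away E V x \<noteq> {} \<Longrightarrow>
    \<exists>y \<in> away E V x. simplicial V y"
proof (induction "card V" arbitrary: V x rule: less_induct)
  case less
  note fin = less.prems(1) and ch = less.prems(2) and x = less.prems(3)
  obtain c0 where c0: "c0 \<in> away E V x" using less.prems(4) by blast
  \<comment> \<open>The component \<open>C\<close> of \<open>c0\<close> is described by reachability.\<close>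
  let ?r = "{(u, v). u \<in> away E V x \<and> v \<in> away E V x \<and> E u v}"
  define C where "C = {c. (c0, c) \<in> ?r\<^sup>*}"
  have c0C: "c0 \<in> C" by (simp add: C_def)
  have Caway: "c \<in> away E V x" if "c \<in> C" for c
    using that[unfolded C_def mem_Collect_eq] by (induction rule: rtrancl_induct) (use c0 in auto)
  have Cclosed: "v \<in> C" if "c \<in> C" "v \<in> away E V x" "E c v" for c v
  proof -
    have "(c, v) \<in> ?r" using that Caway by blast
    then show ?thesis using that(1) unfolding C_def by (simp add: rtrancl_into_rtrancl)
  qed
  have "\<exists>p. p \<noteq> [] \<and> hd p = c0 \<and> last p = c \<and> walk p \<and> set p \<subseteq> C" if "c \<in> C" for c
    using that[unfolded C_def mem_Collect_eq]
  proof (induction rule: rtrancl_induct)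
    case base
    show ?case by (rule exI[of _ "[c0]"]) (simp add: walk_def c0C)
  next
    case (step c d)
    then obtain p where p: "p \<noteq> []" "hd p = c0" "last p = c" "walk p" "set p \<subseteq> C" by blast
    have "d \<in> C" using step(1,2) unfolding C_def by (simp add: rtrancl_into_rtrancl)
    then show ?case using p step(2) by (intro exI[of _ "p @ [d]"]) (auto intro: walk_snoc)
  qed
  then have from0: "\<exists>p. p \<noteq> [] \<and> hd p = c0 \<and> last p = c \<and> walk p \<and> set p \<subseteq> C" if "c \<in> C" for c
    using that by blast
  have between: "\<exists>p. joins C a b p" if cd: "c \<in> C" "d \<in> C" "E a c" "E d b" for a b c d
  proof -
    obtain p where p: "p \<noteq> []" "hd p = c0" "last p = c" "walk p" "set p \<subseteq> C" using from0[OF cd(1)] by blast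
    obtain q where q: "q \<noteq> []" "hd q = c0" "last q = d" "walk q" "set q \<subseteq> C" using from0[OF cd(2)] by blast
    obtain q' where q': "q = c0 # q'" using q(1,2) by (cases q) auto
    have pq: "walk (rev p @ q')"
    proof (cases "q' = []")
      case True
      then show ?thesis using walk_rev[OF p(4)] by simp
    next
      case False
      have "E c0 (hd q')" "walk q'" using walk_ConsD q(4) False unfolding q' by auto
      then show ?thesis using walk_rev[OF p(4)] p(1,2) False by (intro walk_append) (auto simp: last_rev)
    qed
    have hd: "hd (rev p @ q') = c" using p(1,3) by (simp add: hd_rev)
    have last: "last (rev p @ q') = d"
      using p(1,2) q(3) unfolding q' by (auto simp: last_rev last_append)
    have ne: "rev p @ q' \<noteq> []" using p(1) by simp
    have "walk (a # (rev p @ q'))" by (rule walk_Cons[OF pq ne]) (use hd cd(3) in simp)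
    then have "walk ((a # (rev p @ q')) @ [b])"
      by (rule walk_snoc) (use last ne cd(4) in auto)
    then have "joins C a b ((a # (rev p @ q')) @ [b])"
      using p(5) q(5) unfolding q' joins_def by auto
    then show ?thesis by blast
  qed
  define T where "T = {s \<in> V. E x s \<and> (\<exists>c\<in>C. E c s)}"
  have CV: "C \<subseteq> V" using Caway by (auto simp: away_def)
  have clique: "E a b" if a: "a \<in> T" and b: "b \<in> T" and ab: "a \<noteq> b" for a b
  proof -
    obtain c d where cd: "c \<in> C" "E c a" "d \<in> C" "E d b" using a b by (auto simp: T_def)
    obtain p where p: "joins C a b p" using between[OF cd(1,3) sym[OF cd(2)] cd(4)] by blast
    show ?thesis
      by (rule separator_clique[OF ch CV _ x _ _ _ _ ab p])
        (use a b Caway in \<open>auto simp: T_def away_def\<close>)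
  qed
  let ?H = "C \<union> T"
  have HV: "?H \<subseteq> V" using CV by (auto simp: T_def)
  have "x \<notin> ?H" using Caway irrefl by (auto simp: T_def away_def)
  then have "?H \<subset> V" using HV x by blast
  then have card: "card ?H < card V" by (rule psubset_card_mono[OF fin])
  have finH: "finite ?H" by (rule finite_subset[OF HV fin])
  have chH: "chordal_on ?H" by (rule chordal_on_subset[OF ch HV])
  have nbrs: "v \<in> ?H" if "c \<in> C" "v \<in> V" "E c v" for c v
  proof (cases "v \<in> away E V x")
    case True
    then show ?thesis using Cclosed that by blast
  next
    case False
    have "v \<noteq> x" using Caway[OF that(1)] sym[OF that(3)] by (auto simp: away_def)
    then have "E x v" using False that by (simp add: away_def)
    then show ?thesis using that by (auto simp: T_def)
  qed
  have lift: "simplicial V z" if "z \<in> C" "simplicial ?H z" for z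
    unfolding simplicial_def
  proof (intro conjI ballI impI)
    show "z \<in> V" using that(1) CV by blast
    fix a b assume "a \<in> V" "b \<in> V" "E z a" "E z b" "a \<noteq> b"
    then show "E a b" using that(2) nbrs[OF that(1)] unfolding simplicial_def by blast
  qed
  have "\<exists>z\<in>C. simplicial ?H z"
  proof (cases "\<exists>s\<in>T. away E ?H s \<noteq> {}")
    case True
    then obtain s where s: "s \<in> T" "away E ?H s \<noteq> {}" by blast
    then obtain z where z: "z \<in> away E ?H s" "simplicial ?H z"
      using less.hyps[OF card finH chH, of s] by blast
    have "z \<notin> T" using z(1) clique[OF s(1), of z] by (auto simp: away_def)
    then show ?thesis using z by (auto simp: away_def)
  next
    case noT: False
    show ?thesis
    proof (cases "\<exists>c\<in>C. away E ?H c \<noteq> {}")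
      case True
      then obtain c where c: "c \<in> C" "away E ?H c \<noteq> {}" by blast
      then obtain z where z: "z \<in> away E ?H c" "simplicial ?H z"
        using less.hyps[OF card finH chH, of c] by blast
      have "z \<notin> T"
      proof
        assume "z \<in> T"
        then have "away E ?H z = {}" using noT by blast
        then have "c = z \<or> E z c" using c(1) by (auto simp: away_def)
        then show False using z(1) sym[of z c] by (auto simp: away_def)
      qed
      then show ?thesis using z by (auto simp: away_def)
    next
      case False
      then have "away E ?H v = {}" if "v \<in> ?H" for v using noT that by blast
      then have "E a b" if "a \<in> ?H" "b \<in> ?H" "a \<noteq> b" for a b using that by (auto simp: away_def)
      then have "simplicial ?H c0" using c0C by (simp add: simplicial_def)
      then show ?thesis using c0C by blast
    qed
  qed
  then show ?case using lift Caway by blast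
qed

lemma exists_simplicial:
  assumes "finite V" "chordal_on V" "V \<noteq> {}"
  shows "\<exists>y. simplicial V y"
proof (cases "\<exists>x\<in>V. away E V x \<noteq> {}")
  case True
  then show ?thesis using exists_simplicial_off[OF assms(1,2)] by blast
next
  case False
  then have "E a b" if "a \<in> V" "b \<in> V" "a \<noteq> b" for a b using that by (auto simp: away_def)
  then show ?thesis using assms(3) unfolding simplicial_def by blast
qed

lemma hered_shedding_chordal:
  assumes "finite V" "chordal_on V"
  shows "hered_shedding E V"
proof (rule hered_shedding_if_simplicial)
  fix W assume W: "W \<subseteq> V" "W \<noteq> {}"
  have "chordal_on W" by (rule chordal_on_subset[OF assms(2) W(1)])
  then show "\<exists>y. simplicial W y"
    using exists_simplicial[OF finite_subset[OF W(1) assms(1)]] W(2) by blast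
qed

end

text \<open>Going backwards from two adjacent positions with property \<open>P\<close>, one comes to an end because \<open>P\<close> fails somewhere.\<close>

lemma cyclic_run_start:
  fixes P :: "nat \<Rightarrow> bool"
  assumes i: "i < 5" "P i" "P (Suc i mod 5)" and k: "k < 5" "\<not> P k"
  shows "\<exists>i<5. P i \<and> P (Suc i mod 5) \<and> \<not> P ((i + 4) mod 5)"
proof (rule ccontr)
  assume "\<not> ?thesis"
  then have *: "P (Suc i mod 5) \<Longrightarrow> P i \<Longrightarrow> P ((i + 4) mod 5)" if "i < 5" for i using that by blast
  have s: "P 1 \<Longrightarrow> P 0 \<Longrightarrow> P 4" "P 2 \<Longrightarrow> P 1 \<Longrightarrow> P 0" "P 3 \<Longrightarrow> P 2 \<Longrightarrow> P 1"
    "P 4 \<Longrightarrow> P 3 \<Longrightarrow> P 2" "P 0 \<Longrightarrow> P 4 \<Longrightarrow> P 3"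
    using *[of 0] *[of 1] *[of 2] *[of 3] *[of 4] by (simp_all add: numeral_2_eq_2[symmetric])
  have "i = 0 \<or> i = 1 \<or> i = 2 \<or> i = 3 \<or> i = 4" using i(1) by linarith
  then have "(P 0 \<and> P 1) \<or> (P 1 \<and> P 2) \<or> (P 2 \<and> P 3) \<or> (P 3 \<and> P 4) \<or> (P 4 \<and> P 0)"
    using i(2,3) by (elim disjE) (simp_all add: numeral_2_eq_2[symmetric])
  then have "P 0 \<and> P 1 \<and> P 2 \<and> P 3 \<and> P 4" using s by blast
  moreover have "k = 0 \<or> k = 1 \<or> k = 2 \<or> k = 3 \<or> k = 4" using k(1) by linarith
  ultimately show False using k(2) by blast
qed

text \<open>In the five-cycle, an independent set of the two vertices opposite to \<open>d ! 0\<close> has at most one element, and one of the two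
neighbours of \<open>d ! 0\<close> is not adjacent to it.  A proper subset of the vertices induces paths, and the second vertex of a
path dominates the first.\<close>

lemma (in sym_graph) hered_shedding_five_cycle:
  assumes d: "length d = 5" "distinct d"
    and adj: "\<And>i j. i < 5 \<Longrightarrow> j < 5 \<Longrightarrow> E (d ! i) (d ! j) \<longleftrightarrow> j = Suc i mod 5 \<or> i = Suc j mod 5"
  shows "hered_shedding E (set d)"
  unfolding hered_shedding_def
proof (intro allI impI)
  fix W assume W: "W \<subseteq> set d" "\<not> indep E W"
  have idx: "\<exists>i<5. u = d ! i" if "u \<in> W" for u
    using that W(1) d(1) by (metis in_set_conv_nth subsetD)
  show "\<exists>x. shedding E W x"
  proof (cases "W = set d")
    case True
    have mem: "d ! i \<in> W" if "i < 5" for i using True that d(1) by simp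
    have "shedding E W (d ! 0)"
      unfolding shedding_def
    proof (intro conjI allI impI)
      show "d ! 0 \<in> W" by (rule mem) simp
      fix F assume F: "F \<subseteq> away E W (d ! 0)" "indep E F"
      have F23: "f = d ! 2 \<or> f = d ! 3" if "f \<in> F" for f
      proof -
        have f: "f \<in> W" "f \<noteq> d ! 0" "\<not> E (d ! 0) f" using F(1) that by (auto simp: away_def)
        obtain i where i: "i < 5" "f = d ! i" using idx[OF f(1)] by blast
        have "i \<noteq> 0" using f(2) i(2) by metis
        moreover have "i \<noteq> 1" "i \<noteq> 4" using f(3) adj[of 0 i] i by auto
        ultimately have "i = 2 \<or> i = 3" using i(1) by linarith
        then show ?thesis using i(2) by blast
      qed
      show "\<exists>y\<in>W. E (d ! 0) y \<and> (\<forall>f\<in>F. \<not> E y f)"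
      proof (cases "d ! 2 \<in> F")
        case True
        have "E (d ! 2) (d ! 3)" using adj[of 2 3] by simp
        then have "d ! 3 \<notin> F" using F(2) True by (auto simp: indep_def)
        then have "\<forall>f\<in>F. \<not> E (d ! 4) f" using F23 adj[of 4 2] by auto
        moreover have "E (d ! 0) (d ! 4)" using adj[of 0 4] by simp
        ultimately show ?thesis using mem[of 4] by auto
      next
        case False
        then have "\<forall>f\<in>F. \<not> E (d ! 1) f" using F23 adj[of 1 3] by auto
        moreover have "E (d ! 0) (d ! 1)" using adj[of 0 1] by simp
        ultimately show ?thesis using mem[of 1] by auto
      qed
    qed
    then show ?thesis by blast
  next
    case False
    let ?P = "\<lambda>i. d ! i \<in> W"
    obtain u v where uv: "u \<in> W" "v \<in> W" "E u v" using W(2) by (auto simp: indep_def)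
    obtain i where i: "i < 5" "u = d ! i" using idx[OF uv(1)] by blast
    obtain j where j: "j < 5" "v = d ! j" using idx[OF uv(2)] by blast
    have "j = Suc i mod 5 \<or> i = Suc j mod 5" using adj[OF i(1) j(1)] uv(3) i(2) j(2) by simp
    then have "\<exists>i<5. ?P i \<and> ?P (Suc i mod 5)" using i j uv by blast
    moreover have "\<exists>k<5. \<not> ?P k"
      using False W(1) d(1) by (metis in_set_conv_nth subsetI subset_antisym)
    ultimately obtain i where i: "i < 5" "?P i" "?P (Suc i mod 5)" "\<not> ?P ((i + 4) mod 5)"
      using cyclic_run_start[of _ ?P] by blast
    have "shedding E W (d ! (Suc i mod 5))"
    proof (rule shedding_if_dominated[OF i(3,2)])
      have "Suc i mod 5 < 5" by simp
      then show "E (d ! (Suc i mod 5)) (d ! i)" using adj[of "Suc i mod 5" i] i(1) by simp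
      fix z assume z: "z \<in> W" "E (d ! i) z"
      obtain k where k: "k < 5" "z = d ! k" using idx[OF z(1)] by blast
      have "k = Suc i mod 5 \<or> i = Suc k mod 5" using adj[OF i(1) k(1)] z(2) k(2) by simp
      moreover have "i \<noteq> Suc k mod 5"
      proof
        assume "i = Suc k mod 5"
        then have "(i + 4) mod 5 = (Suc k + 4) mod 5" by (simp add: mod_add_left_eq)
        then have "(i + 4) mod 5 = k" using k(1) by simp
        then show False using i(4) z(1) k(2) by simp
      qed
      ultimately show "z = d ! (Suc i mod 5) \<or> E (d ! (Suc i mod 5)) z" using k(2) by blast
    qed
    then show ?thesis by blast
  qed
qed

section \<open>Whiskered graphs\<close>

definition adj :: "'v graph \<Rightarrow> 'v \<Rightarrow> 'v \<Rightarrow> bool" where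
  "adj G u v \<longleftrightarrow> {u, v} \<in> edges G"

lemma sym_graph_adj: "simple_graph G \<Longrightarrow> sym_graph (adj G)"
  by unfold_locales (auto simp: adj_def simple_graph_def insert_commute)

lemma simple_add_whiskers:
  assumes "simple_graph G" "S \<subseteq> verts G"
  shows "simple_graph (add_whiskers G S)"
  unfolding simple_graph_def
proof (intro conjI ballI)
  have fin: "finite (verts G)" using assms(1) by (simp add: simple_graph_def)
  then show "finite (verts (add_whiskers G S))"
    using finite_subset[OF assms(2)] by (simp add: add_whiskers_def)
  fix e assume "e \<in> edges (add_whiskers G S)"
  then consider e' where "e' \<in> edges G" "e = Inl ` e'" | y where "y \<in> S" "e = {Inr y, Inl y}"
    by (auto simp: add_whiskers_def)
  then show "\<exists>u v. u \<in> verts (add_whiskers G S) \<and> v \<in> verts (add_whiskers G S) \<and> u \<noteq> v \<and> e = {u, v}"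
  proof cases
    case 1
    then obtain u v where "u \<in> verts G" "v \<in> verts G" "u \<noteq> v" "e' = {u, v}"
      using assms(1) by (auto simp: simple_graph_def)
    then show ?thesis using 1 by (intro exI[of _ "Inl u"] exI[of _ "Inl v"]) (simp add: add_whiskers_def)
  next
    case 2
    then show ?thesis using assms(2)
      by (intro exI[of _ "Inr y"] exI[of _ "Inl y"]) (auto simp: add_whiskers_def)
  qed
qed

lemma adj_whiskers_Inl: "adj (add_whiskers G S) (Inl a) (Inl b) \<longleftrightarrow> adj G a b"
proof -
  have "{Inl a, Inl b} = Inl ` {a, b}" by simp
  then have 1: "({Inl a, Inl b} :: ('a + 'a) set) = Inl ` e \<longleftrightarrow> {a, b} = e" for e
    by (metis inj_Inl inj_image_eq_iff)
  have 2: "({Inl a, Inl b} :: ('a + 'a) set) \<noteq> {Inr y, Inl y}" for y by auto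
  show ?thesis unfolding adj_def add_whiskers_def graph.simps Un_iff image_iff 1 using 2 by blast
qed

lemma adj_whiskers_Inr: "adj (add_whiskers G S) (Inr y) v \<longleftrightarrow> y \<in> S \<and> v = Inl y"
proof -
  have 1: "{Inr y, v} \<noteq> Inl ` e" for e by blast
  have 2: "{Inr y, v} = {Inr z, Inl z} \<longleftrightarrow> z = y \<and> v = Inl y" for z by (auto simp: doubleton_eq_iff)
  show ?thesis unfolding adj_def add_whiskers_def graph.simps Un_iff image_iff 2 using 1 by blast
qed

text \<open>A cycle among the vertices embedded by \<open>Inl\<close> is the image of a cycle of the original graph.\<close>

lemma chordal_on_whiskers:
  assumes G: "simple_graph G" and S: "S \<subseteq> verts G" and ch: "chordal (delete_verts G S)"
  shows "sym_graph.chordal_on (adj (add_whiskers G S)) (Inl ` (verts G - S))"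
proof -
  interpret sym_graph "adj (add_whiskers G S)" by (rule sym_graph_adj[OF simple_add_whiskers[OF G S]])
  show ?thesis
    unfolding chordal_on_def
  proof (intro allI impI)
    fix c assume c: "4 \<le> length c" "distinct c" "set c \<subseteq> Inl ` (verts G - S)"
      "\<forall>i. Suc i < length c \<longrightarrow> adj (add_whiskers G S) (c ! i) (c ! Suc i)"
      "adj (add_whiskers G S) (last c) (hd c)"
    define d where "d = map projl c"
    have cd: "c = map Inl d" unfolding d_def using c(3) by (auto intro!: map_idI[symmetric])
    have len: "length d = length c" by (simp add: d_def)
    have dV: "set d \<subseteq> verts G - S" using c(3) unfolding cd by auto
    have edge: "{d ! i, d ! j} \<in> edges (delete_verts G S)"
      if "adj G (d ! i) (d ! j)" "i < length d" "j < length d" for i j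
    proof -
      have "d ! i \<in> verts G - S" "d ! j \<in> verts G - S" using that dV nth_mem by blast+
      then show ?thesis using that(1) by (simp add: delete_verts_def adj_def)
    qed
    have "is_cycle_in (delete_verts G S) d"
      unfolding is_cycle_in_def
    proof (intro conjI)
      show "3 \<le> length d" using c(1) len by simp
      show "distinct d" using c(2) unfolding cd by (simp add: distinct_map)
      show "set d \<subseteq> verts (delete_verts G S)" using dV by (simp add: delete_verts_def)
      show "cycle_edges d \<subseteq> edges (delete_verts G S)"
        unfolding cycle_edges_def
      proof clarify
        fix i assume i: "i < length d"
        show "{d ! i, d ! (Suc i mod length d)} \<in> edges (delete_verts G S)"
        proof (cases "Suc i = length d")
          case True
          have "c \<noteq> []" "d \<noteq> []" using i len by auto
          moreover have "i = length d - 1" using True by simp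
          ultimately have "last c = Inl (d ! i)" "hd c = Inl (d ! 0)"
            by (simp_all add: cd last_map hd_map last_conv_nth hd_conv_nth)
          then have "adj G (d ! i) (d ! 0)" using c(5) by (simp add: adj_whiskers_Inl)
          then show ?thesis using edge[of i 0] i True by (cases "length d") auto
        next
          case False
          then have "Suc i < length d" using i by simp
          then have "adj G (d ! i) (d ! Suc i)" using c(4) by (simp add: cd adj_whiskers_Inl)
          then show ?thesis using edge[of i "Suc i"] i \<open>Suc i < length d\<close> by simp
        qed
      qed
    qed
    then have "has_chord (delete_verts G S) d" using ch c(1) len by (simp add: chordal_def)
    then obtain i j where ij: "i < length d" "j < length d" "i \<noteq> j" "j \<noteq> Suc i mod length d"
      "i \<noteq> Suc j mod length d" "{d ! i, d ! j} \<in> edges (delete_verts G S)"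
      unfolding has_chord_def by blast
    have chord: "\<exists>i j. i < j \<and> j < length c \<and> j \<noteq> Suc i \<and> \<not> (i = 0 \<and> Suc j = length c) \<and>
          adj (add_whiskers G S) (c ! i) (c ! j)"
      if ij: "i < j" "j < length d" "j \<noteq> Suc i mod length d" "i \<noteq> Suc j mod length d" "adj G (d ! i) (d ! j)" for i j
    proof -
      have "j \<noteq> Suc i" using ij by auto
      moreover have "\<not> (i = 0 \<and> Suc j = length c)" using ij(4) len by auto
      moreover have "adj (add_whiskers G S) (c ! i) (c ! j)" using ij by (simp add: cd adj_whiskers_Inl)
      ultimately show ?thesis using ij(1,2) len by auto
    qed
    have "adj G (d ! i) (d ! j)" "adj G (d ! j) (d ! i)"
      using ij(6) by (auto simp: adj_def delete_verts_def insert_commute)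
    then show "\<exists>i j. i < j \<and> j < length c \<and> j \<noteq> Suc i \<and> \<not> (i = 0 \<and> Suc j = length c) \<and>
          adj (add_whiskers G S) (c ! i) (c ! j)"
      using chord[of i j] chord[of j i] ij(1-5) by (cases i j rule: linorder_cases) blast+
  qed
qed

lemma vertex_decomposable_add_whiskers:
  assumes G: "simple_graph G" and S: "S \<subseteq> verts G"
    and T: "chordal (delete_verts G S) \<or> is_cycle_graph 5 (delete_verts G S)"
  shows "vertex_decomposable (adj (add_whiskers G S)) (verts (add_whiskers G S))"
proof -
  let ?E = "adj (add_whiskers G S)" and ?T = "Inl ` (verts G - S) :: ('a + 'a) set"
  interpret sym_graph ?E by (rule sym_graph_adj[OF simple_add_whiskers[OF G S]])
  have fin: "finite (verts G)" using G by (simp add: simple_graph_def)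
  have verts_eq: "verts (add_whiskers G S) = Inl ` verts G \<union> Inr ` S" by (simp add: add_whiskers_def)
  have T': "hered_shedding ?E ?T"
    using T
  proof
    assume "chordal (delete_verts G S)"
    then show ?thesis using fin chordal_on_whiskers[OF G S] by (intro hered_shedding_chordal) auto
  next
    assume "is_cycle_graph 5 (delete_verts G S)"
    then obtain c where c: "length c = 5" "distinct c" "verts G - S = set c"
      "edges (delete_verts G S) = cycle_edges c"
      by (auto simp: is_cycle_graph_def delete_verts_def)
    have "hered_shedding ?E (set (map Inl c))"
    proof (rule hered_shedding_five_cycle)
      show "length (map Inl c) = 5" using c(1) by simp
      show "distinct (map Inl c)" using c(2) by (simp add: distinct_map)
      fix i j :: nat assume ij: "i < 5" "j < 5"
      have "c ! i \<in> verts G - S" "c ! j \<in> verts G - S" using c(1,3) ij by auto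
      then have "adj G (c ! i) (c ! j) \<longleftrightarrow> {c ! i, c ! j} \<in> edges (delete_verts G S)"
        by (simp add: adj_def delete_verts_def)
      moreover have "?E (map Inl c ! i) (map Inl c ! j) \<longleftrightarrow> adj G (c ! i) (c ! j)"
        using ij c(1) by (simp add: adj_whiskers_Inl)
      ultimately have "?E (map Inl c ! i) (map Inl c ! j) \<longleftrightarrow> {c ! i, c ! j} \<in> edges (delete_verts G S)"
        by simp
      also have "\<dots> \<longleftrightarrow> (\<exists>k<5. {c ! i, c ! j} = {c ! k, c ! (Suc k mod 5)})"
        unfolding c(4) cycle_edges_def using c(1) by auto
      also have "\<dots> \<longleftrightarrow> (\<exists>k<5. i = k \<and> j = Suc k mod 5 \<or> i = Suc k mod 5 \<and> j = k)"
      proof -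
        have "{c ! i, c ! j} = {c ! k, c ! (Suc k mod 5)} \<longleftrightarrow>
            i = k \<and> j = Suc k mod 5 \<or> i = Suc k mod 5 \<and> j = k" if "k < 5" for k
        proof -
          have "Suc k mod 5 < 5" by simp
          then show ?thesis
            unfolding doubleton_eq_iff using ij that c(1) nth_eq_iff_index_eq[OF c(2)] by simp
        qed
        then show ?thesis by blast
      qed
      also have "\<dots> \<longleftrightarrow> j = Suc i mod 5 \<or> i = Suc j mod 5" using ij by blast
      finally show "?E (map Inl c ! i) (map Inl c ! j) \<longleftrightarrow> j = Suc i mod 5 \<or> i = Suc j mod 5" .
    qed
    then show ?thesis using c(3) by simp
  qed
  have T'': "hered_shedding ?E (?T \<union> Inr ` S)"
  proof (rule hered_shedding_isolated[OF T'])
    fix u v :: "'a + 'a" assume "u \<in> Inr ` S" "v \<in> ?T \<union> Inr ` S"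
    then show "\<not> ?E u v" by (auto simp: adj_whiskers_Inr)
  qed
  show ?thesis
  proof (rule vertex_decomposable_if_leaves[where S = "Inl ` S"])
    show "finite (verts (add_whiskers G S))" using fin finite_subset[OF S] by (simp add: verts_eq)
    have "verts (add_whiskers G S) - Inl ` S = ?T \<union> Inr ` S" unfolding verts_eq by auto
    then show "hered_shedding ?E (verts (add_whiskers G S) - Inl ` S)" using T'' by simp
    fix s assume "s \<in> Inl ` S \<inter> verts (add_whiskers G S)"
    then obtain y where y: "y \<in> S" "s = Inl y" by auto
    have "?E (Inl y) (Inr y)" by (rule sym) (use y(1) in \<open>simp add: adj_whiskers_Inr\<close>)
    moreover have "Inr y \<in> verts (add_whiskers G S) - Inl ` S" using y(1) by (auto simp: verts_eq)
    ultimately show "\<exists>l\<in>verts (add_whiskers G S) - Inl ` S. ?E s l \<and>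
        (\<forall>v\<in>verts (add_whiskers G S). ?E l v \<longrightarrow> v = s)"
      using y(2) by (intro bexI[of _ "Inr y"]) (auto simp: adj_whiskers_Inr)
  qed
qed

section \<open>The theorem\<close>

theorem theorem3p3:
  fixes G :: "'a graph" and S :: "'a set"
  assumes "simple_graph G"
    and "S \<subseteq> verts G"
    and "chordal (delete_verts G S) \<or> is_cycle_graph 5 (delete_verts G S)"
  shows "sequentially_cohen_macaulay_graph TYPE('k::field) (add_whiskers G S)"
proof (rule sequentially_cohen_macaulay_if_vertex_decomposable)
  show "simple_graph (add_whiskers G S)" by (rule simple_add_whiskers[OF assms(1,2)])
  show "vertex_decomposable (\<lambda>u v. {u, v} \<in> edges (add_whiskers G S)) (verts (add_whiskers G S))"
    using vertex_decomposable_add_whiskers[OF assms] unfolding adj_def[abs_def] .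
qed

end
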